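(* Suppose there are constants $C_1,C_2,C_3,C_4>0$ and $t_1,t_3,t_4\ge0$, $t_2>0$ such that, for all sufficiently small $h>0$, $$C_1h^{t_1}\exp\big[-C_2(1/h)^{t_2}(\log(1/h))^{t_3}\big]\le\phi(\mathbf{x},h)\le C_3h^{t_4}\exp\big[-C_4(1/h)^{t_2}(\log(1/h))^{t_3}\big],$$ and let $m(h)=C_2(1/h)^{t_2}(\log(1/h))^{t_3}$ for $0<h<1$. Assume: (1) there are constants $0<l\le L$ with $l\le K(u)\le L$ for $0\le u\le1$, and $K(u)=0$ for $u>1$; (2) $\beta>0$ and for some $b_F>0$, $\|F(\mathbf{z})-F(\mathbf{x})\|\le b_F\,d(\mathbf{x},\mathbf{z})^\beta$ for all $\mathbf{z}$ in a neighborhood of $\mathbf{x}$; (3) for some $\nu>2$, $\mathbb{E}\big[\|G(\mathbf{Y})-\mathbb{E}[G(\mathbf{Y})\mid\mathbf{X}=\mathbf{z}]\|^\nu\mid\mathbf{X}=\mathbf{z}\big]$ is uniformly bounded for $\mathbf{z}$ in a neighborhood of $\mathbf{x}$; (4) for every bandwidth sequence with $h_n\to0$ and $n\phi(\mathbf{x},h_n)\to\infty$, $\widehat{\Theta}_n(\mathbf{x})-\Theta(\mathbf{x})=B_n(\mathbf{x})+V_n(\mathbf{x})+R_n(\mathbf{x})$ with $R_n(\mathbf{x})=o_{\mathbb{P}}(\delta_n)$, $\delta_n=\max\{h_n^\beta,[n\phi(\mathbf{x},h_n)]^{-1/2}\}$; (5) for some positive integer $i_0$, $\mathbb{V}(\mathbf{z})=\mathbb{E}\big[\big(\tilde{\phi}_{i_0}(\mathbb{L}_{\mathbf{x}}(G(\mathbf{Y})-\mathbb{E}[G(\mathbf{Y})\mid\mathbf{X}=\mathbf{z}]))\big)^2\,\big|\,\mathbf{X}=\mathbf{z}\big]$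 converges to $\mathbb{V}(\mathbf{x})$ as $\mathbf{z}\to\mathbf{x}$, and $\mathbb{V}(\mathbf{x})>0$. Let $\widehat{\Theta}_n^{(b)}(\mathbf{x})$ be the estimate constructed with a bandwidth sequence $h_n^{(b)}\to0$, $n\phi(\mathbf{x},h_n^{(b)})\to\infty$, such that $(h_n^{(b)})^{2\beta}n\phi(\mathbf{x},h_n^{(b)})$ is bounded and bounded away from $0$ as $n\to\infty$. Let $\widehat{\Theta}_n^{(op)}(\mathbf{x})$ be the estimate constructed with the optimum bandwidth $h_n^{(op)}$, which (for all large $n$) minimizes over $h\in(0,1)$ the function $f_n(h)=a\,h^{2\beta}+\frac{b}{nC_1}(1/h)^{t_1}\exp[m(h)]$, where $a,b>0$ are constants. Then, for any $\beta_1>\beta$ and any $\Theta(\cdot)$ whose corresponding $F$ satisfies $\|F(\mathbf{z})-F(\mathbf{x})\|\le b_F'\,d(\mathbf{x},\mathbf{z})^{\beta_1}$ for some $b_F'>0$ and all $\mathbf{z}$ in a neighborhood of $\mathbf{x}$, $$\frac{\big\|\widehat{\Theta}_n^{(op)}(\mathbf{x})-\Theta(\mathbf{x})\big\|}{\big\|\widehat{\Theta}_n^{(b)}(\mathbf{x})-\Theta(\mathbf{x})\big\|}=o_{\mathbb{P}}(1)\quad\text{as }n\to\infty.$$ Further, if $\mathbb{E}[\|R_n(\mathbf{x})\|^2]=o(\delta_n^2)$ as $n\to\infty$ (for both bandwidth sequences), then $$\frac{\mathbb{E}\big\|\widehat{\Theta}_n^{(op)}(\mathbf{x})-\Theta(\mathbf{x})\big\|^2}{\mathbb{E}\big\|\widehat{\Theta}_n^{(b)}(\mathbf{x})-\Theta(\mathbf{x})\big\|^2}=o(1)\quad\text{as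 }n\to\infty.$$
   Context: $(\mathcal{C},d)$ is a complete separable metric space, $\mathcal{R}$ is a measurable space, $(\mathbf{X},\mathbf{Y})$ is a random element of $\mathcal{C}\times\mathcal{R}$, and $(\mathbf{X}_i,\mathbf{Y}_i)$, $i\ge1$, are i.i.d. copies. A regular conditional distribution of $\mathbf{Y}$ given $\mathbf{X}=\mathbf{z}$ is fixed and $\mathbb{E}[\,\cdot\mid\mathbf{X}=\mathbf{z}]$ is taken with respect to it; Banach-space-valued expectations are in the Bochner sense. $\mathbf{x}\in\mathcal{C}$ is fixed and $\phi(\mathbf{x},h)=\mathbb{P}[d(\mathbf{x},\mathbf{X})\le h]$. $K:[0,\infty)\to[0,\infty)$ is a measurable kernel; bandwidths are positive and deterministic. $\mathcal{B}$ is a separable Banach space of type 2 (there is $c_0>0$ with $\mathbb{E}\|\sum_{i\le n}\mathbf{Z}_i\|^2\le c_0\sum_{i\le n}\mathbb{E}\|\mathbf{Z}_i\|^2$ for all $n$ and all independent zero-mean $\mathbf{Z}_i$ with finite second moments) with a Schauder basis $\{\mathbf{e}_i\}$; $\tilde{\phi}_i\in\mathcal{B}^*$ are the coordinate functionals, so $\mathbf{v}=\sum_i\tilde{\phi}_i(\mathbf{v})\mathbf{e}_i$ for all $\mathbf{v}\in\mathcal{B}$. $\mathcal{G}$ is a separable Banach space, $F:\mathcal{C}\to\mathcal{G}$ and $G:\mathcal{R}\to\mathcal{G}$ are measurable, $\mathbb{L}_{\mathbf{x}}:\mathcal{G}\to\mathcal{B}$ is continuous linear. The parameter $\Theta(\mathbf{x})\in\mathcal{B}$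 is a functional of the conditional distribution of $\mathbf{Y}$ given $\mathbf{X}=\mathbf{x}$, and its kernel estimate $\widehat{\Theta}_n(\mathbf{x})$ with bandwidth $h_n$ is the same functional of the weighted empirical measure putting mass $K(h_n^{-1}d(\mathbf{x},\mathbf{X}_i))/\sum_jK(h_n^{-1}d(\mathbf{x},\mathbf{X}_j))$ at $\mathbf{Y}_i$. Here $$B_n(\mathbf{x})=\mathbb{L}_{\mathbf{x}}\left(\frac{\sum_{i=1}^{n}F(\mathbf{X}_i)K(h_n^{-1}d(\mathbf{x},\mathbf{X}_i))}{\sum_{i=1}^{n}K(h_n^{-1}d(\mathbf{x},\mathbf{X}_i))}-F(\mathbf{x})\right),$$ $$V_n(\mathbf{x})=\mathbb{L}_{\mathbf{x}}\left(\frac{\sum_{i=1}^{n}\big[G(\mathbf{Y}_i)-\mathbb{E}[G(\mathbf{Y}_i)\mid\mathbf{X}_i]\big]K(h_n^{-1}d(\mathbf{x},\mathbf{X}_i))}{\sum_{i=1}^{n}K(h_n^{-1}d(\mathbf{x},\mathbf{X}_i))}\right),$$ and kernel quotients with zero denominator are read as $0$. The constants $a,b>0$ in $f_n$ are chosen so that $\mathbb{E}\|B_n(\mathbf{x})+V_n(\mathbf{x})\|^2\le f_n(h_n)$ for all sufficiently large $n$, whenever $h_n\to0$ and $n\phi(\mathbf{x},h_n)\to\infty$. A minimizer of $f_n$ over $(0,1)$ exists for all large $n$, and $h_n^{(op)}\to0$, $n\phi(\mathbf{x},h_n^{(op)})\to\infty$. *)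

theory Defs
  imports "HOL-Probability.Probability"
begin

section \<open>Geometry of the parameter space\<close>

text \<open>
  Type 2. A HOL definition cannot quantify over all sample-space types; it suffices to let the
  sample space range over the probability measures on \<^typ>\<open>nat \<Rightarrow> 'b\<close>, because finitely many
  random elements of \<^typ>\<open>'b\<close> on any probability space have their joint law there. Lemma
  type2_space_ineq below recovers the inequality on an arbitrary probability space.
\<close>

definition type2_space :: "'b::{banach, second_countable_topology} itself \<Rightarrow> bool" where
  "type2_space TYPE('b) \<longleftrightarrow>
    (\<exists>c\<^sub>0>0. \<forall>(P :: (nat \<Rightarrow> 'b) measure) (Z :: nat \<Rightarrow> (nat \<Rightarrow> 'b) \<Rightarrow> 'b) n.
       prob_space P \<longrightarrow>
       prob_space.indep_vars P (\<lambda>_. borel) Z {..<n} \<longrightarrow>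
       (\<forall>i<n. integrable P (\<lambda>\<omega>. (norm (Z i \<omega>))\<^sup>2) \<and> integral\<^sup>L P (Z i) = 0) \<longrightarrow>
       (\<integral>\<omega>. (norm (\<Sum>i<n. Z i \<omega>))\<^sup>2 \<partial>P) \<le> c\<^sub>0 * (\<Sum>i<n. \<integral>\<omega>. (norm (Z i \<omega>))\<^sup>2 \<partial>P))"

text \<open>
  The index set \<open>I\<close> is infinite for an infinite-dimensional space; finite \<open>I\<close> covers the
  finite-dimensional spaces, where padding a basis with zero vectors would destroy uniqueness.
\<close>

definition schauder_basis :: "nat set \<Rightarrow> (nat \<Rightarrow> 'b::real_normed_vector) \<Rightarrow> bool" where
  "schauder_basis I e \<longleftrightarrow>
    (\<forall>v. \<exists>!a :: nat \<Rightarrow> real. (\<forall>i. i \<notin> I \<longrightarrow> a i = 0) \<and> (\<lambda>i. a i *\<^sub>R e i) sums v)"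

definition coordinate_functionals ::
  "nat set \<Rightarrow> (nat \<Rightarrow> 'b::real_normed_vector) \<Rightarrow> (nat \<Rightarrow> 'b \<Rightarrow> real) \<Rightarrow> bool" where
  "coordinate_functionals I e \<phi> \<longleftrightarrow>
    (\<forall>i\<in>I. bounded_linear (\<phi> i)) \<and>
    (\<forall>v. (\<lambda>i. if i \<in> I then \<phi> i v *\<^sub>R e i else 0) sums v)"


section \<open>Probabilistic notions\<close>

definition regular_cond_distr ::
  "'w measure \<Rightarrow> 'r measure \<Rightarrow> ('w \<Rightarrow> 'c::topological_space) \<Rightarrow> ('w \<Rightarrow> 'r)
    \<Rightarrow> ('c \<Rightarrow> 'r measure) \<Rightarrow> bool" where
  "regular_cond_distr M R X Y \<kappa> \<longleftrightarrow>
    \<kappa> \<in> measurable borel (prob_algebra R) \<and>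
    (\<forall>A\<in>sets borel. \<forall>B\<in>sets R.
       emeasure M {\<omega>\<in>space M. X \<omega> \<in> A \<and> Y \<omega> \<in> B}
         = (\<integral>\<^sup>+z\<in>A. emeasure (\<kappa> z) B \<partial>distr M borel X))"

text \<open>
  \<open>W\<^sub>n = o\<^sub>P(r\<^sub>n)\<close> for nonnegative \<open>W\<^sub>n\<close>. The values are extended so that a ratio with vanishing
  denominator and positive numerator counts as infinite, as \<^typ>\<open>ennreal\<close> division does, and not
  as the \<open>0\<close> that real division would return.
\<close>

definition small_o_prob :: "'w measure \<Rightarrow> (nat \<Rightarrow> 'w \<Rightarrow> ennreal) \<Rightarrow> (nat \<Rightarrow> real) \<Rightarrow> bool" where
  "small_o_prob M W r \<longleftrightarrow>
    (\<forall>\<epsilon>>0. (\<lambda>n. measure M {\<omega>\<in>space M. W n \<omega> > ennreal (\<epsilon> * r n)}) \<longlonglongrightarrow> 0)"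

definition small_ball_prob ::
  "'w measure \<Rightarrow> ('w \<Rightarrow> 'c::metric_space) \<Rightarrow> 'c \<Rightarrow> real \<Rightarrow> real" where
  "small_ball_prob M X x h = measure M {\<omega>\<in>space M. dist x (X \<omega>) \<le> h}"

definition admissible_bandwidth :: "(real \<Rightarrow> real) \<Rightarrow> (nat \<Rightarrow> real) \<Rightarrow> bool" where
  "admissible_bandwidth \<phi> h \<longleftrightarrow>
    (\<forall>n. 0 < h n) \<and> h \<longlonglongrightarrow> 0 \<and> filterlim (\<lambda>n. real n * \<phi> (h n)) at_top sequentially"


section \<open>Kernel estimates\<close>

text \<open>
  Samples are indexed by \<open>1, \<dots>, n\<close>; \<open>xs i\<close> and \<open>ys i\<close> are realized values. All kernel
  quotients use division by the sum of the kernel values, hence vanish when that sum is \<open>0\<close>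
  (so \<open>weighted_empirical\<close> is then the zero measure).
\<close>

definition kernel_sum ::
  "(real \<Rightarrow> real) \<Rightarrow> 'c::metric_space \<Rightarrow> real \<Rightarrow> nat \<Rightarrow> (nat \<Rightarrow> 'c) \<Rightarrow> real" where
  "kernel_sum K x h n xs = (\<Sum>i=1..n. K (dist x (xs i) / h))"

definition weighted_empirical ::
  "'r measure \<Rightarrow> (real \<Rightarrow> real) \<Rightarrow> 'c::metric_space \<Rightarrow> real \<Rightarrow> nat \<Rightarrow> (nat \<Rightarrow> 'c)
    \<Rightarrow> (nat \<Rightarrow> 'r) \<Rightarrow> 'r measure" where
  "weighted_empirical R K x h n xs ys =
    measure_of (space R) (sets R)
      (\<lambda>A. \<Sum>i=1..n. ennreal (K (dist x (xs i) / h) / kernel_sum K x h n xs) * indicator A (ys i))"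

text \<open>
  \<open>T\<close> is the functional for which the parameter at \<open>z\<close> is \<open>T\<close> of the conditional distribution
  at \<open>z\<close>.
\<close>

definition kernel_estimate ::
  "('r measure \<Rightarrow> 'b) \<Rightarrow> 'r measure \<Rightarrow> (real \<Rightarrow> real) \<Rightarrow> 'c::metric_space \<Rightarrow> real \<Rightarrow> nat
    \<Rightarrow> (nat \<Rightarrow> 'c) \<Rightarrow> (nat \<Rightarrow> 'r) \<Rightarrow> 'b" where
  "kernel_estimate T R K x h n xs ys = T (weighted_empirical R K x h n xs ys)"

definition bias_term ::
  "('g::real_normed_vector \<Rightarrow> 'b) \<Rightarrow> ('c \<Rightarrow> 'g) \<Rightarrow> (real \<Rightarrow> real) \<Rightarrow> 'c::metric_space \<Rightarrow> real
    \<Rightarrow> nat \<Rightarrow> (nat \<Rightarrow> 'c) \<Rightarrow> 'b" where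
  "bias_term L F K x h n xs =
    L ((\<Sum>i=1..n. K (dist x (xs i) / h) *\<^sub>R F (xs i)) /\<^sub>R kernel_sum K x h n xs - F x)"

text \<open>
  The Bochner integral is \<open>0\<close> for non-integrable \<open>G\<close>. A finite moment of
  \<open>norm (G y - cond_mean \<kappa> G z)\<close> of order at least \<open>1\<close> under \<open>\<kappa> z\<close> rules this case out at \<open>z\<close>.
\<close>

definition cond_mean ::
  "('c \<Rightarrow> 'r measure) \<Rightarrow> ('r \<Rightarrow> 'g::{banach, second_countable_topology}) \<Rightarrow> 'c \<Rightarrow> 'g" where
  "cond_mean \<kappa> G z = (\<integral>y. G y \<partial>\<kappa> z)"

definition noise_term ::
  "('g::{banach, second_countable_topology} \<Rightarrow> 'b) \<Rightarrow> ('r \<Rightarrow> 'g) \<Rightarrow> ('c \<Rightarrow> 'r measure)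
    \<Rightarrow> (real \<Rightarrow> real) \<Rightarrow> 'c::metric_space \<Rightarrow> real \<Rightarrow> nat \<Rightarrow> (nat \<Rightarrow> 'c) \<Rightarrow> (nat \<Rightarrow> 'r) \<Rightarrow> 'b" where
  "noise_term L G \<kappa> K x h n xs ys =
    L ((\<Sum>i=1..n. K (dist x (xs i) / h) *\<^sub>R (G (ys i) - cond_mean \<kappa> G (xs i)))
        /\<^sub>R kernel_sum K x h n xs)"

definition remainder_term ::
  "('r measure \<Rightarrow> 'b::real_normed_vector) \<Rightarrow> 'r measure
    \<Rightarrow> ('g::{banach, second_countable_topology} \<Rightarrow> 'b) \<Rightarrow> ('c \<Rightarrow> 'g) \<Rightarrow> ('r \<Rightarrow> 'g)
    \<Rightarrow> ('c \<Rightarrow> 'r measure) \<Rightarrow> (real \<Rightarrow> real) \<Rightarrow> 'c::metric_space \<Rightarrow> real \<Rightarrow> nat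
    \<Rightarrow> (nat \<Rightarrow> 'c) \<Rightarrow> (nat \<Rightarrow> 'r) \<Rightarrow> 'b" where
  "remainder_term T R L F G \<kappa> K x h n xs ys =
    kernel_estimate T R K x h n xs ys - T (\<kappa> x)
      - (bias_term L F K x h n xs + noise_term L G \<kappa> K x h n xs ys)"

definition rate :: "(real \<Rightarrow> real) \<Rightarrow> real \<Rightarrow> (nat \<Rightarrow> real) \<Rightarrow> nat \<Rightarrow> real" where
  "rate \<phi> \<beta> h n = max (h n powr \<beta>) ((real n * \<phi> (h n)) powr (- 1 / 2))"

definition coord_cond_var ::
  "('b \<Rightarrow> real) \<Rightarrow> ('g::{banach, second_countable_topology} \<Rightarrow> 'b) \<Rightarrow> ('r \<Rightarrow> 'g)
    \<Rightarrow> ('c \<Rightarrow> 'r measure) \<Rightarrow> 'c \<Rightarrow> real" where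
  "coord_cond_var \<psi> L G \<kappa> z = (\<integral>y. (\<psi> (L (G y - cond_mean \<kappa> G z)))\<^sup>2 \<partial>\<kappa> z)"

definition log_rate :: "real \<Rightarrow> real \<Rightarrow> real \<Rightarrow> real \<Rightarrow> real" where
  "log_rate C t\<^sub>2 t\<^sub>3 h = C * (1 / h) powr t\<^sub>2 * (ln (1 / h)) powr t\<^sub>3"

definition bandwidth_objective ::
  "real \<Rightarrow> real \<Rightarrow> real \<Rightarrow> real \<Rightarrow> real \<Rightarrow> real \<Rightarrow> real \<Rightarrow> real \<Rightarrow> nat \<Rightarrow> real \<Rightarrow> real" where
  "bandwidth_objective a b \<beta> C\<^sub>1 C\<^sub>2 t\<^sub>1 t\<^sub>2 t\<^sub>3 n h =
    a * h powr (2 * \<beta>)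
      + b / (real n * C\<^sub>1) * (1 / h) powr t\<^sub>1 * exp (log_rate C\<^sub>2 t\<^sub>2 t\<^sub>3 h)"


section \<open>Basic facts about the definitions\<close>

lemma emeasure_weighted_empirical:
  fixes ys :: "nat \<Rightarrow> 'r"
  assumes A: "A \<in> sets R"
  shows "emeasure (weighted_empirical R K x h n xs ys) A =
    (\<Sum>i=1..n. ennreal (K (dist x (xs i) / h) / kernel_sum K x h n xs) * indicator A (ys i))"
  unfolding weighted_empirical_def
proof (rule emeasure_measure_of_sigma[OF sets.sigma_algebra_axioms _ _ A])
  let ?w = "\<lambda>i. ennreal (K (dist x (xs i) / h) / kernel_sum K x h n xs)"
  show "positive (sets R) (\<lambda>A. \<Sum>i=1..n. ?w i * indicator A (ys i))"
    by (simp add: positive_def)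
  show "countably_additive (sets R) (\<lambda>A. \<Sum>i=1..n. ?w i * indicator A (ys i))"
    unfolding countably_additive_def
  proof (intro allI impI)
    fix B :: "nat \<Rightarrow> 'r set"
    assume "disjoint_family B"
    then have "(\<Sum>k. indicator (B k) (ys i) :: ennreal) = indicator (\<Union>k. B k) (ys i)" for i
      by (rule suminf_indicator)
    then show "(\<Sum>k. \<Sum>i=1..n. ?w i * indicator (B k) (ys i))
        = (\<Sum>i=1..n. ?w i * indicator (\<Union>k. B k) (ys i))"
      by (subst suminf_sum) (simp_all add: ennreal_suminf_cmult)
  qed
qed

lemma type2_space_ineq:
  assumes "type2_space TYPE('b::{banach, second_countable_topology})"
  shows "\<exists>c\<^sub>0>0. \<forall>(P :: 'w measure) (Z :: nat \<Rightarrow> 'w \<Rightarrow> 'b) n.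
       prob_space P \<longrightarrow>
       prob_space.indep_vars P (\<lambda>_. borel) Z {..<n} \<longrightarrow>
       (\<forall>i<n. integrable P (\<lambda>\<omega>. (norm (Z i \<omega>))\<^sup>2) \<and> integral\<^sup>L P (Z i) = 0) \<longrightarrow>
       (\<integral>\<omega>. (norm (\<Sum>i<n. Z i \<omega>))\<^sup>2 \<partial>P) \<le> c\<^sub>0 * (\<Sum>i<n. \<integral>\<omega>. (norm (Z i \<omega>))\<^sup>2 \<partial>P)"
proof -
  obtain c where c: "c > 0" and ineq:
    "\<And>(P :: (nat \<Rightarrow> 'b) measure) (Z :: nat \<Rightarrow> (nat \<Rightarrow> 'b) \<Rightarrow> 'b) n.
       prob_space P \<Longrightarrow> prob_space.indep_vars P (\<lambda>_. borel) Z {..<n} \<Longrightarrow>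
       (\<And>i. i < n \<Longrightarrow> integrable P (\<lambda>\<omega>. (norm (Z i \<omega>))\<^sup>2) \<and> integral\<^sup>L P (Z i) = 0) \<Longrightarrow>
       (\<integral>\<omega>. (norm (\<Sum>i<n. Z i \<omega>))\<^sup>2 \<partial>P) \<le> c * (\<Sum>i<n. \<integral>\<omega>. (norm (Z i \<omega>))\<^sup>2 \<partial>P)"
    using assms unfolding type2_space_def by blast
  show ?thesis
  proof (intro exI[of _ c] conjI c allI impI)
    fix P :: "'w measure" and Z :: "nat \<Rightarrow> 'w \<Rightarrow> 'b" and n
    assume P: "prob_space P" and ind: "prob_space.indep_vars P (\<lambda>_. borel) Z {..<n}"
      and Z: "\<forall>i<n. integrable P (\<lambda>\<omega>. (norm (Z i \<omega>))\<^sup>2) \<and> integral\<^sup>L P (Z i) = 0"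
    interpret P: prob_space P by fact
    let ?N = "\<Pi>\<^sub>M i\<in>{..<n}. (borel :: 'b measure)"
    let ?f = "\<lambda>\<omega>. \<lambda>i\<in>{..<n}. Z i \<omega>"
    have Zm [measurable]: "i < n \<Longrightarrow> Z i \<in> borel_measurable P" for i
      using ind by (auto simp: P.indep_vars_def)
    have f [measurable]: "?f \<in> measurable P ?N"
      by (rule measurable_restrict) simp
    define Q where "Q = distr P ?N ?f"
    have [measurable_cong]: "sets Q = sets ?N" by (simp add: Q_def)
    interpret Q: prob_space Q
      unfolding Q_def by (rule P.prob_space_distr) (rule f)
    have comp [measurable]: "i < n \<Longrightarrow> (\<lambda>x. x i) \<in> borel_measurable ?N" for i
      by simp
    have law: "distr Q borel (\<lambda>x. x i) = distr P borel (Z i)" if "i < n" for i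
      unfolding Q_def using that
      by (subst distr_distr) (auto intro!: distr_cong simp: comp_def)
    have indQ: "Q.indep_vars (\<lambda>_. borel) (\<lambda>i x. x i) {..<n}"
    proof (cases "n = 0")
      case True
      then show ?thesis by (simp add: Q.indep_vars_def2 Q.indep_sets_def)
    next
      case False
      have "distr Q ?N (\<lambda>x. \<lambda>i\<in>{..<n}. x i) = distr P ?N ?f"
        unfolding Q_def
        by (subst distr_distr[OF measurable_restrict f]) (auto intro!: distr_cong simp: comp_def)
      also have "\<dots> = (\<Pi>\<^sub>M i\<in>{..<n}. distr P borel (Z i))"
        using False ind by (subst (asm) P.indep_vars_iff_distr_eq_PiM') auto
      also have "\<dots> = (\<Pi>\<^sub>M i\<in>{..<n}. distr Q borel (\<lambda>x. x i))"
        by (rule PiM_cong) (auto simp: law)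
      finally show ?thesis
        using False by (subst Q.indep_vars_iff_distr_eq_PiM') (auto simp: Q_def)
    qed
    have int: "integrable Q (\<lambda>x. (norm (x i))\<^sup>2) \<longleftrightarrow> integrable P (\<lambda>\<omega>. (norm (Z i \<omega>))\<^sup>2)"
      and int0: "(\<integral>x. x i \<partial>Q) = integral\<^sup>L P (Z i)"
      and int2: "(\<integral>x. (norm (x i))\<^sup>2 \<partial>Q) = (\<integral>\<omega>. (norm (Z i \<omega>))\<^sup>2 \<partial>P)" if "i < n" for i
      unfolding Q_def using that
      by (simp_all add: integrable_distr_eq integral_distr)
    have "(\<integral>\<omega>. (norm (\<Sum>i<n. Z i \<omega>))\<^sup>2 \<partial>P) = (\<integral>x. (norm (\<Sum>i<n. x i))\<^sup>2 \<partial>Q)"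
      unfolding Q_def by (subst integral_distr) (auto intro!: borel_measurable_sum)
    also have "\<dots> \<le> c * (\<Sum>i<n. \<integral>x. (norm (x i))\<^sup>2 \<partial>Q)"
      using Z by (intro ineq[OF Q.prob_space_axioms indQ]) (simp add: int int0)
    also have "\<dots> = c * (\<Sum>i<n. \<integral>\<omega>. (norm (Z i \<omega>))\<^sup>2 \<partial>P)"
      by (simp add: int2)
    finally show "(\<integral>\<omega>. (norm (\<Sum>i<n. Z i \<omega>))\<^sup>2 \<partial>P)
        \<le> c * (\<Sum>i<n. \<integral>\<omega>. (norm (Z i \<omega>))\<^sup>2 \<partial>P)" .
  qed
qed

end

theory Submission
  imports Defs "HOL-Real_Asymp.Real_Asymp"
begin

text \<open>
  The first-order condition at the minimizer \<open>hop\<close>, in the variable \<open>ln (1 / h)\<close>, shows that there the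
  variance part of the objective is smaller than \<open>hop powr (2 * \<beta>)\<close> by a factor of order \<open>1 / m(hop)\<close>. Hence
  \<open>n \<phi>(hop) hop powr (2 * \<beta>)\<close> tends to infinity. For a smoother \<open>F\<close> the bias at \<open>hop\<close> is also of smaller order
  than \<open>hop powr \<beta>\<close>, and so the whole error of the \<open>hop\<close> estimate is \<open>o(hop powr \<beta>)\<close>. Comparing values of the
  objective gives \<open>hop = O(hb)\<close>. At \<open>hb\<close>, on the other hand, the noise has the exact order \<open>hb powr \<beta>\<close>: a
  central limit theorem for triangular arrays, applied to one coordinate of its numerator, keeps it
  away from \<open>0\<close> on that scale.

  The second moment of the noise does not require conditioning on all covariates at once. If the number of
  observations in the ball exceeds a quarter of its mean, type 2 applied to the numerator suffices;
  otherwise the quotient is a convex combination of residuals, and a Chernoff bound, exponentially small in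
  \<open>n \<phi>(h)\<close>, absorbs the crude estimate.
\<close>

section \<open>The optimal bandwidth\<close>

text \<open>The two small-ball bounds need not match: if \<open>C\<^sub>2 > C\<^sub>4\<close>, they
  differ by a factor exponential in \<open>m\<close>, and the objective, which is built from the
  lower bound, may overstate the true variance by that factor. The argument survives because the two
  bounds are used at different places. At \<open>hop\<close> only the lower bound enters, combined
  with the first-order condition; the upper bound enters only at \<open>hb\<close>, where a constant
  dilation of the bandwidth makes up for the gap between the exponents.

  All errors are measured on the single scale \<open>hb n powr \<beta>\<close>. The extra smoothness
  of \<open>F\<close> matters at \<open>hb\<close> too: with exponent \<beta> alone the bias there
  could be as large as the noise, whereas with \<open>\<beta>\<^sub>1 > \<beta>\<close> bias and
  remainder are both negligible, so that the noise fixes the order of the error and nothing can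
  cancel it. A lower bound on a norm needs just one bounded functional, and the random denominator
  of the noise just an upper bound in probability. The limit theorem is therefore about sums of real
  i.i.d. variables, not about quotients in a Banach space.\<close>

lemma filterlim_log_rate:
  assumes "0 < C" "0 < t\<^sub>2" "0 \<le> t\<^sub>3"
  shows "filterlim (log_rate C t\<^sub>2 t\<^sub>3) at_top (at_right 0)"
proof (rule filterlim_at_top_mono)
  show "filterlim (\<lambda>h::real. C * (1 / h) powr t\<^sub>2) at_top (at_right 0)"
    using assms by real_asymp
  \<comment> \<open>Once \<open>h \<le> exp (- 1)\<close>, the logarithmic factor is at least 1, so
    the pure power is a lower bound.\<close>
  have "\<forall>\<^sub>F h::real in at_right 0. 1 \<le> ln (1 / h)"
    by real_asymp
  then show "\<forall>\<^sub>F h in at_right 0. C * (1 / h) powr t\<^sub>2 \<le> log_rate C t\<^sub>2 t\<^sub>3 h"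
  proof eventually_elim
    case (elim h)
    then have "C * (1 / h) powr t\<^sub>2 * 1 \<le> C * (1 / h) powr t\<^sub>2 * ln (1 / h) powr t\<^sub>3"
      using assms by (intro mult_left_mono ge_one_powr_ge_zero) auto
    then show ?case by (simp add: log_rate_def)
  qed
qed

text \<open>The choice of bandwidth is deterministic analysis: \<phi> is an arbitrary real function
  here, known only through its two-sided bound near 0.\<close>

locale bandwidth_choice =
  fixes \<phi> :: "real \<Rightarrow> real" and a b \<beta> C\<^sub>1 C\<^sub>2 C\<^sub>3 C\<^sub>4 t\<^sub>1 t\<^sub>2 t\<^sub>3 t\<^sub>4 :: real
    and hop :: "nat \<Rightarrow> real"
  assumes C_pos: "0 < C\<^sub>1" "0 < C\<^sub>2" "0 < C\<^sub>3" "0 < C\<^sub>4"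
    and t_range: "0 \<le> t\<^sub>1" "0 < t\<^sub>2" "0 \<le> t\<^sub>3" "0 \<le> t\<^sub>4"
    and small_ball: "\<forall>\<^sub>F h in at_right 0.
        C\<^sub>1 * h powr t\<^sub>1 * exp (- log_rate C\<^sub>2 t\<^sub>2 t\<^sub>3 h) \<le> \<phi> h \<and>
        \<phi> h \<le> C\<^sub>3 * h powr t\<^sub>4 * exp (- log_rate C\<^sub>4 t\<^sub>2 t\<^sub>3 h)"
    and ab: "0 < a" "0 < b" and \<beta>: "0 < \<beta>"
    and hop: "\<And>n. 0 < hop n"
      "\<forall>\<^sub>F n in sequentially. is_arg_min (bandwidth_objective a b \<beta> C\<^sub>1 C\<^sub>2 t\<^sub>1 t\<^sub>2 t\<^sub>3 n)
        (\<lambda>h. h \<in> {0<..<1}) (hop n)"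
begin

abbreviation f :: "nat \<Rightarrow> real \<Rightarrow> real" where
  "f \<equiv> bandwidth_objective a b \<beta> C\<^sub>1 C\<^sub>2 t\<^sub>1 t\<^sub>2 t\<^sub>3"

text \<open>This is \<open>b / n\<close> divided by the lower small-ball bound, so for small
  \<open>h\<close> it dominates \<open>b / (n * \<phi> h)\<close>, the order of the noise
  variance.\<close>

definition variance_part :: "nat \<Rightarrow> real \<Rightarrow> real" where
  "variance_part n h = b / (real n * C\<^sub>1) * (1 / h) powr t\<^sub>1 * exp (log_rate C\<^sub>2 t\<^sub>2 t\<^sub>3 h)"

lemma objective_eq: "f n h = a * h powr (2 * \<beta>) + variance_part n h"
  by (simp add: bandwidth_objective_def variance_part_def)

lemma variance_part_nonneg: "0 \<le> variance_part n h"
  using ab C_pos by (simp add: variance_part_def)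

lemma eventually_hop_le:
  "\<forall>\<^sub>F n in sequentially. 0 < n \<and> hop n < 1 \<and> (\<forall>h\<in>{0<..<1}. f n (hop n) \<le> f n h)"
  using hop(2) eventually_gt_at_top[of 0]
  by eventually_elim (auto simp: is_arg_min_def simp flip: not_less)

lemma bias_part_hop_le:
  "\<forall>\<^sub>F n in sequentially. \<forall>h\<in>{0<..<1}. a * hop n powr (2 * \<beta>) \<le> f n h"
  using eventually_hop_le
proof eventually_elim
  case (elim n)
  then show ?case using variance_part_nonneg[of n "hop n"] objective_eq[of n "hop n"] by force
qed

text \<open>A fixed bandwidth below \<open>y\<close> eventually beats every bandwidth that is at
  least \<open>y\<close>: its variance part vanishes as \<open>n\<close> grows, and its bias part is
  smaller than \<open>a * y powr (2 * \<beta>)\<close>.\<close>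

lemma hop_tendsto_0: "hop \<longlonglongrightarrow> 0"
proof (rule order_tendstoI)
  fix y :: real assume "y < 0"
  then show "\<forall>\<^sub>F n in sequentially. y < hop n"
    by (intro always_eventually allI) (meson hop(1) less_trans)
next
  fix y :: real assume y: "0 < y"
  define h where "h = min y 1 / 2"
  have h: "0 < h" "h < 1" "h < y" using y by (auto simp: h_def min_def)
  have "(\<lambda>n. f n h) \<longlonglongrightarrow> a * h powr (2 * \<beta>) + 0 * (1 / h) powr t\<^sub>1 * exp (log_rate C\<^sub>2 t\<^sub>2 t\<^sub>3 h)"
    unfolding bandwidth_objective_def using C_pos
    by (intro tendsto_intros) real_asymp
  moreover have "a * h powr (2 * \<beta>) < a * y powr (2 * \<beta>)"
    using h ab \<beta> by (simp add: powr_less_mono2)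
  ultimately have "\<forall>\<^sub>F n in sequentially. f n h < a * y powr (2 * \<beta>)"
    by (auto dest: order_tendstoD(2))
  then show "\<forall>\<^sub>F n in sequentially. hop n < y"
    using bias_part_hop_le
  proof eventually_elim
    case (elim n)
    then have "a * hop n powr (2 * \<beta>) < a * y powr (2 * \<beta>)"
      using h by force
    then have "hop n powr (2 * \<beta>) < y powr (2 * \<beta>)" using ab by simp
    then show ?case
      using \<beta> y hop(1)[of n] by (meson less_eq_real_def not_less powr_mono2 mult_pos_pos zero_less_numeral)
  qed
qed

lemma hop_at_right_0: "filterlim hop (at_right 0) sequentially"
  using hop(1) hop_tendsto_0 by (auto simp: filterlim_at less_imp_neq[symmetric])

text \<open>First-order condition at the minimizer, in the variable \<open>ln (1 / h)\<close>.\<close>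

lemma variance_part_hop_le:
  "\<forall>\<^sub>F n in sequentially.
     t\<^sub>2 * log_rate C\<^sub>2 t\<^sub>2 t\<^sub>3 (hop n) * variance_part n (hop n) \<le> 2 * a * \<beta> * hop n powr (2 * \<beta>)"
  using eventually_hop_le
proof eventually_elim
  case (elim n)
  define c where "c = b / (real n * C\<^sub>1)"
  \<comment> \<open>The substitution \<open>h = exp (- s)\<close> turns powers of \<open>h\<close>
    into exponentials; the derivative of the second summand is then that summand times a sum of
    nonnegative terms.\<close>
  define q where "q s = a * exp (- 2 * \<beta> * s) + c * exp (t\<^sub>1 * s + C\<^sub>2 * exp (t\<^sub>2 * s) * s powr t\<^sub>3)" for s
  define s where "s = - ln (hop n)"
  have c: "0 < c" using elim ab C_pos by (simp add: c_def)
  have s: "0 < s" and hs: "hop n = exp (- s)" using elim hop(1)[of n] by (simp_all add: s_def)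
  have q_eq: "f n (exp (- r)) = q r" if "0 < r" for r
    using that
    by (simp add: bandwidth_objective_def q_def c_def log_rate_def powr_def exp_add ln_div
        algebra_simps)
  let ?D = "t\<^sub>1 + C\<^sub>2 * (exp (t\<^sub>2 * s) * t\<^sub>2 * s powr t\<^sub>3 + exp (t\<^sub>2 * s) * (t\<^sub>3 * s powr (t\<^sub>3 - 1)))"
  let ?E = "exp (t\<^sub>1 * s + C\<^sub>2 * exp (t\<^sub>2 * s) * s powr t\<^sub>3)"
  have "(q has_real_derivative a * (exp (- 2 * \<beta> * s) * (- 2 * \<beta>)) + c * (?E * ?D)) (at s)"
    unfolding q_def using s
    by (auto intro!: derivative_eq_intros simp: algebra_simps)
  \<comment> \<open>The radius \<open>s\<close> keeps \<open>r\<close> positive, that is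
    \<open>exp (- r) < 1\<close>, so every competitor lies in the interval over which
    \<open>hop n\<close> is minimal.\<close>
  moreover have "\<forall>r. \<bar>s - r\<bar> < s \<longrightarrow> q s \<le> q r"
  proof (intro allI impI)
    fix r assume "\<bar>s - r\<bar> < s"
    then have "0 < r" by linarith
    then have "f n (hop n) \<le> f n (exp (- r))" using elim by simp
    then show "q s \<le> q r" using \<open>0 < r\<close> s by (simp add: q_eq hs)
  qed
  ultimately have "a * (exp (- 2 * \<beta> * s) * (- 2 * \<beta>)) + c * (?E * ?D) = 0"
    using s by (blast intro: DERIV_local_min)
  then have eq: "c * ?E * ?D = 2 * a * \<beta> * exp (- 2 * \<beta> * s)"
    by (simp add: algebra_simps)
  have v: "variance_part n (hop n) = c * ?E"
    using s by (simp add: variance_part_def c_def hs log_rate_def powr_def exp_add ln_div)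
  have r: "log_rate C\<^sub>2 t\<^sub>2 t\<^sub>3 (hop n) = C\<^sub>2 * exp (t\<^sub>2 * s) * s powr t\<^sub>3"
    using s by (simp add: hs log_rate_def powr_def ln_div)
  \<comment> \<open>Of the logarithmic derivative \<open>?D\<close> only the dominant term is kept,
    which is \<open>t\<^sub>2\<close> times \<open>log_rate\<close>; the dropped terms are
    nonnegative.\<close>
  have "t\<^sub>2 * (C\<^sub>2 * exp (t\<^sub>2 * s) * s powr t\<^sub>3) \<le> ?D"
    using t_range C_pos s by (simp add: algebra_simps)
  then have "c * ?E * (t\<^sub>2 * (C\<^sub>2 * exp (t\<^sub>2 * s) * s powr t\<^sub>3)) \<le> c * ?E * ?D"
    using c by (intro mult_left_mono) auto
  moreover have "hop n powr (2 * \<beta>) = exp (- 2 * \<beta> * s)"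
    by (simp add: hs powr_def)
  ultimately show ?case
    unfolding v r eq by (simp add: algebra_simps)
qed

text \<open>The variance part cancels: the lower small-ball bound gives
  \<open>b \<le> n * \<phi> (hop n) * variance_part n (hop n)\<close>, and inserting this into the
  first-order inequality leaves a multiple of \<open>log_rate\<close> at \<open>hop n\<close> as a
  lower bound.\<close>

lemma hop_signal_to_noise:
  "filterlim (\<lambda>n. hop n powr (2 * \<beta>) * (real n * \<phi> (hop n))) at_top sequentially"
proof (rule filterlim_at_top_mono)
  have "filterlim (\<lambda>n. log_rate C\<^sub>2 t\<^sub>2 t\<^sub>3 (hop n)) at_top sequentially"
    using C_pos t_range by (intro filterlim_compose[OF filterlim_log_rate hop_at_right_0]) auto
  then show "filterlim (\<lambda>n. b * t\<^sub>2 / (2 * a * \<beta>) * log_rate C\<^sub>2 t\<^sub>2 t\<^sub>3 (hop n)) at_top sequentially"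
    using ab \<beta> t_range by (intro filterlim_tendsto_pos_mult_at_top[OF tendsto_const]) auto
  show "\<forall>\<^sub>F n in sequentially. b * t\<^sub>2 / (2 * a * \<beta>) * log_rate C\<^sub>2 t\<^sub>2 t\<^sub>3 (hop n)
          \<le> hop n powr (2 * \<beta>) * (real n * \<phi> (hop n))"
    using variance_part_hop_le eventually_gt_at_top[of 0]
      eventually_compose_filterlim[OF small_ball hop_at_right_0]
  proof eventually_elim
    case (elim n)
    let ?m = "log_rate C\<^sub>2 t\<^sub>2 t\<^sub>3 (hop n)" and ?v = "variance_part n (hop n)"
    have v: "?v > 0" using elim ab C_pos hop(1)[of n] by (simp add: variance_part_def)
    have "real n * (C\<^sub>1 * hop n powr t\<^sub>1 * exp (- ?m)) * ?v = b"
      using elim C_pos hop(1)[of n]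
      by (simp add: variance_part_def powr_divide exp_minus field_simps)
    then have "b = real n * (C\<^sub>1 * hop n powr t\<^sub>1 * exp (- ?m)) * ?v" ..
    also have "\<dots> \<le> real n * \<phi> (hop n) * ?v"
      using elim v by (intro mult_right_mono mult_left_mono) auto
    finally have b: "b \<le> real n * \<phi> (hop n) * ?v" .
    have "b * (t\<^sub>2 * ?m * ?v) \<le> b * (2 * a * \<beta> * hop n powr (2 * \<beta>))"
      using elim ab by (intro mult_left_mono) auto
    also have "\<dots> \<le> (real n * \<phi> (hop n) * ?v) * (2 * a * \<beta> * hop n powr (2 * \<beta>))"
      using b ab \<beta> by (intro mult_right_mono) auto
    finally have "?v * (b * t\<^sub>2 * ?m) \<le> ?v * (2 * a * \<beta> * (hop n powr (2 * \<beta>) * (real n * \<phi> (hop n))))"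
      by (simp add: algebra_simps)
    then have "b * t\<^sub>2 * ?m \<le> 2 * a * \<beta> * (hop n powr (2 * \<beta>) * (real n * \<phi> (hop n)))"
      using v by simp
    then show ?case using ab \<beta> by (simp add: field_simps)
  qed
qed

text \<open>Since \<open>hop n < 1\<close> eventually, dropping the factor
  \<open>hop n powr (2 * \<beta>)\<close> from the product that tends to infinity only increases
  it.\<close>

lemma hop_admissible: "admissible_bandwidth \<phi> hop"
  unfolding admissible_bandwidth_def
proof (intro conjI allI hop(1) hop_tendsto_0)
  show "filterlim (\<lambda>n. real n * \<phi> (hop n)) at_top sequentially"
    using hop_signal_to_noise
  proof (rule filterlim_at_top_mono)
    have "\<forall>\<^sub>F n in sequentially. 0 < hop n powr (2 * \<beta>) * (real n * \<phi> (hop n))"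
      using hop_signal_to_noise by (simp add: filterlim_at_top_dense)
    then show "\<forall>\<^sub>F n in sequentially. hop n powr (2 * \<beta>) * (real n * \<phi> (hop n)) \<le> real n * \<phi> (hop n)"
      using eventually_hop_le
    proof eventually_elim
      case (elim n)
      have "0 \<le> real n * \<phi> (hop n)"
        using elim by (simp add: zero_less_mult_iff)
      moreover have "hop n powr (2 * \<beta>) \<le> 1"
        using elim hop(1)[of n] \<beta> by (intro powr_le1) auto
      ultimately show ?case by (intro mult_left_le_one_le) auto
    qed
  qed
qed

text \<open>
  Comparing \<open>hop\<close> with \<open>A * hb\<close>: for large \<open>A\<close> the exponent at \<open>A * hb\<close> is at most half of the one
  in the upper bound for \<open>\<phi> (hb n)\<close>, although \<open>C\<^sub>2\<close> may be larger than \<open>C\<^sub>4\<close>.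
\<close>

lemma hop_le_const_mult:
  assumes hb: "admissible_bandwidth \<phi> hb"
    and c: "0 < c" "\<forall>\<^sub>F n in sequentially. c \<le> hb n powr (2 * \<beta>) * real n * \<phi> (hb n)"
  shows "\<exists>A>0. \<forall>\<^sub>F n in sequentially. hop n \<le> A * hb n"
proof -
  have hb_pos: "\<And>n. 0 < hb n" and hb0: "hb \<longlonglongrightarrow> 0"
    using hb by (auto simp: admissible_bandwidth_def)
  have hb_right: "filterlim hb (at_right 0) sequentially"
    using hb_pos hb0 by (auto simp: filterlim_at less_imp_neq[symmetric])
  \<comment> \<open>The second entry gives
    \<open>A powr t\<^sub>2 \<ge> 2 * C\<^sub>2 / C\<^sub>4\<close>, which halves the exponent.
    \<open>A \<ge> 1\<close> ensures that the logarithm at \<open>A * h\<close> is at most the one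
    at \<open>h\<close>, and that \<open>(1 / A) powr t\<^sub>1 \<le> 1\<close>.\<close>
  define A where "A = max 1 ((2 * C\<^sub>2 / C\<^sub>4) powr (1 / t\<^sub>2))"
  have A: "1 \<le> A" by (simp add: A_def)
  have "2 * C\<^sub>2 / C\<^sub>4 = ((2 * C\<^sub>2 / C\<^sub>4) powr (1 / t\<^sub>2)) powr t\<^sub>2"
    using C_pos t_range by (simp add: powr_powr)
  also have "\<dots> \<le> A powr t\<^sub>2"
    using t_range by (intro powr_mono2) (auto simp: A_def)
  finally have A2: "C\<^sub>2 / A powr t\<^sub>2 \<le> C\<^sub>4 / 2"
    using A C_pos by (simp add: field_simps)
  have rate_le: "log_rate C\<^sub>2 t\<^sub>2 t\<^sub>3 (A * h) \<le> log_rate C\<^sub>4 t\<^sub>2 t\<^sub>3 h / 2" if h: "0 < h" "A * h < 1" for h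
  proof -
    have "0 < A * h" using h A by simp
    then have "0 \<le> ln (1 / (A * h))" using h by (intro ln_ge_zero) (simp add: field_simps)
    moreover have "ln (1 / (A * h)) \<le> ln (1 / h)" using h A by (simp add: ln_div ln_mult)
    ultimately have "ln (1 / (A * h)) powr t\<^sub>3 \<le> ln (1 / h) powr t\<^sub>3"
      using t_range by (intro powr_mono2) auto
    then have "log_rate C\<^sub>2 t\<^sub>2 t\<^sub>3 (A * h) \<le> C\<^sub>2 * (1 / (A * h)) powr t\<^sub>2 * ln (1 / h) powr t\<^sub>3"
      unfolding log_rate_def using C_pos by (intro mult_left_mono) auto
    also have "\<dots> = (C\<^sub>2 / A powr t\<^sub>2) * ((1 / h) powr t\<^sub>2 * ln (1 / h) powr t\<^sub>3)"
      using h A by (simp add: powr_divide powr_mult)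
    also have "\<dots> \<le> (C\<^sub>4 / 2) * ((1 / h) powr t\<^sub>2 * ln (1 / h) powr t\<^sub>3)"
      using A2 by (intro mult_right_mono) auto
    finally show ?thesis by (simp add: log_rate_def)
  qed
  \<comment> \<open>Half of the exponent pays for the variance part at \<open>A * h\<close>; the
    other half must absorb the polynomial factor \<open>(1 / h) powr t\<^sub>1\<close>.\<close>
  have "((\<lambda>h. (1 / h) powr t\<^sub>1 * exp (- (C\<^sub>4 / 2 * (1 / h) powr t\<^sub>2))) \<longlongrightarrow> 0) (at_right 0)"
    using C_pos t_range by real_asymp
  then have bd1: "\<forall>\<^sub>F h in at_right 0. (1 / h) powr t\<^sub>1 * exp (- (C\<^sub>4 / 2 * (1 / h) powr t\<^sub>2)) < 1"
    by (rule order_tendstoD) simp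
  have bd2: "\<forall>\<^sub>F h::real in at_right 0. 1 \<le> ln (1 / h)" and bd3: "\<forall>\<^sub>F h::real in at_right 0. A * h < 1"
    and bd4: "\<forall>\<^sub>F h::real in at_right 0. h < 1"
    using A by real_asymp+
  \<comment> \<open>The summands come from the bias part and from the variance part of the objective
    at \<open>A * hb n\<close>, both expressed as multiples of
    \<open>hb n powr (2 * \<beta>)\<close>.\<close>
  define D where "D = a * A powr (2 * \<beta>) + b * C\<^sub>3 / (c * C\<^sub>1)"
  have D: "0 < D" using ab c C_pos A by (auto simp: D_def intro!: add_pos_pos)
  have main: "\<forall>\<^sub>F n in sequentially. a * hop n powr (2 * \<beta>) \<le> D * hb n powr (2 * \<beta>)"
    using bias_part_hop_le c(2) eventually_gt_at_top[of 0]
      eventually_compose_filterlim[OF small_ball hb_right]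
      eventually_compose_filterlim[OF bd1 hb_right] eventually_compose_filterlim[OF bd2 hb_right]
      eventually_compose_filterlim[OF bd3 hb_right] eventually_compose_filterlim[OF bd4 hb_right]
  proof eventually_elim
    case (elim n)
    let ?h = "hb n"
    have h: "0 < ?h" by (rule hb_pos)
    let ?r = "log_rate C\<^sub>4 t\<^sub>2 t\<^sub>3 ?h"
    have "c \<le> ?h powr (2 * \<beta>) * real n * \<phi> ?h" using elim by simp
    also have "\<dots> \<le> ?h powr (2 * \<beta>) * real n * (C\<^sub>3 * 1 * exp (- ?r))"
    proof (intro mult_left_mono)
      have "\<phi> ?h \<le> C\<^sub>3 * ?h powr t\<^sub>4 * exp (- ?r)" using elim by simp
      also have "\<dots> \<le> C\<^sub>3 * 1 * exp (- ?r)"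
        using C_pos h elim t_range by (intro mult_right_mono mult_left_mono powr_le1) auto
      finally show "\<phi> ?h \<le> C\<^sub>3 * 1 * exp (- ?r)" .
    qed auto
    \<comment> \<open>The lower bound \<open>c\<close>, combined with the upper bound for \<phi>, is
      solved for \<open>1 / n\<close>; this eliminates the sample size from the variance
      part.\<close>
    finally have n: "1 / real n \<le> ?h powr (2 * \<beta>) * (C\<^sub>3 / c) * exp (- ?r)"
      using elim(3) c by (simp add: field_simps)
    have "variance_part n (A * ?h) = b / C\<^sub>1 * (1 / real n) * ((1 / A) powr t\<^sub>1 * (1 / ?h) powr t\<^sub>1)
        * exp (log_rate C\<^sub>2 t\<^sub>2 t\<^sub>3 (A * ?h))"
      using A h by (simp add: variance_part_def powr_divide powr_mult)
    also have "\<dots> \<le> b / C\<^sub>1 * (?h powr (2 * \<beta>) * (C\<^sub>3 / c) * exp (- ?r)) * (1 * (1 / ?h) powr t\<^sub>1)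
        * exp (?r / 2)"
      using n A h elim rate_le[of ?h] ab C_pos t_range c
      by (intro mult_mono order.refl) (auto intro!: powr_le1 mult_nonneg_nonneg)
    also have "\<dots> = b * C\<^sub>3 / (c * C\<^sub>1) * ?h powr (2 * \<beta>) * ((1 / ?h) powr t\<^sub>1 * exp (- (?r / 2)))"
      using mult_exp_exp[of "- ?r" "?r / 2"] by (simp add: field_simps)
    also have "\<dots> \<le> b * C\<^sub>3 / (c * C\<^sub>1) * ?h powr (2 * \<beta>) * 1"
    proof (intro mult_left_mono)
      have "C\<^sub>4 / 2 * (1 / ?h) powr t\<^sub>2 \<le> ?r / 2"
        using elim C_pos t_range
          mult_left_mono[OF ge_one_powr_ge_zero[of "ln (1 / ?h)" t\<^sub>3], of "C\<^sub>4 / 2 * (1 / ?h) powr t\<^sub>2"]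
        by (auto simp: log_rate_def)
      then have "(1 / ?h) powr t\<^sub>1 * exp (- (?r / 2)) \<le> (1 / ?h) powr t\<^sub>1 * exp (- (C\<^sub>4 / 2 * (1 / ?h) powr t\<^sub>2))"
        by (intro mult_left_mono) auto
      then show "(1 / ?h) powr t\<^sub>1 * exp (- (?r / 2)) \<le> 1" using elim by linarith
    qed (use ab C_pos c in auto)
    finally have "f n (A * ?h) \<le> D * ?h powr (2 * \<beta>)"
      using A h by (simp add: objective_eq D_def powr_mult algebra_simps)
    moreover have "a * hop n powr (2 * \<beta>) \<le> f n (A * ?h)"
      using elim A h by auto
    ultimately show ?case by linarith
  qed
  have "\<forall>\<^sub>F n in sequentially. hop n \<le> (D / a) powr (1 / (2 * \<beta>)) * hb n"
    using main
  proof eventually_elim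
    case (elim n)
    have "hop n = (hop n powr (2 * \<beta>)) powr (1 / (2 * \<beta>))"
      using hop(1)[of n] \<beta> by (simp add: powr_powr)
    also have "\<dots> \<le> (D / a * hb n powr (2 * \<beta>)) powr (1 / (2 * \<beta>))"
      using elim ab \<beta> by (intro powr_mono2) (auto simp: field_simps)
    also have "\<dots> = (D / a) powr (1 / (2 * \<beta>)) * hb n"
      using hb_pos[of n] \<beta> D ab powr_mult[of "D / a" "hb n powr (2 * \<beta>)"] by (simp add: powr_powr)
    finally show ?case .
  qed
  then show ?thesis using D ab by (intro exI[of _ "(D / a) powr (1 / (2 * \<beta>))"]) auto
qed

end

section \<open>A central limit theorem for triangular arrays\<close>

text \<open>For \<open>0 < \<nu> - 2 \<le> 1\<close> the power
  \<open>(s * \<bar>x\<bar>) powr (\<nu> - 2)\<close> is at least the smaller of 1 and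
  \<open>s * \<bar>x\<bar>\<close>. The left side is the truncated Taylor remainder of a
  characteristic function, which thereby becomes a moment of order \<nu>.\<close>

lemma powr_cube_interpolate:
  fixes s :: real
  assumes "2 < \<nu>" "\<nu> \<le> 3" "0 \<le> s"
  shows "min (6 * x\<^sup>2) (s * \<bar>x\<bar> ^ 3) \<le> 6 * s powr (\<nu> - 2) * \<bar>x\<bar> powr \<nu>"
proof (cases "x = 0 \<or> s = 0")
  case False
  then have x: "0 < \<bar>x\<bar>" and s: "0 < s" using assms by auto
  have e: "6 * s powr (\<nu> - 2) * \<bar>x\<bar> powr \<nu> = 6 * x\<^sup>2 * (s * \<bar>x\<bar>) powr (\<nu> - 2)"
    using x s by (simp add: powr_mult powr_diff)
  show ?thesis
  proof (cases "s * \<bar>x\<bar> \<le> 1")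
    case True
    have "s * \<bar>x\<bar> = (s * \<bar>x\<bar>) powr 1" using x s by simp
    also have "\<dots> \<le> (s * \<bar>x\<bar>) powr (\<nu> - 2)"
      using True x s assms by (intro powr_mono') auto
    finally have "x\<^sup>2 * (s * \<bar>x\<bar>) \<le> x\<^sup>2 * (s * \<bar>x\<bar>) powr (\<nu> - 2)"
      by (intro mult_left_mono) auto
    moreover have "0 \<le> x\<^sup>2 * (s * \<bar>x\<bar>) powr (\<nu> - 2)" by simp
    moreover have "s * \<bar>x\<bar> ^ 3 = x\<^sup>2 * (s * \<bar>x\<bar>)"
      by (simp add: power3_eq_cube power2_eq_square)
    ultimately have "s * \<bar>x\<bar> ^ 3 \<le> 6 * x\<^sup>2 * (s * \<bar>x\<bar>) powr (\<nu> - 2)" by linarith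
    then show ?thesis unfolding e by linarith
  next
    case False
    then have "1 \<le> (s * \<bar>x\<bar>) powr (\<nu> - 2)" using assms by (intro ge_one_powr_ge_zero) auto
    then have "6 * x\<^sup>2 * 1 \<le> 6 * x\<^sup>2 * (s * \<bar>x\<bar>) powr (\<nu> - 2)" by (intro mult_left_mono) auto
    then show ?thesis unfolding e by (simp add: min_le_iff_disj)
  qed
qed auto

text \<open>By Levy continuity it suffices to compare the characteristic function of a row, an
  \<open>n\<close>-th power, with \<open>(1 - t^2 / (2 * n)) ^ n\<close>; the difference is
  controlled by the Lyapunov ratio. The moment hypotheses are only eventual because in the
  application they hold once the bandwidth is small.\<close>

theorem (in prob_space) lyapunov_clt_iid_rows:
  fixes W :: "nat \<Rightarrow> nat \<Rightarrow> 'a \<Rightarrow> real" and Q :: "nat \<Rightarrow> real measure"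
  assumes indep: "\<And>n. indep_vars (\<lambda>_. borel) (W n) {1..n}"
    and law: "\<And>n i. i \<in> {1..n} \<Longrightarrow> distr M borel (W n i) = Q n"
    and Q: "\<And>n. real_distribution (Q n)"
    and mean: "\<forall>\<^sub>F n in sequentially. integrable (Q n) (\<lambda>x. x) \<and> (\<integral>x. x \<partial>Q n) = 0"
    and \<nu>: "2 < \<nu>" "\<nu> \<le> 3"
    and moment: "\<forall>\<^sub>F n in sequentially. integrable (Q n) (\<lambda>x. \<bar>x\<bar> powr \<nu>)"
    and sq: "\<forall>\<^sub>F n in sequentially. integrable (Q n) (\<lambda>x. x\<^sup>2) \<and> 0 < (\<integral>x. x\<^sup>2 \<partial>Q n)"
    and lyapunov: "(\<lambda>n. real n * (\<integral>x. \<bar>x\<bar> powr \<nu> \<partial>Q n) / (real n * (\<integral>x. x\<^sup>2 \<partial>Q n)) powr (\<nu> / 2))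
       \<longlonglongrightarrow> 0"
  shows "weak_conv_m (\<lambda>n. distr M borel (\<lambda>\<omega>. (\<Sum>i=1..n. W n i \<omega>) / sqrt (real n * (\<integral>x. x\<^sup>2 \<partial>Q n))))
    std_normal_distribution"
proof (rule levy_continuity)
  have [measurable]: "W n i \<in> borel_measurable M" if "i \<in> {1..n}" for n i
    using indep that unfolding indep_vars_def by blast
  let ?N = "\<lambda>n \<omega>. (\<Sum>i=1..n. W n i \<omega>) / sqrt (real n * (\<integral>x. x\<^sup>2 \<partial>Q n))"
  show "real_distribution (distr M borel (?N n))" for n
    by (intro real_distribution_distr) measurable
  show "real_distribution std_normal_distribution" by (rule real_dist_normal_dist)
  fix t :: real
  have bound: "\<forall>\<^sub>F n in sequentially. cmod (char (distr M borel (?N n)) t - complex_of_real ((1 + (- t\<^sup>2 / 2) / real n) ^ n))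
      \<le> t\<^sup>2 * \<bar>t\<bar> powr (\<nu> - 2) * (real n * (\<integral>x. \<bar>x\<bar> powr \<nu> \<partial>Q n) / (real n * (\<integral>x. x\<^sup>2 \<partial>Q n)) powr (\<nu> / 2))"
    using mean moment sq eventually_gt_at_top[of 0] eventually_ge_at_top[of "nat \<lceil>t\<^sup>2\<rceil>"]
  proof eventually_elim
    case (elim n)
    interpret Q: real_distribution "Q n" by (rule Q)
    define v where "v = (\<integral>x. x\<^sup>2 \<partial>Q n)"
    define r where "r = sqrt (real n * v)"
    define u where "u = t / r"
    have r: "0 < r" and n: "0 < real n" and v: "0 < v" and t: "t\<^sup>2 \<le> real n"
      using elim by (auto simp: r_def v_def le_nat_iff nat_le_iff ceiling_le_iff)
    have char_row: "char (distr M borel (\<lambda>\<omega>. W n i \<omega> / r)) t = char (Q n) u" if "i \<in> {1..n}" for i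
      using that by (subst law[OF that, symmetric]) (simp add: char_def integral_distr u_def)
    have "char (distr M borel (?N n)) t = char (distr M borel (\<lambda>\<omega>. \<Sum>i=1..n. W n i \<omega> / r)) t"
      by (simp add: r_def v_def sum_divide_distrib)
    also have "\<dots> = (\<Prod>i=1..n. char (distr M borel (\<lambda>\<omega>. W n i \<omega> / r)) t)"
      by (intro char_distr_sum indep_vars_compose2[OF indep]) auto
    also have "\<dots> = char (Q n) u ^ n" by (simp add: char_row)
    finally have eq: "char (distr M borel (?N n)) t = char (Q n) u ^ n" .
    \<comment> \<open>The normalization by the standard deviation of the row makes the quadratic
      term of the expansion exactly \<open>t^2 / (2 * n)\<close>.\<close>
    have u2: "u\<^sup>2 * v = t\<^sup>2 / n" using r n v by (simp add: u_def r_def power_divide)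
    have "cmod (char (Q n) u - (1 - u\<^sup>2 * v / 2))
        \<le> u\<^sup>2 / 6 * (\<integral>x. min (6 * x\<^sup>2) (\<bar>u\<bar> * \<bar>x\<bar> ^ 3) \<partial>Q n)"
      using elim by (intro Q.char_approx3) (auto simp: v_def)
    also have "\<dots> \<le> u\<^sup>2 / 6 * (\<integral>x. 6 * \<bar>u\<bar> powr (\<nu> - 2) * \<bar>x\<bar> powr \<nu> \<partial>Q n)"
    proof (intro mult_left_mono integral_mono)
      show "integrable (Q n) (\<lambda>x. min (6 * x\<^sup>2) (\<bar>u\<bar> * \<bar>x\<bar> ^ 3))"
        by (rule Bochner_Integration.integrable_bound[of _ "\<lambda>x. 6 * x\<^sup>2"]) (use elim in auto)
      show "min (6 * x\<^sup>2) (\<bar>u\<bar> * \<bar>x\<bar> ^ 3) \<le> 6 * \<bar>u\<bar> powr (\<nu> - 2) * \<bar>x\<bar> powr \<nu>" for x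
        using \<nu> by (intro powr_cube_interpolate) auto
    qed (use elim in auto)
    also have "\<dots> = u\<^sup>2 * \<bar>u\<bar> powr (\<nu> - 2) * (\<integral>x. \<bar>x\<bar> powr \<nu> \<partial>Q n)" by simp
    finally have one: "cmod (char (Q n) u - complex_of_real (1 + (- t\<^sup>2 / 2) / real n))
        \<le> u\<^sup>2 * \<bar>u\<bar> powr (\<nu> - 2) * (\<integral>x. \<bar>x\<bar> powr \<nu> \<partial>Q n)"
      using u2 by (simp add: mult.commute[of 2])
    have "cmod (char (Q n) u ^ n - complex_of_real (1 + (- t\<^sup>2 / 2) / real n) ^ n)
        \<le> n * cmod (char (Q n) u - complex_of_real (1 + (- t\<^sup>2 / 2) / real n))"
    proof (rule norm_power_diff)
      \<comment> \<open>Powers differ by at most \<open>n\<close> times the difference of the bases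
        only if both bases lie in the unit disk; \<open>t^2 \<le> n\<close> guarantees this for the
        real one.\<close>
      have "\<bar>1 + (- t\<^sup>2 / 2) / real n\<bar> \<le> 1" using t n by (auto simp: abs_le_iff field_simps)
      then show "cmod (complex_of_real (1 + (- t\<^sup>2 / 2) / real n)) \<le> 1"
        by (simp only: norm_of_real)
    qed (rule Q.cmod_char_le_1)
    also have "\<dots> \<le> n * (u\<^sup>2 * \<bar>u\<bar> powr (\<nu> - 2) * (\<integral>x. \<bar>x\<bar> powr \<nu> \<partial>Q n))"
      using one by (intro mult_left_mono) auto
    also have "u\<^sup>2 * \<bar>u\<bar> powr (\<nu> - 2) = t\<^sup>2 * \<bar>t\<bar> powr (\<nu> - 2) / (r\<^sup>2 * r powr (\<nu> - 2))"
      using r by (simp add: u_def power_divide powr_divide abs_divide)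
    also have "r\<^sup>2 * r powr (\<nu> - 2) = r powr \<nu>"
      using r by (simp add: powr_diff)
    also have "r powr \<nu> = (real n * v) powr (\<nu> / 2)"
      using n v by (simp add: r_def powr_half_sqrt[symmetric] powr_powr)
    finally show ?case
      unfolding eq v_def of_real_power by (simp add: algebra_simps)
  qed
  have "(\<lambda>n. t\<^sup>2 * \<bar>t\<bar> powr (\<nu> - 2) * (real n * (\<integral>x. \<bar>x\<bar> powr \<nu> \<partial>Q n) / (real n * (\<integral>x. x\<^sup>2 \<partial>Q n)) powr (\<nu> / 2))) \<longlonglongrightarrow> 0"
    using tendsto_mult_right_zero[OF lyapunov] by blast
  then have "(\<lambda>n. char (distr M borel (?N n)) t - complex_of_real ((1 + (- t\<^sup>2 / 2) / real n) ^ n)) \<longlonglongrightarrow> 0"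
    by (rule Lim_null_comparison[OF bound])
  moreover have "(\<lambda>n. complex_of_real ((1 + (-(t^2) / 2) / n)^n)) \<longlonglongrightarrow> complex_of_real (exp (-(t^2) / 2))"
    by (rule isCont_tendsto_compose [OF _ tendsto_exp_limit_sequentially]) auto
  ultimately show "(\<lambda>n. char (distr M borel (?N n)) t) \<longlonglongrightarrow> char std_normal_distribution t"
    unfolding char_std_normal_distribution by (rule Lim_transform[rotated])
qed

lemma std_normal_small_interval:
  assumes "0 \<le> \<epsilon>"
  shows "measure std_normal_distribution {-\<epsilon>..\<epsilon>} \<le> 2 * \<epsilon>"
proof -
  have "emeasure std_normal_distribution {-\<epsilon>..\<epsilon>} = (\<integral>\<^sup>+x\<in>{-\<epsilon>..\<epsilon>}. ennreal (std_normal_density x) \<partial>lborel)"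
    by (subst emeasure_density) auto
  also have "\<dots> \<le> (\<integral>\<^sup>+x. indicator {-\<epsilon>..\<epsilon>} x \<partial>lborel)"
  proof (intro nn_integral_mono)
    fix x :: real
    have "1 \<le> sqrt (2 * pi)" using pi_ge_two by (intro real_le_rsqrt) auto
    then have "std_normal_density x \<le> 1"
      unfolding std_normal_density_def by (intro mult_le_one) (auto simp: field_simps)
    then show "ennreal (std_normal_density x) * indicator {-\<epsilon>..\<epsilon>} x \<le> indicator {-\<epsilon>..\<epsilon>} x"
      by (auto simp: indicator_def ennreal_le_1)
  qed
  also have "\<dots> = ennreal (2 * \<epsilon>)" using assms by simp
  finally show ?thesis using assms by (simp add: measure_def enn2real_leI)
qed

text \<open>The endpoints are null for the normal law, so the probabilities converge; the constant 3
  instead of 2 leaves room to pass from the limit to a bound for all large \<open>n\<close>.\<close>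

lemma weak_conv_std_normal_small_interval:
  assumes N: "\<And>n. real_distribution (N n)" and conv: "weak_conv_m N std_normal_distribution"
    and \<epsilon>: "0 < \<epsilon>"
  shows "\<forall>\<^sub>F n in sequentially. measure (N n) {-\<epsilon>..\<epsilon>} < 3 * \<epsilon>"
proof -
  interpret S: real_distribution std_normal_distribution by (rule real_dist_normal_dist)
  have "frontier {-\<epsilon>..\<epsilon>} = {-\<epsilon>, \<epsilon>}"
    using \<epsilon> by (auto simp: frontier_def)
  then have "emeasure std_normal_distribution (frontier {-\<epsilon>..\<epsilon>}) = 0"
    by (auto simp: emeasure_density finite_imp_null_set_lborel intro!: nn_integral_null_set)
  then have "(\<lambda>n. measure (N n) {-\<epsilon>..\<epsilon>}) \<longlonglongrightarrow> measure std_normal_distribution {-\<epsilon>..\<epsilon>}"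
    by (intro weak_conv_imp_continuity_set_conv[OF N S.real_distribution_axioms conv]) auto
  moreover have "measure std_normal_distribution {-\<epsilon>..\<epsilon>} < 3 * \<epsilon>"
    using std_normal_small_interval[of \<epsilon>] \<epsilon> by simp
  ultimately show ?thesis by (rule order_tendstoD)
qed

section \<open>Observations in small balls\<close>

text \<open>The sample is indexed from 1, whereas the type 2 inequality speaks of
  \<open>{..<n}\<close>; a shift by \<open>Suc\<close> has to carry independence across.\<close>

lemma (in prob_space) indep_vars_reindex_inj:
  assumes X: "indep_vars N X (f ` J)" and f: "inj_on f J"
  shows "indep_vars (\<lambda>j. N (f j)) (\<lambda>j. X (f j)) J"
  unfolding indep_vars_def2 indep_sets_def
proof (intro conjI ballI allI impI)
  fix j assume "j \<in> J"
  then show "random_variable (N (f j)) (X (f j))"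
    using X unfolding indep_vars_def2 by blast
next
  have X2: "indep_sets (\<lambda>i. {X i -` A \<inter> space M |A. A \<in> sets (N i)}) (f ` J)"
    using X unfolding indep_vars_def2 by simp
  then show "{X (f j) -` A \<inter> space M |A. A \<in> sets (N (f j))} \<subseteq> events" if "j \<in> J" for j
    using that unfolding indep_sets_def by blast
  fix J' A
  assume J': "J' \<subseteq> J" "J' \<noteq> {}" "finite J'"
    and A: "A \<in> Pi J' (\<lambda>j. {X (f j) -` A \<inter> space M |A. A \<in> sets (N (f j))})"
  define g where "g = the_inv_into J' f"
  have inj: "inj_on f J'" using f J' by (meson inj_on_subset)
  have g: "g (f j) = j" if "j \<in> J'" for j
    using inj that by (simp add: g_def the_inv_into_f_f)
  have "prob (\<Inter>i\<in>f ` J'. (A \<circ> g) i) = (\<Prod>i\<in>f ` J'. prob ((A \<circ> g) i))"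
    using J' A g by (intro indep_setsD[OF X2]) (auto simp: Pi_iff)
  then show "prob (\<Inter>j\<in>J'. A j) = (\<Prod>j\<in>J'. prob (A j))"
    using g inj by (simp add: prod.reindex cong: INF_cong_simp prod.cong)
qed

section \<open>The sampling model and the disintegration of the joint law\<close>

locale kernel_sample = prob_space M for M :: "'w measure" +
  fixes R :: "'r measure"
    and X :: "'w \<Rightarrow> 'c::polish_space" and Y :: "'w \<Rightarrow> 'r"
    and Xs :: "nat \<Rightarrow> 'w \<Rightarrow> 'c" and Ys :: "nat \<Rightarrow> 'w \<Rightarrow> 'r"
    and \<kappa> :: "'c \<Rightarrow> 'r measure"
    and x :: 'c
    and K :: "real \<Rightarrow> real" and l\<^sub>K L\<^sub>K :: real
  assumes X_meas [measurable]: "X \<in> measurable M borel"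
    and Y_meas [measurable]: "Y \<in> measurable M R"
    and sample_indep: "indep_vars (\<lambda>_. borel \<Otimes>\<^sub>M R) (\<lambda>i \<omega>. (Xs i \<omega>, Ys i \<omega>)) {1..}"
    and sample_law: "\<And>i. i \<ge> 1 \<Longrightarrow> distr M (borel \<Otimes>\<^sub>M R) (\<lambda>\<omega>. (Xs i \<omega>, Ys i \<omega>))
                    = distr M (borel \<Otimes>\<^sub>M R) (\<lambda>\<omega>. (X \<omega>, Y \<omega>))"
    and rcd: "regular_cond_distr M R X Y \<kappa>"
    and K_meas: "K \<in> borel_measurable (restrict_space borel {0..})"
    and K_bounds: "0 < l\<^sub>K" "l\<^sub>K \<le> L\<^sub>K"
      "\<And>u. 0 \<le> u \<Longrightarrow> u \<le> 1 \<Longrightarrow> l\<^sub>K \<le> K u \<and> K u \<le> L\<^sub>K"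
      "\<And>u. 1 < u \<Longrightarrow> K u = 0"
begin

abbreviation \<phi> :: "real \<Rightarrow> real" where "\<phi> \<equiv> small_ball_prob M X x"

abbreviation P\<^sub>X :: "'c measure" where "P\<^sub>X \<equiv> distr M borel X"

definition D :: "('c \<times> 'r) measure" where
  "D = distr M (borel \<Otimes>\<^sub>M R) (\<lambda>\<omega>. (X \<omega>, Y \<omega>))"

abbreviation ind :: "real \<Rightarrow> 'c \<Rightarrow> real" where "ind h \<equiv> indicator {z. dist x z \<le> h}"

definition count :: "real \<Rightarrow> nat \<Rightarrow> 'w \<Rightarrow> real" where
  "count h n \<omega> = (\<Sum>i=1..n. ind h (Xs i \<omega>))"

lemma sets_D [measurable_cong]: "sets D = sets (borel \<Otimes>\<^sub>M R)" and space_D [simp]: "space D = UNIV \<times> space R"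
  by (simp_all add: D_def space_pair_measure)

lemma prob_space_D: "prob_space D"
  unfolding D_def by (rule prob_space_distr) simp

lemma kernel_meas: "\<kappa> \<in> measurable borel (prob_algebra R)"
  using rcd by (simp add: regular_cond_distr_def)

lemma kernel_meas' [measurable]: "\<kappa> \<in> measurable borel (subprob_algebra R)"
  using kernel_meas by (rule measurable_prob_algebraD)

lemma prob_space_kernel: "prob_space (\<kappa> z)" and kernel_sets [measurable_cong]: "sets (\<kappa> z) = sets R"
  using measurable_space[OF kernel_meas, of z] by (auto simp: space_prob_algebra)

lemma space_kernel [simp]: "space (\<kappa> z) = space R"
  using kernel_sets by (rule sets_eq_imp_space_eq)

lemma kernel_pair_measurable [measurable]:
  "(\<lambda>z. distr (\<kappa> z) (borel \<Otimes>\<^sub>M R) (Pair z)) \<in> measurable borel (subprob_algebra (borel \<Otimes>\<^sub>M R))"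
  by (rule measurable_distr2[where M = R]) auto

text \<open>The conditional distribution is specified on rectangles only. These form an
  intersection-stable generator, on which two finite measures that agree must coincide; iterated
  integration over arbitrary sets follows.\<close>

lemma D_eq_bind: "D = P\<^sub>X \<bind> (\<lambda>z. distr (\<kappa> z) (borel \<Otimes>\<^sub>M R) (Pair z))" (is "_ = ?B")
proof -
  have km: "(\<lambda>z. distr (\<kappa> z) (borel \<Otimes>\<^sub>M R) (Pair z)) \<in> measurable P\<^sub>X (subprob_algebra (borel \<Otimes>\<^sub>M R))"
    by simp
  have sB: "sets ?B = sets (borel \<Otimes>\<^sub>M R)"
    by (rule sets_bind[OF sets_kernel[OF km]]) auto
  let ?E = "{a \<times> b | a b. a \<in> sets (borel :: 'c measure) \<and> b \<in> sets R}"
  have eq: "emeasure D (a \<times> b) = emeasure ?B (a \<times> b)" if a: "a \<in> sets borel" and b: "b \<in> sets R" for a b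
  proof -
    have "emeasure D (a \<times> b) = emeasure M {\<omega>\<in>space M. X \<omega> \<in> a \<and> Y \<omega> \<in> b}"
      unfolding D_def using a b by (subst emeasure_distr) (auto intro!: arg_cong[where f="emeasure M"])
    also have "\<dots> = (\<integral>\<^sup>+z\<in>a. emeasure (\<kappa> z) b \<partial>P\<^sub>X)"
      using rcd a b by (simp add: regular_cond_distr_def)
    also have "\<dots> = (\<integral>\<^sup>+z. emeasure (distr (\<kappa> z) (borel \<Otimes>\<^sub>M R) (Pair z)) (a \<times> b) \<partial>P\<^sub>X)"
    proof (intro nn_integral_cong)
      fix z
      have "Pair z -` (a \<times> b) \<inter> space R = (if z \<in> a then b else {})"
        using sets.sets_into_space[OF b] by auto
      then show "emeasure (\<kappa> z) b * indicator a z = emeasure (distr (\<kappa> z) (borel \<Otimes>\<^sub>M R) (Pair z)) (a \<times> b)"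
        using a b by (subst emeasure_distr) auto
    qed
    also have "\<dots> = emeasure ?B (a \<times> b)"
      using a b by (subst emeasure_bind[OF _ km]) auto
    finally show ?thesis .
  qed
  have fin: "emeasure D (UNIV \<times> space R) \<noteq> \<infinity>"
    using prob_space.emeasure_space_1[OF prob_space_D] by simp
  show ?thesis
  proof (rule measure_eqI_generator_eq[where A="\<lambda>_. UNIV \<times> space R" and E="?E" and \<Omega>="UNIV \<times> space R"])
    show "Int_stable ?E" using Int_stable_pair_measure_generator[of borel R] by simp
    show "?E \<subseteq> Pow (UNIV \<times> space R)" using sets.space_closed[of R] by auto
    show "sets D = sigma_sets (UNIV \<times> space R) ?E"
      by (simp add: sets_D sets_pair_measure)
    show "sets ?B = sigma_sets (UNIV \<times> space R) ?E"
      by (simp add: sB sets_pair_measure)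
    show "range (\<lambda>_::nat. UNIV \<times> space R) \<subseteq> ?E"
      by (intro image_subsetI CollectI exI[of _ UNIV] exI[of _ "space R"]) simp
  qed (use eq fin in auto)
qed

lemma nn_integral_D:
  assumes [measurable]: "g \<in> borel_measurable (borel \<Otimes>\<^sub>M R)"
  shows "(\<integral>\<^sup>+p. g p \<partial>D) = (\<integral>\<^sup>+z. \<integral>\<^sup>+y. g (z, y) \<partial>\<kappa> z \<partial>P\<^sub>X)"
  unfolding D_eq_bind
  by (subst nn_integral_bind[where B = "borel \<Otimes>\<^sub>M R"]) (simp_all add: nn_integral_distr)

lemma sample_meas: "1 \<le> i \<Longrightarrow> (\<lambda>\<omega>. (Xs i \<omega>, Ys i \<omega>)) \<in> measurable M (borel \<Otimes>\<^sub>M R)"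
  using sample_indep by (simp add: indep_vars_def)

lemma Xs_meas [measurable (raw)]: "1 \<le> i \<Longrightarrow> Xs i \<in> borel_measurable M"
  using measurable_compose[OF sample_meas measurable_fst] by simp

lemma nn_integral_sample:
  assumes "1 \<le> i" "g \<in> borel_measurable (borel \<Otimes>\<^sub>M R)"
  shows "(\<integral>\<^sup>+\<omega>. g (Xs i \<omega>, Ys i \<omega>) \<partial>M) = (\<integral>\<^sup>+p. g p \<partial>D)"
  unfolding D_def sample_law[OF assms(1), symmetric]
  by (subst nn_integral_distr[OF sample_meas]) (use assms in auto)

lemma distr_sample:
  assumes "1 \<le> i" "g \<in> measurable (borel \<Otimes>\<^sub>M R) N"
  shows "distr M N (\<lambda>\<omega>. g (Xs i \<omega>, Ys i \<omega>)) = distr D N g"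
  unfolding D_def sample_law[OF assms(1), symmetric]
  by (subst distr_distr[OF _ sample_meas]) (use assms in \<open>auto simp: comp_def\<close>)

lemma indep_sample:
  assumes "J \<subseteq> {1..}" "\<And>i. i \<in> J \<Longrightarrow> g i \<in> measurable (borel \<Otimes>\<^sub>M R) (N i)"
  shows "indep_vars N (\<lambda>i \<omega>. g i (Xs i \<omega>, Ys i \<omega>)) J"
  using assms by (intro indep_vars_compose2[OF indep_vars_subset[OF sample_indep]]) auto

section \<open>Kernel weights and the number of observations in the ball\<close>

lemma ball_meas [measurable]: "{z. dist x z \<le> h} \<in> sets borel"
  by (intro borel_closed closed_Collect_le) (auto intro!: continuous_intros)

lemma weight_meas [measurable]: "0 < h \<Longrightarrow> (\<lambda>z. K (dist x z / h)) \<in> borel_measurable borel"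
  by (rule measurable_compose[OF _ K_meas], rule measurable_restrict_space2) auto

lemma weight_le: "0 < h \<Longrightarrow> K (dist x z / h) \<le> L\<^sub>K * ind h z"
  and weight_ge: "0 < h \<Longrightarrow> l\<^sub>K * ind h z \<le> K (dist x z / h)"
  and weight_outside: "0 < h \<Longrightarrow> h < dist x z \<Longrightarrow> K (dist x z / h) = 0"
  using K_bounds(3)[of "dist x z / h"] K_bounds(4)[of "dist x z / h"]
  by (auto simp: indicator_def field_simps)

lemma weight_nonneg: "0 < h \<Longrightarrow> 0 \<le> K (dist x z / h)"
  using K_bounds(1) by (intro order_trans[OF _ weight_ge] mult_nonneg_nonneg) auto

lemma kernel_sum_bounds:
  assumes "0 < h"
  shows "l\<^sub>K * count h n \<omega> \<le> kernel_sum K x h n (\<lambda>i. Xs i \<omega>)"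
    and "kernel_sum K x h n (\<lambda>i. Xs i \<omega>) \<le> L\<^sub>K * count h n \<omega>"
  unfolding kernel_sum_def count_def sum_distrib_left
  using assms by (intro sum_mono weight_ge weight_le; simp)+

lemma count_nonneg: "0 \<le> count h n \<omega>"
  by (simp add: count_def sum_nonneg)

lemma count_meas [measurable]: "count h n \<in> borel_measurable M"
  unfolding count_def[abs_def] by measurable

lemma kernel_sum_meas [measurable]:
  "0 < h \<Longrightarrow> (\<lambda>\<omega>. kernel_sum K x h n (\<lambda>i. Xs i \<omega>)) \<in> borel_measurable M"
  unfolding kernel_sum_def by (intro borel_measurable_sum measurable_compose[OF Xs_meas weight_meas]) auto

lemma \<phi>_nonneg: "0 \<le> \<phi> h" and \<phi>_le_1: "\<phi> h \<le> 1"
  by (simp_all add: small_ball_prob_def)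

lemma emeasure_ball: "emeasure P\<^sub>X {z. dist x z \<le> h} = ennreal (\<phi> h)"
  unfolding small_ball_prob_def
  by (subst emeasure_distr) (auto simp: emeasure_eq_measure intro!: arg_cong[where f=prob])

text \<open>A conditional bound uniform over the ball becomes a bound of order
  \<open>\<phi> h\<close>. The factors \<open>\<phi> h\<close> in the upper moment bounds arise in
  this way.\<close>

lemma nn_integral_ball:
  assumes "\<And>z. dist x z \<le> h \<Longrightarrow> (\<integral>\<^sup>+y. g (z, y) \<partial>\<kappa> z) \<le> ennreal c"
    "g \<in> borel_measurable (borel \<Otimes>\<^sub>M R)" "\<And>z y. h < dist x z \<Longrightarrow> g (z, y) = 0"
    "0 \<le> c"
  shows "(\<integral>\<^sup>+p. g p \<partial>D) \<le> ennreal (c * \<phi> h)"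
proof -
  have "(\<integral>\<^sup>+p. g p \<partial>D) \<le> (\<integral>\<^sup>+z. ennreal c * indicator {z. dist x z \<le> h} z \<partial>P\<^sub>X)"
    unfolding nn_integral_D[OF assms(2)]
    using assms by (intro nn_integral_mono) (auto simp: indicator_def not_le)
  also have "\<dots> = ennreal (c * \<phi> h)"
    using assms by (simp add: nn_integral_cmult_indicator emeasure_ball ennreal_mult \<phi>_nonneg)
  finally show ?thesis .
qed

text \<open>
  Chernoff's argument survives an extra factor depending on one observation, because the exponentially
  tilted integrand is still a product over the sample.
\<close>

lemma count_lower_tail:
  assumes g [measurable]: "g \<in> borel_measurable (borel \<Otimes>\<^sub>M R)" and i: "i \<in> {1..n}"
  shows "(\<integral>\<^sup>+\<omega>. g (Xs i \<omega>, Ys i \<omega>) * indicator {\<omega>. count h n \<omega> \<le> real n * \<phi> h / 4} \<omega> \<partial>M)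
    \<le> ennreal (2 * exp (- real n * \<phi> h / 4)) * (\<integral>\<^sup>+p. g p \<partial>D)"
proof -
  define p where "p = \<phi> h"
  have p: "0 \<le> p" "p \<le> 1" by (simp_all add: p_def \<phi>_nonneg \<phi>_le_1)
  define e :: "'c \<times> 'r \<Rightarrow> ennreal" where "e q = ennreal (exp (- ind h (fst q)))" for q
  have e [measurable]: "e \<in> borel_measurable (borel \<Otimes>\<^sub>M R)" unfolding e_def by measurable
  \<comment> \<open>With tilt parameter 1, \<open>exp (- 1) \<le> 1 / 2\<close> bounds the factor of
    each observation by \<open>exp (- p / 2)\<close>. Over the sample this gains
    \<open>n * p / 2\<close>, twice what the threshold \<open>n * p / 4\<close> costs.\<close>
  have e_int: "(\<integral>\<^sup>+q. e q \<partial>D) \<le> ennreal (exp (- p / 2))"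
  proof -
    interpret PX: prob_space P\<^sub>X by (rule prob_space_distr) simp
    have "(\<integral>\<^sup>+q. e q \<partial>D) = (\<integral>\<^sup>+z. ennreal (exp (- ind h z)) \<partial>P\<^sub>X)"
      unfolding nn_integral_D[OF e] by (simp add: e_def prob_space.emeasure_space_1[OF prob_space_kernel, simplified])
    also have "\<dots> \<le> (\<integral>\<^sup>+z. ennreal (1 - ind h z / 2) \<partial>P\<^sub>X)"
    proof (intro nn_integral_mono ennreal_leI)
      fix z
      have "2 \<le> exp (1::real)" using exp_ge_add_one_self[of 1] by simp
      then show "exp (- ind h z) \<le> 1 - ind h z / 2"
        by (auto simp: indicator_def exp_minus field_simps)
    qed
    also have "\<dots> = ennreal (\<integral>z. 1 - ind h z / 2 \<partial>P\<^sub>X)"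
      by (intro nn_integral_eq_integral) (auto simp: indicator_def intro!: PX.integrable_const_bound[of _ 1])
    also have "(\<integral>z. 1 - ind h z / 2 \<partial>P\<^sub>X) = 1 - p / 2"
      using emeasure_ball[of h] p
      by (subst Bochner_Integration.integral_diff)
        (auto simp: PX.prob_space p_def measure_def PX.emeasure_space_1[simplified] intro!: PX.integrable_const_bound[of _ 1])
    also have "ennreal (1 - p / 2) \<le> ennreal (exp (- p / 2))"
      using exp_ge_add_one_self[of "- p / 2"] by (intro ennreal_leI) simp
    finally show ?thesis .
  qed
  define H where "H j = (if j = i then g else e)" for j
  have H [measurable]: "H j \<in> borel_measurable (borel \<Otimes>\<^sub>M R)" for j by (simp add: H_def)
  let ?S = "\<lambda>j \<omega>. (Xs j \<omega>, Ys j \<omega>)"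
  have pointwise: "g (?S i \<omega>) * indicator {\<omega>. count h n \<omega> \<le> n * p / 4} \<omega>
      \<le> ennreal (exp (n * p / 4)) * (\<Prod>j=1..n. H j (?S j \<omega>))" for \<omega>
  proof -
    have "ennreal (exp (- count h n \<omega>)) = (\<Prod>j=1..n. e (?S j \<omega>))"
      by (simp add: count_def e_def exp_sum sum_negf[symmetric] prod_ennreal)
    also have "\<dots> = e (?S i \<omega>) * (\<Prod>j\<in>{1..n} - {i}. e (?S j \<omega>))"
      using i by (subst prod.remove[of _ i]) auto
    also have "\<dots> \<le> 1 * (\<Prod>j\<in>{1..n} - {i}. e (?S j \<omega>))"
      by (intro mult_right_mono) (auto simp: e_def)
    finally have le: "ennreal (exp (- count h n \<omega>)) \<le> (\<Prod>j\<in>{1..n} - {i}. e (?S j \<omega>))"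
      by simp
    have "indicator {\<omega>. count h n \<omega> \<le> n * p / 4} \<omega> \<le> ennreal (exp (n * p / 4)) * ennreal (exp (- count h n \<omega>))"
      by (auto simp: indicator_def ennreal_mult[symmetric] mult_exp_exp)
    also have "\<dots> \<le> ennreal (exp (n * p / 4)) * (\<Prod>j\<in>{1..n} - {i}. e (?S j \<omega>))"
      by (intro mult_left_mono le) auto
    finally have "indicator {\<omega>. count h n \<omega> \<le> n * p / 4} \<omega>
      \<le> ennreal (exp (n * p / 4)) * (\<Prod>j\<in>{1..n} - {i}. e (?S j \<omega>))" .
    from mult_left_mono[OF this, of "g (?S i \<omega>)"]
    have "g (?S i \<omega>) * indicator {\<omega>. count h n \<omega> \<le> n * p / 4} \<omega>
      \<le> g (?S i \<omega>) * (ennreal (exp (n * p / 4)) * (\<Prod>j\<in>{1..n} - {i}. e (?S j \<omega>)))"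
      by simp
    also have "\<dots> = ennreal (exp (n * p / 4)) * (H i (?S i \<omega>) * (\<Prod>j\<in>{1..n} - {i}. H j (?S j \<omega>)))"
    proof -
      have "(\<Prod>j\<in>{1..n} - {i}. H j (?S j \<omega>)) = (\<Prod>j\<in>{1..n} - {i}. e (?S j \<omega>))"
        by (intro prod.cong) (auto simp: H_def)
      then show ?thesis by (simp add: H_def ac_simps)
    qed
    also have "\<dots> = ennreal (exp (n * p / 4)) * (\<Prod>j=1..n. H j (?S j \<omega>))"
      using i by (subst (2) prod.remove[of _ i]) auto
    finally show ?thesis .
  qed
  have "(\<Prod>j=1..n. \<integral>\<^sup>+\<omega>. H j (?S j \<omega>) \<partial>M) = (\<Prod>j=1..n. \<integral>\<^sup>+q. H j q \<partial>D)"
    by (intro prod.cong refl nn_integral_sample) auto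
  also have "\<dots> = (\<integral>\<^sup>+q. H i q \<partial>D) * (\<Prod>j\<in>{1..n} - {i}. \<integral>\<^sup>+q. H j q \<partial>D)"
    using i by (subst prod.remove[of _ i]) auto
  also have "\<dots> = (\<integral>\<^sup>+q. g q \<partial>D) * (\<Prod>j\<in>{1..n} - {i}. \<integral>\<^sup>+q. e q \<partial>D)"
    by (intro arg_cong2[of _ _ _ _ "(*)"] prod.cong) (auto simp: H_def)
  also have "\<dots> \<le> (\<integral>\<^sup>+q. g q \<partial>D) * (\<Prod>j\<in>{1..n} - {i}. ennreal (exp (- p / 2)))"
    by (intro mult_left_mono prod_mono_ennreal e_int zero_le)
  also have "(\<Prod>j\<in>{1..n} - {i}. ennreal (exp (- p / 2))) = ennreal (exp (- p / 2) ^ (n - 1))"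
    using i by (simp add: ennreal_power)
  finally have prod_le: "(\<Prod>j=1..n. \<integral>\<^sup>+\<omega>. H j (?S j \<omega>) \<partial>M)
      \<le> (\<integral>\<^sup>+q. g q \<partial>D) * ennreal (exp (- p / 2) ^ (n - 1))" .
  have "(\<integral>\<^sup>+\<omega>. g (?S i \<omega>) * indicator {\<omega>. count h n \<omega> \<le> n * p / 4} \<omega> \<partial>M)
      \<le> (\<integral>\<^sup>+\<omega>. ennreal (exp (n * p / 4)) * (\<Prod>j=1..n. H j (?S j \<omega>)) \<partial>M)"
    by (intro nn_integral_mono pointwise)
  also have "\<dots> = ennreal (exp (n * p / 4)) * (\<Prod>j=1..n. \<integral>\<^sup>+\<omega>. H j (?S j \<omega>) \<partial>M)"
    using indep_sample[of "{1..n}" H "\<lambda>_. borel"]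
    by (subst nn_integral_cmult)
      (auto simp: indep_vars_nn_integral intro!: borel_measurable_prod_ennreal measurable_compose[OF sample_meas H])
  also have "\<dots> \<le> ennreal (exp (n * p / 4)) * ((\<integral>\<^sup>+q. g q \<partial>D) * ennreal (exp (- p / 2) ^ (n - 1)))"
    by (intro mult_left_mono prod_le zero_le)
  also have "\<dots>
      = ennreal (exp (n * p / 4) * exp (- p / 2) ^ (n - 1)) * (\<integral>\<^sup>+q. g q \<partial>D)"
    by (simp add: ennreal_mult ac_simps)
  \<comment> \<open>Only \<open>n - 1\<close> observations are tilted; the missing factor costs
    \<open>exp (p / 2)\<close>, which is at most 2 because \<open>p\<close> is a
    probability.\<close>
  also have "exp (n * p / 4) * exp (- p / 2) ^ (n - 1) = exp (- real n * p / 4) * exp (p / 2)"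
    using i by (simp add: exp_of_nat_mult[symmetric] mult_exp_exp of_nat_diff field_simps)
  also have "ennreal (exp (- real n * p / 4) * exp (p / 2)) * (\<integral>\<^sup>+q. g q \<partial>D)
      \<le> ennreal (2 * exp (- real n * p / 4)) * (\<integral>\<^sup>+q. g q \<partial>D)"
  proof (intro mult_right_mono ennreal_leI)
    have "exp (p / 2) \<le> 1 + p / 2 + (p / 2)\<^sup>2" using p by (intro exp_bound) auto
    also have "\<dots> \<le> 2" using p mult_le_one[of p p] by (simp add: power2_eq_square)
    finally show "exp (- real n * p / 4) * exp (p / 2) \<le> 2 * exp (- real n * p / 4)"
      by simp
  qed simp
  finally show ?thesis by (simp only: p_def)
qed

text \<open>The case of a constant factor; \<open>1 \<le> n\<close> supplies an observation to
  attach it to.\<close>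

lemma prob_count_lower_tail:
  assumes "1 \<le> n"
  shows "prob {\<omega>\<in>space M. count h n \<omega> \<le> real n * \<phi> h / 4} \<le> 2 * exp (- real n * \<phi> h / 4)"
proof -
  have "ennreal (prob {\<omega>\<in>space M. count h n \<omega> \<le> real n * \<phi> h / 4})
      = (\<integral>\<^sup>+\<omega>. indicator {\<omega>\<in>space M. count h n \<omega> \<le> real n * \<phi> h / 4} \<omega> \<partial>M)"
    by (simp add: emeasure_eq_measure)
  also have "\<dots> = (\<integral>\<^sup>+\<omega>. indicator {\<omega>. count h n \<omega> \<le> real n * \<phi> h / 4} \<omega> \<partial>M)"
    by (intro nn_integral_cong) (auto simp: indicator_def)
  also have "\<dots> \<le> ennreal (2 * exp (- real n * \<phi> h / 4)) * (\<integral>\<^sup>+p. 1 \<partial>D)"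
    using count_lower_tail[of "\<lambda>_. 1" 1 n h] assms by simp
  also have "(\<integral>\<^sup>+p. 1 \<partial>D) = 1"
    using prob_space.emeasure_space_1[OF prob_space_D] by simp
  finally show ?thesis by (subst (asm) mult_1_right, subst (asm) ennreal_le_iff) auto
qed

text \<open>Markov's inequality, as the kernel sum has mean at most
  \<open>L\<^sub>K * n * \<phi> h\<close>. It is wanted for the denominator of the noise: where this
  is not too large, a numerator away from 0 keeps the quotient away from 0.\<close>

lemma prob_kernel_sum_upper_tail:
  assumes "0 < h" "0 < A" "0 < real n * \<phi> h"
  shows "prob {\<omega>\<in>space M. A * (real n * \<phi> h) \<le> kernel_sum K x h n (\<lambda>i. Xs i \<omega>)} \<le> L\<^sub>K / A"
proof -
  let ?S = "\<lambda>\<omega>. kernel_sum K x h n (\<lambda>i. Xs i \<omega>)"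
  have "(\<integral>\<^sup>+\<omega>. ennreal (?S \<omega>) \<partial>M) \<le> (\<integral>\<^sup>+\<omega>. (\<Sum>i=1..n. ennreal (L\<^sub>K * ind h (Xs i \<omega>))) \<partial>M)"
    using K_bounds kernel_sum_bounds(2)[OF assms(1)]
    by (intro nn_integral_mono) (auto simp: count_def sum_distrib_left intro!: ennreal_leI)
  also have "\<dots> = (\<Sum>i=1..n. \<integral>\<^sup>+\<omega>. ennreal (L\<^sub>K * ind h (Xs i \<omega>)) \<partial>M)"
    by (intro nn_integral_sum) measurable
  also have "\<dots> \<le> (\<Sum>i=1..n. ennreal (L\<^sub>K * \<phi> h))"
  proof (intro sum_mono)
    fix i assume i: "i \<in> {1..n}"
    have "(\<integral>\<^sup>+\<omega>. ennreal (L\<^sub>K * ind h (Xs i \<omega>)) \<partial>M) = (\<integral>\<^sup>+p. ennreal (L\<^sub>K * ind h (fst p)) \<partial>D)"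
      using i nn_integral_sample[of i "\<lambda>p. ennreal (L\<^sub>K * ind h (fst p))"] by simp
    also have "\<dots> \<le> ennreal (L\<^sub>K * \<phi> h)"
      using K_bounds
      by (intro nn_integral_ball) (auto simp: prob_space.emeasure_space_1[OF prob_space_kernel, simplified])
    finally show "(\<integral>\<^sup>+\<omega>. ennreal (L\<^sub>K * ind h (Xs i \<omega>)) \<partial>M) \<le> ennreal (L\<^sub>K * \<phi> h)" .
  qed
  also have "\<dots> = ennreal (real n * (L\<^sub>K * \<phi> h))"
    using K_bounds \<phi>_nonneg by (simp add: ennreal_mult' ennreal_of_nat_eq_real_of_nat)
  finally have le: "(\<integral>\<^sup>+\<omega>. ennreal (?S \<omega>) \<partial>M) \<le> ennreal (real n * (L\<^sub>K * \<phi> h))" .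
  have "emeasure M {\<omega>\<in>space M. A * (real n * \<phi> h) \<le> ?S \<omega>}
      \<le> emeasure M {\<omega>\<in>space M. 1 \<le> ennreal (1 / (A * (real n * \<phi> h))) * ennreal (?S \<omega>)}"
    using assms
    by (intro emeasure_mono)
      (auto simp: ennreal_mult''[symmetric] field_simps zero_less_mult_iff simp flip: ennreal_1 intro!: ennreal_leI)
  also have "\<dots> \<le> ennreal (1 / (A * (real n * \<phi> h))) * (\<integral>\<^sup>+\<omega>. ennreal (?S \<omega>) \<partial>M)"
    using nn_integral_Markov_inequality[of "\<lambda>\<omega>. ennreal (?S \<omega>)" "space M" M "ennreal (1 / (A * (real n * \<phi> h)))"] assms(1)
    by (simp add: nn_set_integral_space cong: conj_cong)
  also have "\<dots> \<le> ennreal (1 / (A * (real n * \<phi> h))) * ennreal (real n * (L\<^sub>K * \<phi> h))"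
    by (intro mult_left_mono le) auto
  also have "\<dots> = ennreal (L\<^sub>K / A)"
    using assms K_bounds by (subst ennreal_mult'[symmetric]) (auto simp: zero_less_mult_iff field_simps)
  finally show ?thesis using assms K_bounds by (simp add: emeasure_eq_measure)
qed

end

section \<open>Second moments of bias and noise\<close>

lemma ennreal_norm_add_power2_le:
  fixes u w :: "'v::real_normed_vector"
  shows "ennreal ((norm (u + w))\<^sup>2) \<le> ennreal 2 * ennreal ((norm u)\<^sup>2) + ennreal 2 * ennreal ((norm w)\<^sup>2)"
proof -
  have "(norm (u + w))\<^sup>2 \<le> (norm u + norm w)\<^sup>2"
    by (intro power_mono norm_triangle_ineq) auto
  also have "\<dots> \<le> 2 * (norm u)\<^sup>2 + 2 * (norm w)\<^sup>2"
    using sum_squares_bound[of "norm u" "norm w"] by (simp add: power2_sum)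
  finally have "ennreal ((norm (u + w))\<^sup>2) \<le> ennreal (2 * (norm u)\<^sup>2 + 2 * (norm w)\<^sup>2)"
    by (rule ennreal_leI)
  then show ?thesis by (simp add: ennreal_mult)
qed

lemma powr_le_one_plus_powr:
  fixes t :: real
  assumes "0 \<le> t" "0 \<le> q" "q \<le> \<nu>"
  shows "t powr q \<le> 1 + t powr \<nu>"
proof (cases "t \<le> 1")
  case True
  then have "t powr q \<le> 1" using assms by (intro powr_le1) auto
  then show ?thesis using powr_ge_zero[of t \<nu>] by linarith
next
  case False
  then have "t powr q \<le> t powr \<nu>" using assms by (intro powr_mono) auto
  then show ?thesis by simp
qed

text \<open>The quadratic Taylor term of \<open>exp (y / 4)\<close> is \<open>y^2 / 32\<close>. This
  reduces the Chernoff tail to the order of the main term.\<close>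

lemma mult_exp_minus_quarter_le:
  fixes y :: real
  assumes "0 < y"
  shows "y * exp (- y / 4) \<le> 32 / y"
proof -
  have "y\<^sup>2 / 32 \<le> exp (y / 4)"
    using exp_lower_Taylor_quadratic[of "y / 4"] assms by (simp add: power2_eq_square)
  then show ?thesis using assms by (simp add: exp_minus field_simps power2_eq_square)
qed

lemma norm_convex_combination_power2_le:
  fixes v :: "'i \<Rightarrow> 'b::real_normed_vector"
  assumes "finite J" "(\<Sum>i\<in>J. a i) = 1" "\<And>i. i \<in> J \<Longrightarrow> 0 \<le> a i"
  shows "(norm (\<Sum>i\<in>J. a i *\<^sub>R v i))\<^sup>2 \<le> (\<Sum>i\<in>J. a i * (norm (v i))\<^sup>2)"
proof -
  have "norm (\<Sum>i\<in>J. a i *\<^sub>R v i) \<le> (\<Sum>i\<in>J. a i *\<^sub>R norm (v i))"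
    using assms by (intro sum_norm_le) auto
  then have "(norm (\<Sum>i\<in>J. a i *\<^sub>R v i))\<^sup>2 \<le> (\<Sum>i\<in>J. a i *\<^sub>R norm (v i))\<^sup>2"
    by (intro power_mono) auto
  also have "\<dots> \<le> (\<Sum>i\<in>J. a i * (norm (v i))\<^sup>2)"
    using assms by (intro convex_on_sum[OF _ _ convex_power2]) auto
  finally show ?thesis .
qed

locale kernel_noise = kernel_sample M R X Y Xs Ys \<kappa> x K l\<^sub>K L\<^sub>K
  for M :: "'w measure" and R :: "'r measure"
    and X :: "'w \<Rightarrow> 'c::polish_space" and Y :: "'w \<Rightarrow> 'r"
    and Xs :: "nat \<Rightarrow> 'w \<Rightarrow> 'c" and Ys :: "nat \<Rightarrow> 'w \<Rightarrow> 'r"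
    and \<kappa> :: "'c \<Rightarrow> 'r measure" and x :: 'c and K :: "real \<Rightarrow> real" and l\<^sub>K L\<^sub>K :: real +
  fixes G :: "'r \<Rightarrow> 'g::{banach, second_countable_topology}"
    and L :: "'g \<Rightarrow> 'b::{banach, second_countable_topology}"
    and \<nu> c\<^sub>G \<rho> \<Lambda> :: real
  assumes G_meas [measurable]: "G \<in> borel_measurable R"
    and L_lin: "bounded_linear L" and L_bound: "\<And>v. norm (L v) \<le> \<Lambda> * norm v" and \<Lambda>: "0 \<le> \<Lambda>"
    and \<nu>: "2 < \<nu>" and c\<^sub>G: "0 \<le> c\<^sub>G"
    and moment: "\<And>z. dist x z \<le> \<rho> \<Longrightarrow>
      (\<integral>\<^sup>+y. ennreal (norm (G y - cond_mean \<kappa> G z) powr \<nu>) \<partial>\<kappa> z) \<le> ennreal c\<^sub>G"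
begin

sublocale L: bounded_linear L by (rule L_lin)

definition \<xi> :: "'c \<times> 'r \<Rightarrow> 'b" where
  "\<xi> p = L (G (snd p) - cond_mean \<kappa> G (fst p))"

text \<open>Summand of the noise numerator after \<open>L\<close> has been moved inside the sum. The
  random denominator stays outside, so that the summands are i.i.d. over the sample.\<close>

definition U :: "real \<Rightarrow> 'c \<times> 'r \<Rightarrow> 'b" where
  "U h p = K (dist x (fst p) / h) *\<^sub>R \<xi> p"

lemma cond_mean_meas [measurable]: "cond_mean \<kappa> G \<in> borel_measurable borel"
  unfolding cond_mean_def[abs_def]
  by (rule measurable_compose[OF kernel_meas' integral_measurable_subprob_algebra]) simp

lemma L_meas [measurable]: "L \<in> borel_measurable borel"
  by (intro borel_measurable_continuous_onI L.continuous_on continuous_on_id)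

lemma \<xi>_meas [measurable]: "\<xi> \<in> borel_measurable (borel \<Otimes>\<^sub>M R)"
  unfolding \<xi>_def by measurable

lemma U_meas [measurable]: "0 < h \<Longrightarrow> U h \<in> borel_measurable (borel \<Otimes>\<^sub>M R)"
  unfolding U_def using measurable_compose[OF measurable_fst weight_meas[of h]] by measurable

lemma residual_moment:
  assumes "0 \<le> q" "q \<le> \<nu>" "dist x z \<le> \<rho>"
  shows "(\<integral>\<^sup>+y. ennreal (norm (G y - cond_mean \<kappa> G z) powr q) \<partial>\<kappa> z) \<le> ennreal (1 + c\<^sub>G)"
proof -
  interpret \<kappa>: prob_space "\<kappa> z" by (rule prob_space_kernel)
  have "(\<integral>\<^sup>+y. ennreal (norm (G y - cond_mean \<kappa> G z) powr q) \<partial>\<kappa> z)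
      \<le> (\<integral>\<^sup>+y. 1 + ennreal (norm (G y - cond_mean \<kappa> G z) powr \<nu>) \<partial>\<kappa> z)"
    using powr_le_one_plus_powr[OF _ assms(1,2)]
    by (intro nn_integral_mono) (auto simp flip: ennreal_1 ennreal_plus intro!: ennreal_leI)
  also have "\<dots> = 1 + (\<integral>\<^sup>+y. ennreal (norm (G y - cond_mean \<kappa> G z) powr \<nu>) \<partial>\<kappa> z)"
    by (subst nn_integral_add) (auto simp: \<kappa>.emeasure_space_1[simplified])
  also have "\<dots> \<le> 1 + ennreal c\<^sub>G"
    by (intro add_mono moment assms) auto
  finally show ?thesis using c\<^sub>G by simp
qed

lemma \<xi>_moment:
  assumes "0 \<le> q" "q \<le> \<nu>" "dist x z \<le> \<rho>"
  shows "(\<integral>\<^sup>+y. ennreal (norm (\<xi> (z, y)) powr q) \<partial>\<kappa> z) \<le> ennreal (\<Lambda> powr q * (1 + c\<^sub>G))"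
proof -
  have "(\<integral>\<^sup>+y. ennreal (norm (\<xi> (z, y)) powr q) \<partial>\<kappa> z)
      \<le> (\<integral>\<^sup>+y. ennreal (\<Lambda> powr q) * ennreal (norm (G y - cond_mean \<kappa> G z) powr q) \<partial>\<kappa> z)"
    using assms(1) \<Lambda> L_bound
    by (intro nn_integral_mono) (auto simp: \<xi>_def powr_mult[symmetric] simp flip: ennreal_mult intro!: ennreal_leI powr_mono2)
  also have "\<dots> \<le> ennreal (\<Lambda> powr q) * ennreal (1 + c\<^sub>G)"
    by (subst nn_integral_cmult) (auto intro!: mult_left_mono residual_moment assms)
  finally show ?thesis using c\<^sub>G by (simp add: ennreal_mult)
qed

lemma \<xi>_centered:
  assumes "dist x z \<le> \<rho>"
  shows "integrable (\<kappa> z) (\<lambda>y. \<xi> (z, y))" "(\<integral>y. \<xi> (z, y) \<partial>\<kappa> z) = 0"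
proof -
  interpret \<kappa>: prob_space "\<kappa> z" by (rule prob_space_kernel)
  have int: "integrable (\<kappa> z) (\<lambda>y. G y - cond_mean \<kappa> G z)"
  proof (rule integrableI_bounded)
    have "(\<integral>\<^sup>+y. ennreal (norm (G y - cond_mean \<kappa> G z)) \<partial>\<kappa> z) \<le> ennreal (1 + c\<^sub>G)"
      using residual_moment[of 1 z] \<nu> assms by simp
    then show "(\<integral>\<^sup>+y. ennreal (norm (G y - cond_mean \<kappa> G z)) \<partial>\<kappa> z) < \<infinity>"
      by (rule le_less_trans) simp
  qed simp
  \<comment> \<open>Adding the constant back proves that \<open>G\<close> itself is integrable.
    Without this, \<open>cond_mean\<close> might be the default value 0 of the Bochner integral and
    the residual would not be centered.\<close>
  then have "integrable (\<kappa> z) (\<lambda>y. (G y - cond_mean \<kappa> G z) + cond_mean \<kappa> G z)"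
    by (intro Bochner_Integration.integrable_add) auto
  then have "integrable (\<kappa> z) G" by simp
  then have zero: "(\<integral>y. G y - cond_mean \<kappa> G z \<partial>\<kappa> z) = 0"
    by (simp add: cond_mean_def \<kappa>.prob_space[simplified])
  show "integrable (\<kappa> z) (\<lambda>y. \<xi> (z, y))"
    unfolding \<xi>_def using integrable_bounded_linear[OF L_lin int] by simp
  show "(\<integral>y. \<xi> (z, y) \<partial>\<kappa> z) = 0"
    unfolding \<xi>_def using integral_bounded_linear[OF L_lin int] zero by (simp add: L.zero)
qed

lemma U_zero: "0 < h \<Longrightarrow> h < dist x z \<Longrightarrow> U h (z, y) = 0"
  by (simp add: U_def weight_outside)

lemma norm_U_powr_le:
  assumes "0 < h" "0 \<le> q"
  shows "norm (U h p) powr q \<le> L\<^sub>K powr q * norm (\<xi> p) powr q"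
proof -
  have "K (dist x (fst p) / h) \<le> L\<^sub>K"
    using weight_le[OF assms(1), of "fst p"] K_bounds(1,2)
    by (cases "dist x (fst p) \<le> h") auto
  then have "norm (U h p) \<le> L\<^sub>K * norm (\<xi> p)"
    unfolding U_def using weight_nonneg[OF assms(1)] by (auto intro!: mult_right_mono)
  then show ?thesis
    using assms(2) K_bounds by (auto simp: powr_mult[symmetric] intro!: powr_mono2)
qed

lemma U_moment:
  assumes h: "0 < h" "h \<le> \<rho>" and q: "0 < q" "q \<le> \<nu>"
  shows "(\<integral>\<^sup>+p. ennreal (norm (U h p) powr q) \<partial>D) \<le> ennreal ((L\<^sub>K * \<Lambda>) powr q * (1 + c\<^sub>G) * \<phi> h)"
proof (rule nn_integral_ball)
  fix z assume z: "dist x z \<le> h"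
  have "(\<integral>\<^sup>+y. ennreal (norm (U h (z, y)) powr q) \<partial>\<kappa> z)
      \<le> (\<integral>\<^sup>+y. ennreal (L\<^sub>K powr q) * ennreal (norm (\<xi> (z, y)) powr q) \<partial>\<kappa> z)"
    using norm_U_powr_le h q
    by (intro nn_integral_mono) (auto simp flip: ennreal_mult intro!: ennreal_leI)
  also have "\<dots> \<le> ennreal (L\<^sub>K powr q) * ennreal (\<Lambda> powr q * (1 + c\<^sub>G))"
    using z h q by (subst nn_integral_cmult) (auto intro!: mult_left_mono \<xi>_moment)
  finally show "(\<integral>\<^sup>+y. ennreal (norm (U h (z, y)) powr q) \<partial>\<kappa> z) \<le> ennreal ((L\<^sub>K * \<Lambda>) powr q * (1 + c\<^sub>G))"
    using c\<^sub>G K_bounds \<Lambda> by (simp add: powr_mult ac_simps flip: ennreal_mult)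
qed (use h q c\<^sub>G U_zero in auto)

lemma U_integrable_powr:
  assumes h: "0 < h" "h \<le> \<rho>" and q: "0 < q" "q \<le> \<nu>"
  shows "integrable D (\<lambda>p. norm (U h p) powr q)"
proof (rule integrableI_bounded)
  show "(\<integral>\<^sup>+p. ennreal (norm (norm (U h p) powr q)) \<partial>D) < \<infinity>"
    using U_moment[OF assms] by (auto intro: le_less_trans)
qed (use h in simp)

lemma U_integrable:
  assumes h: "0 < h" "h \<le> \<rho>"
  shows "integrable D (U h)"
proof (rule integrableI_bounded)
  show "(\<integral>\<^sup>+p. ennreal (norm (U h p)) \<partial>D) < \<infinity>"
    using U_moment[OF h, of 1] \<nu> by (auto intro: le_less_trans)
qed (use h in simp)

text \<open>The disintegration is available for nonnegative integrands. A vanishing conditional mean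
  says that positive and negative part have the same conditional integral, and these can be
  integrated separately.\<close>

lemma integral_D_eq_0:
  fixes g :: "'c \<times> 'r \<Rightarrow> real"
  assumes g: "integrable D g"
    and zero: "\<And>z. integrable (\<kappa> z) (\<lambda>y. g (z, y)) \<and> (\<integral>y. g (z, y) \<partial>\<kappa> z) = 0"
  shows "(\<integral>p. g p \<partial>D) = 0"
proof -
  have [measurable]: "g \<in> borel_measurable (borel \<Otimes>\<^sub>M R)"
    using borel_measurable_integrable[OF g] by (simp cong: measurable_cong_sets add: sets_D)
  have "(\<integral>\<^sup>+y. ennreal (g (z, y)) \<partial>\<kappa> z) = (\<integral>\<^sup>+y. ennreal (- g (z, y)) \<partial>\<kappa> z)" for z
  proof -
    have i: "integrable (\<kappa> z) (\<lambda>y. g (z, y))" using zero by blast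
    have "enn2real (\<integral>\<^sup>+y. ennreal (g (z, y)) \<partial>\<kappa> z) = enn2real (\<integral>\<^sup>+y. ennreal (- g (z, y)) \<partial>\<kappa> z)"
      using zero[of z] real_lebesgue_integral_def[OF i] by simp
    moreover have "(\<integral>\<^sup>+y. ennreal (g (z, y)) \<partial>\<kappa> z) < top" "(\<integral>\<^sup>+y. ennreal (- g (z, y)) \<partial>\<kappa> z) < top"
      using i by (auto simp: real_integrable_def less_top)
    ultimately show ?thesis by (metis ennreal_enn2real)
  qed
  then have "(\<integral>\<^sup>+p. ennreal (g p) \<partial>D) = (\<integral>\<^sup>+p. ennreal (- g p) \<partial>D)"
    by (simp add: nn_integral_D)
  then show ?thesis by (simp add: real_lebesgue_integral_def[OF g])
qed

text \<open>Given \<open>z\<close>, the kernel weight is a constant: inside the ball it multiplies a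
  centered residual, and outside it is 0.\<close>

lemma functional_U_mean:
  assumes h: "0 < h" "h \<le> \<rho>" and f: "bounded_linear f"
  shows "(\<integral>p. f (U h p) \<partial>D) = (0::real)"
proof (rule integral_D_eq_0)
  show "integrable D (\<lambda>p. f (U h p))"
    by (rule integrable_bounded_linear[OF f U_integrable[OF h]])
  interpret f: bounded_linear f by (rule f)
  fix z
  show "integrable (\<kappa> z) (\<lambda>y. f (U h (z, y))) \<and> (\<integral>y. f (U h (z, y)) \<partial>\<kappa> z) = 0"
  proof (cases "dist x z \<le> h")
    case True
    then have c: "integrable (\<kappa> z) (\<lambda>y. \<xi> (z, y))" "(\<integral>y. \<xi> (z, y) \<partial>\<kappa> z) = 0"
      using \<xi>_centered[of z] h by auto
    have "(\<integral>y. f (\<xi> (z, y)) \<partial>\<kappa> z) = 0"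
      using integral_bounded_linear[OF f c(1)] c(2) by (simp add: f.zero)
    then show ?thesis
      using integrable_bounded_linear[OF f c(1)] by (simp add: U_def f.scaleR)
  next
    case False
    then show ?thesis using h by (simp add: U_zero f.zero)
  qed
qed

text \<open>The coordinate functionals separate points, so the mean can be computed coordinatewise.\<close>

lemma U_mean:
  assumes h: "0 < h" "h \<le> \<rho>" and coords: "coordinate_functionals I e (\<psi> :: nat \<Rightarrow> 'b \<Rightarrow> real)"
  shows "(\<integral>p. U h p \<partial>D) = 0"
proof -
  let ?v = "\<integral>p. U h p \<partial>D"
  have "\<psi> i ?v = 0" if "i \<in> I" for i
  proof -
    have bl: "bounded_linear (\<psi> i)" using coords that by (simp add: coordinate_functionals_def)
    show ?thesis
      using functional_U_mean[OF h bl] integral_bounded_linear[OF bl U_integrable[OF h]] by simp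
  qed
  then have "(\<lambda>i. if i \<in> I then \<psi> i ?v *\<^sub>R e i else 0) = (\<lambda>_. 0)" by auto
  moreover have "(\<lambda>i. if i \<in> I then \<psi> i ?v *\<^sub>R e i else 0) sums ?v"
    using coords unfolding coordinate_functionals_def by blast
  ultimately have "(\<lambda>_::nat. 0) sums ?v" by simp
  then show ?thesis using sums_zero by (rule sums_unique2)
qed

abbreviation noise :: "real \<Rightarrow> nat \<Rightarrow> 'w \<Rightarrow> 'b" where
  "noise h n \<omega> \<equiv> noise_term L G \<kappa> K x h n (\<lambda>i. Xs i \<omega>) (\<lambda>i. Ys i \<omega>)"

abbreviation Usum :: "real \<Rightarrow> nat \<Rightarrow> 'w \<Rightarrow> 'b" where
  "Usum h n \<omega> \<equiv> (\<Sum>i=1..n. U h (Xs i \<omega>, Ys i \<omega>))"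

lemma noise_eq: "noise h n \<omega> = Usum h n \<omega> /\<^sub>R kernel_sum K x h n (\<lambda>i. Xs i \<omega>)"
  by (simp add: noise_term_def U_def \<xi>_def L.scaleR L.sum)

lemma Usum_meas [measurable]: "0 < h \<Longrightarrow> Usum h n \<in> borel_measurable M"
  by (intro borel_measurable_sum measurable_compose[OF sample_meas U_meas]) auto

lemma noise_meas [measurable]: "0 < h \<Longrightarrow> noise h n \<in> borel_measurable M"
  unfolding noise_eq using kernel_sum_meas Usum_meas by (intro borel_measurable_scaleR) measurable

text \<open>Type 2 reduces the second moment of the sum to \<open>n\<close> second moments, each of
  order \<open>\<phi> h\<close>. The constant is chosen before \<open>h\<close> and
  \<open>n\<close>, as varying bandwidths require.\<close>

lemma Usum_second_moment:
  assumes type2: "type2_space TYPE('b)" and coords: "coordinate_functionals I e (\<psi> :: nat \<Rightarrow> 'b \<Rightarrow> real)"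
  shows "\<exists>C\<ge>0. \<forall>h n. 0 < h \<longrightarrow> h \<le> \<rho> \<longrightarrow>
    (\<integral>\<^sup>+\<omega>. ennreal ((norm (Usum h n \<omega>))\<^sup>2) \<partial>M) \<le> ennreal (C * (real n * \<phi> h))"
proof -
  from type2_space_ineq[OF type2, where 'w='w]
  obtain c where c: "0 < c" and ineq: "\<And>(Z :: nat \<Rightarrow> 'w \<Rightarrow> 'b) n.
       indep_vars (\<lambda>_. borel) Z {..<n} \<Longrightarrow>
       (\<And>i. i < n \<Longrightarrow> integrable M (\<lambda>\<omega>. (norm (Z i \<omega>))\<^sup>2) \<and> integral\<^sup>L M (Z i) = 0) \<Longrightarrow>
       (\<integral>\<omega>. (norm (\<Sum>i<n. Z i \<omega>))\<^sup>2 \<partial>M) \<le> c * (\<Sum>i<n. \<integral>\<omega>. (norm (Z i \<omega>))\<^sup>2 \<partial>M)"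
    using prob_space_axioms by blast
  define q where "q = (L\<^sub>K * \<Lambda>) powr 2 * (1 + c\<^sub>G)"
  have q: "0 \<le> q" using c\<^sub>G by (simp add: q_def)
  show ?thesis
  proof (intro exI[of _ "c * q"] conjI allI impI)
    show "0 \<le> c * q" using c q by simp
    fix h n assume h: "0 < h" "h \<le> \<rho>"
    define Z where "Z i \<omega> = U h (Xs (Suc i) \<omega>, Ys (Suc i) \<omega>)" for i \<omega>
    have sq: "(norm v)\<^sup>2 = norm v powr 2" for v :: 'b by simp
    have int_D: "integrable D (\<lambda>p. (norm (U h p))\<^sup>2)"
      unfolding sq using \<nu> h by (intro U_integrable_powr) auto
    have sq_le: "(\<integral>p. (norm (U h p))\<^sup>2 \<partial>D) \<le> q * \<phi> h"
    proof -
      have "ennreal (\<integral>p. (norm (U h p))\<^sup>2 \<partial>D) = (\<integral>\<^sup>+p. ennreal (norm (U h p) powr 2) \<partial>D)"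
        using int_D by (subst nn_integral_eq_integral[symmetric]) auto
      also have "\<dots> \<le> ennreal (q * \<phi> h)"
        unfolding q_def using \<nu> h by (intro U_moment) auto
      finally show ?thesis using q \<phi>_nonneg by (simp add: ennreal_le_iff)
    qed
    have distr: "distr M borel (Z i) = distr D borel (U h)" for i
      unfolding Z_def using h by (intro distr_sample) auto
    have Zm [measurable]: "Z i \<in> borel_measurable M" for i
      unfolding Z_def using h by (intro measurable_compose[OF sample_meas U_meas]) auto
    have int_Z: "integrable M (\<lambda>\<omega>. (norm (Z i \<omega>))\<^sup>2)" for i
    proof -
      have "integrable (distr M borel (Z i)) (\<lambda>v. (norm v)\<^sup>2)"
        unfolding distr using int_D h by (subst integrable_distr_eq) (auto cong: measurable_cong_sets simp: sets_D)
      then show ?thesis by (subst (asm) integrable_distr_eq) auto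
    qed
    have mean_Z: "integral\<^sup>L M (Z i) = 0" for i
    proof -
      have "integral\<^sup>L M (Z i) = (\<integral>v. v \<partial>distr M borel (Z i))" by (subst integral_distr) auto
      also have "\<dots> = (\<integral>p. U h p \<partial>D)"
        unfolding distr using h by (subst integral_distr) (auto cong: measurable_cong_sets simp: sets_D)
      finally show ?thesis using U_mean[OF h coords] by simp
    qed
    have sq_Z: "(\<integral>\<omega>. (norm (Z i \<omega>))\<^sup>2 \<partial>M) \<le> q * \<phi> h" for i
    proof -
      have "(\<integral>\<omega>. (norm (Z i \<omega>))\<^sup>2 \<partial>M) = (\<integral>v. (norm v)\<^sup>2 \<partial>distr M borel (Z i))" by (subst integral_distr) auto
      also have "\<dots> = (\<integral>p. (norm (U h p))\<^sup>2 \<partial>D)"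
        unfolding distr using h by (subst integral_distr) (auto cong: measurable_cong_sets simp: sets_D)
      finally show ?thesis using sq_le by simp
    qed
    have indep: "indep_vars (\<lambda>_. borel) Z {..<n}"
      unfolding Z_def
      by (rule indep_vars_reindex_inj[where f=Suc and N="\<lambda>_. borel" and X="\<lambda>i \<omega>. U h (Xs i \<omega>, Ys i \<omega>)"])
        (use h in \<open>auto intro!: indep_sample\<close>)
    have sum_eq: "Usum h n \<omega> = (\<Sum>i<n. Z i \<omega>)" for \<omega>
      unfolding Z_def by (simp add: sum.atLeast1_atMost_eq)
    \<comment> \<open>The type 2 inequality bounds a Bochner integral, which would be 0 for a
      non-integrable function. Integrability is what transfers the bound to the extended integral of
      the claim.\<close>
    have int_sum: "integrable M (\<lambda>\<omega>. (norm (\<Sum>i<n. Z i \<omega>))\<^sup>2)"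
    proof (rule Bochner_Integration.integrable_bound)
      show "integrable M (\<lambda>\<omega>. real n * (\<Sum>i<n. (norm (Z i \<omega>))\<^sup>2))"
        using int_Z by auto
      have "(norm (\<Sum>i<n. Z i \<omega>))\<^sup>2 \<le> real n * (\<Sum>i<n. (norm (Z i \<omega>))\<^sup>2)" for \<omega>
      proof -
        have "(norm (\<Sum>i<n. Z i \<omega>))\<^sup>2 \<le> (\<Sum>i<n. norm (Z i \<omega>))\<^sup>2"
          by (intro power_mono norm_sum) auto
        also have "\<dots> \<le> real n * (\<Sum>i<n. (norm (Z i \<omega>))\<^sup>2)"
          using sum_squared_le_sum_of_squares[of "\<lambda>i. norm (Z i \<omega>)" "{..<n}"] by (simp add: mult.commute)
        finally show ?thesis .
      qed
      then show "AE \<omega> in M. norm ((norm (\<Sum>i<n. Z i \<omega>))\<^sup>2) \<le> norm (real n * (\<Sum>i<n. (norm (Z i \<omega>))\<^sup>2))"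
        by (auto simp: abs_mult sum_nonneg)
    qed measurable
    have "(\<integral>\<^sup>+\<omega>. ennreal ((norm (Usum h n \<omega>))\<^sup>2) \<partial>M) = ennreal (\<integral>\<omega>. (norm (\<Sum>i<n. Z i \<omega>))\<^sup>2 \<partial>M)"
      unfolding sum_eq using int_sum by (intro nn_integral_eq_integral) auto
    also have "\<dots> \<le> ennreal (c * (\<Sum>i<n. \<integral>\<omega>. (norm (Z i \<omega>))\<^sup>2 \<partial>M))"
      using int_Z mean_Z by (intro ennreal_leI ineq indep) auto
    also have "\<dots> \<le> ennreal (c * (\<Sum>i<n. q * \<phi> h))"
      using c by (intro ennreal_leI mult_left_mono sum_mono sq_Z) auto
    finally show "(\<integral>\<^sup>+\<omega>. ennreal ((norm (Usum h n \<omega>))\<^sup>2) \<partial>M) \<le> ennreal (c * q * (real n * \<phi> h))"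
      by (simp add: algebra_simps)
  qed
qed

text \<open>
  Where few observations fall into the ball, the quotient is a convex combination of the residuals,
  and the Chernoff bound pays for replacing all weights by \<open>1\<close>.
\<close>

lemma noise_power2_le:
  assumes h: "0 < h" and np: "0 < real n * \<phi> h"
  shows "ennreal ((norm (noise h n \<omega>))\<^sup>2)
    \<le> ennreal (16 / (l\<^sub>K * (real n * \<phi> h))\<^sup>2) * ennreal ((norm (Usum h n \<omega>))\<^sup>2)
     + (\<Sum>i=1..n. ennreal ((norm (\<xi> (Xs i \<omega>, Ys i \<omega>)))\<^sup>2 * ind h (Xs i \<omega>))
         * indicator {\<omega>. count h n \<omega> \<le> real n * \<phi> h / 4} \<omega>)"
proof -
  let ?S = "kernel_sum K x h n (\<lambda>i. Xs i \<omega>)"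
  let ?w = "\<lambda>i. K (dist x (Xs i \<omega>) / h)"
  let ?np = "real n * \<phi> h"
  have wS: "?S = (\<Sum>i=1..n. ?w i)" by (simp add: kernel_sum_def)
  have S0: "0 \<le> ?S" unfolding wS using h by (intro sum_nonneg weight_nonneg)
  show ?thesis
  proof (cases "count h n \<omega> \<le> ?np / 4")
    case False
    then have "l\<^sub>K * (?np / 4) \<le> l\<^sub>K * count h n \<omega>"
      using K_bounds by (intro mult_left_mono) auto
    also have "\<dots> \<le> ?S" by (rule kernel_sum_bounds[OF h])
    \<comment> \<open>Origin of the constant 16: the denominator is at least a quarter of
      \<open>l\<^sub>K * ?np\<close>, and it enters squared.\<close>
    finally have S: "l\<^sub>K * ?np / 4 \<le> ?S" by simp
    have pos: "0 < l\<^sub>K * ?np / 4" using K_bounds np by simp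
    have "(norm (noise h n \<omega>))\<^sup>2 = (norm (Usum h n \<omega>))\<^sup>2 / ?S\<^sup>2"
      unfolding noise_eq by (simp add: power_mult_distrib power_divide field_simps)
    also have "\<dots> \<le> (norm (Usum h n \<omega>))\<^sup>2 / (l\<^sub>K * ?np / 4)\<^sup>2"
      using S pos S0 by (intro divide_left_mono power_mono mult_pos_pos zero_less_power) auto
    also have "\<dots> = 16 / (l\<^sub>K * ?np)\<^sup>2 * (norm (Usum h n \<omega>))\<^sup>2"
      by (simp add: power_divide)
    finally have "ennreal ((norm (noise h n \<omega>))\<^sup>2)
        \<le> ennreal (16 / (l\<^sub>K * ?np)\<^sup>2) * ennreal ((norm (Usum h n \<omega>))\<^sup>2)"
      by (subst ennreal_mult[symmetric]) (auto intro: ennreal_leI)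
    then show ?thesis by (rule order_trans) simp
  next
    case True
    have "(norm (noise h n \<omega>))\<^sup>2 \<le> (\<Sum>i=1..n. (norm (\<xi> (Xs i \<omega>, Ys i \<omega>)))\<^sup>2 * ind h (Xs i \<omega>))"
    proof (cases "?S = 0")
      case True
      \<comment> \<open>A vanishing kernel sum makes the quotient 0 by convention, and the right
        side is nonnegative.\<close>
      then show ?thesis unfolding noise_eq by (simp add: sum_nonneg)
    next
      case False
      then have S: "0 < ?S" using S0 by simp
      have w_le: "?w i \<le> ?S" if "i \<in> {1..n}" for i
        unfolding wS using that h weight_nonneg by (intro member_le_sum) auto
      have "noise h n \<omega> = (\<Sum>i=1..n. (?w i / ?S) *\<^sub>R \<xi> (Xs i \<omega>, Ys i \<omega>))"
        unfolding noise_eq by (simp add: U_def scaleR_sum_right divide_inverse mult.commute)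
      then have "(norm (noise h n \<omega>))\<^sup>2 \<le> (\<Sum>i=1..n. ?w i / ?S * (norm (\<xi> (Xs i \<omega>, Ys i \<omega>)))\<^sup>2)"
        using S h weight_nonneg
        by (simp only:) (intro norm_convex_combination_power2_le; simp add: wS flip: sum_divide_distrib)
      also have "\<dots> \<le> (\<Sum>i=1..n. (norm (\<xi> (Xs i \<omega>, Ys i \<omega>)))\<^sup>2 * ind h (Xs i \<omega>))"
      proof (intro sum_mono)
        fix i assume i: "i \<in> {1..n}"
        have "?w i / ?S \<le> ind h (Xs i \<omega>)"
          using w_le[OF i] S weight_outside[OF h, of "Xs i \<omega>"] by (auto simp: indicator_def)
        then show "?w i / ?S * (norm (\<xi> (Xs i \<omega>, Ys i \<omega>)))\<^sup>2 \<le> (norm (\<xi> (Xs i \<omega>, Ys i \<omega>)))\<^sup>2 * ind h (Xs i \<omega>)"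
          by (subst mult.commute) (intro mult_left_mono; simp)
      qed
      finally show ?thesis .
    qed
    then have "ennreal ((norm (noise h n \<omega>))\<^sup>2)
        \<le> (\<Sum>i=1..n. ennreal ((norm (\<xi> (Xs i \<omega>, Ys i \<omega>)))\<^sup>2 * ind h (Xs i \<omega>)))"
      by (subst sum_ennreal) (auto intro: ennreal_leI)
    then show ?thesis using True by (intro order_trans[OF _ add_increasing[OF _ order.refl]]) auto
  qed
qed

text \<open>On the good event type 2 contributes \<open>16 * C / l\<^sub>K^2\<close>. On the bad
  event the \<open>n\<close> residuals together contribute \<open>2 * q * y * exp (- y / 4)\<close>
  with \<open>y = n * \<phi> h\<close>, hence at most \<open>64 * q / y\<close>. Both parts have
  order \<open>1 / (n * \<phi> h)\<close>.\<close>

lemma noise_second_moment: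
  assumes type2: "type2_space TYPE('b)" and coords: "coordinate_functionals I e (\<psi> :: nat \<Rightarrow> 'b \<Rightarrow> real)"
  shows "\<exists>C\<ge>0. \<forall>h n. 0 < h \<longrightarrow> h \<le> \<rho> \<longrightarrow> 0 < real n * \<phi> h \<longrightarrow>
    (\<integral>\<^sup>+\<omega>. ennreal ((norm (noise h n \<omega>))\<^sup>2) \<partial>M) \<le> ennreal (C / (real n * \<phi> h))"
proof -
  obtain C where C: "0 \<le> C" and num: "\<And>h n. 0 < h \<Longrightarrow> h \<le> \<rho> \<Longrightarrow>
      (\<integral>\<^sup>+\<omega>. ennreal ((norm (Usum h n \<omega>))\<^sup>2) \<partial>M) \<le> ennreal (C * (real n * \<phi> h))"
    using Usum_second_moment[OF type2 coords] by blast
  define q where "q = \<Lambda> powr 2 * (1 + c\<^sub>G)"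
  have q: "0 \<le> q" using c\<^sub>G by (simp add: q_def)
  show ?thesis
  proof (intro exI[of _ "16 * C / l\<^sub>K\<^sup>2 + 64 * q"] conjI allI impI)
    show "0 \<le> 16 * C / l\<^sub>K\<^sup>2 + 64 * q" using C q by simp
    fix h n assume h: "0 < h" "h \<le> \<rho>" and np: "0 < real n * \<phi> h"
    let ?np = "real n * \<phi> h"
    let ?S = "\<lambda>i \<omega>. (Xs i \<omega>, Ys i \<omega>)"
    let ?I = "\<lambda>\<omega>. indicator {\<omega>. count h n \<omega> \<le> ?np / 4} \<omega> :: ennreal"
    define g where "g p = ennreal ((norm (\<xi> p))\<^sup>2 * ind h (fst p))" for p
    have g [measurable]: "g \<in> borel_measurable (borel \<Otimes>\<^sub>M R)" unfolding g_def by measurable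
    have "(\<integral>\<^sup>+p. g p \<partial>D) \<le> ennreal (q * \<phi> h)"
    proof (rule nn_integral_ball[OF _ g])
      fix z assume "dist x z \<le> h"
      then show "(\<integral>\<^sup>+y. g (z, y) \<partial>\<kappa> z) \<le> ennreal q"
        using \<xi>_moment[of 2 z] \<nu> h by (simp add: g_def q_def)
    qed (use q in \<open>auto simp: g_def\<close>)
    then have tail: "(\<integral>\<^sup>+\<omega>. g (?S i \<omega>) * ?I \<omega> \<partial>M) \<le> ennreal (2 * exp (- ?np / 4) * (q * \<phi> h))" if "i \<in> {1..n}" for i
      using count_lower_tail[OF g that, of h] q \<phi>_nonneg
      by (subst ennreal_mult) (auto elim!: order_trans intro!: mult_left_mono)
    have "(\<integral>\<^sup>+\<omega>. ennreal ((norm (noise h n \<omega>))\<^sup>2) \<partial>M)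
        \<le> (\<integral>\<^sup>+\<omega>. ennreal (16 / (l\<^sub>K * ?np)\<^sup>2) * ennreal ((norm (Usum h n \<omega>))\<^sup>2)
             + (\<Sum>i=1..n. g (?S i \<omega>) * ?I \<omega>) \<partial>M)"
      unfolding g_def fst_conv by (intro nn_integral_mono noise_power2_le h np)
    also have "\<dots> = ennreal (16 / (l\<^sub>K * ?np)\<^sup>2) * (\<integral>\<^sup>+\<omega>. ennreal ((norm (Usum h n \<omega>))\<^sup>2) \<partial>M)
        + (\<Sum>i=1..n. \<integral>\<^sup>+\<omega>. g (?S i \<omega>) * ?I \<omega> \<partial>M)"
    proof -
      have [measurable]: "(\<lambda>\<omega>. g (?S i \<omega>)) \<in> borel_measurable M" if "i \<in> {1..n}" for i
        using that by (intro measurable_compose[OF sample_meas g]) auto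
      have [measurable]: "(\<lambda>\<omega>. Usum h n \<omega>) \<in> borel_measurable M"
        using h(1) by (rule Usum_meas)
      have m: "(\<lambda>\<omega>. g (?S i \<omega>) * ?I \<omega>) \<in> borel_measurable M" if "i \<in> {1..n}" for i
        using that by measurable
      have "(\<integral>\<^sup>+\<omega>. (\<Sum>i=1..n. g (?S i \<omega>) * ?I \<omega>) \<partial>M) = (\<Sum>i=1..n. \<integral>\<^sup>+\<omega>. g (?S i \<omega>) * ?I \<omega> \<partial>M)"
        by (intro nn_integral_sum m)
      moreover have "(\<integral>\<^sup>+\<omega>. ennreal (16 / (l\<^sub>K * ?np)\<^sup>2) * ennreal ((norm (Usum h n \<omega>))\<^sup>2) \<partial>M)
          = ennreal (16 / (l\<^sub>K * ?np)\<^sup>2) * (\<integral>\<^sup>+\<omega>. ennreal ((norm (Usum h n \<omega>))\<^sup>2) \<partial>M)"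
        by (intro nn_integral_cmult) measurable
      moreover have "(\<lambda>\<omega>. \<Sum>i=1..n. g (?S i \<omega>) * ?I \<omega>) \<in> borel_measurable M"
        by (intro borel_measurable_sum m)
      ultimately show ?thesis
        by (subst nn_integral_add) measurable
    qed
    also have "\<dots> \<le> ennreal (16 / (l\<^sub>K * ?np)\<^sup>2) * ennreal (C * ?np)
        + (\<Sum>i=1..n. ennreal (2 * exp (- ?np / 4) * (q * \<phi> h)))"
      by (intro add_mono mult_left_mono sum_mono tail num[OF h]) auto
    also have "\<dots> = ennreal (16 / (l\<^sub>K * ?np)\<^sup>2 * (C * ?np) + 2 * q * (?np * exp (- ?np / 4)))"
    proof -
      have "(\<Sum>i=1..n. ennreal (2 * exp (- ?np / 4) * (q * \<phi> h))) = ennreal (\<Sum>i=1..n. 2 * exp (- ?np / 4) * (q * \<phi> h))"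
        using q \<phi>_nonneg by (intro sum_ennreal) auto
      also have "(\<Sum>i=1..n. 2 * exp (- ?np / 4) * (q * \<phi> h)) = 2 * q * (?np * exp (- ?np / 4))"
        by simp
      finally show ?thesis
        using C q np by (simp only: ennreal_mult''[symmetric] mult_nonneg_nonneg less_imp_le) (intro ennreal_plus[symmetric]; simp)
    qed
    also have "\<dots> \<le> ennreal ((16 * C / l\<^sub>K\<^sup>2 + 64 * q) / ?np)"
    proof (intro ennreal_leI)
      have "16 / (l\<^sub>K * ?np)\<^sup>2 * (C * ?np) = 16 * C / l\<^sub>K\<^sup>2 / ?np"
        using np K_bounds by (simp add: power2_eq_square field_simps)
      moreover have "2 * q * (?np * exp (- ?np / 4)) \<le> 2 * q * (32 / ?np)"
        using q np by (intro mult_left_mono mult_exp_minus_quarter_le) auto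
      ultimately show "16 / (l\<^sub>K * ?np)\<^sup>2 * (C * ?np) + 2 * q * (?np * exp (- ?np / 4)) \<le> (16 * C / l\<^sub>K\<^sup>2 + 64 * q) / ?np"
        by (simp add: add_divide_distrib)
    qed
    finally show "(\<integral>\<^sup>+\<omega>. ennreal ((norm (noise h n \<omega>))\<^sup>2) \<partial>M) \<le> ennreal ((16 * C / l\<^sub>K\<^sup>2 + 64 * q) / ?np)" .
  qed
qed

end

section \<open>Second moments of the bias and of the leading error\<close>

context kernel_noise
begin

abbreviation bias :: "('c \<Rightarrow> 'g) \<Rightarrow> real \<Rightarrow> nat \<Rightarrow> 'w \<Rightarrow> 'b" where
  "bias F h n \<omega> \<equiv> bias_term L F K x h n (\<lambda>i. Xs i \<omega>)"

lemma bias_meas [measurable]: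
  assumes [measurable]: "F \<in> borel_measurable borel" and h: "0 < h"
  shows "bias F h n \<in> borel_measurable M"
proof -
  have "(\<lambda>\<omega>. \<Sum>i=1..n. K (dist x (Xs i \<omega>) / h) *\<^sub>R F (Xs i \<omega>)) \<in> borel_measurable M"
    using h by (intro borel_measurable_sum borel_measurable_scaleR measurable_compose[OF Xs_meas weight_meas]
      measurable_compose[OF Xs_meas assms(1)]) auto
  then show ?thesis
    unfolding bias_term_def using kernel_sum_meas[OF h, of n] by measurable
qed

text \<open>A weighted mean of \<open>F\<close> over the ball inherits the modulus of continuity at
  \<open>x\<close>. If the kernel sum vanishes, the quotient is 0 by convention and the bias is
  \<open>L (- F x)\<close>: bounded but not small, whence the second alternative.\<close>

lemma bias_bound:
  assumes h: "0 < h" and b: "0 \<le> b" "0 \<le> \<beta>"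
    and F: "\<And>z. dist x z \<le> h \<Longrightarrow> norm (F z - F x) \<le> b * dist x z powr \<beta>"
  shows "norm (bias F h n \<omega>) \<le> \<Lambda> * (b * h powr \<beta>)
    \<or> count h n \<omega> = 0 \<and> norm (bias F h n \<omega>) \<le> \<Lambda> * norm (F x)"
proof -
  let ?S = "kernel_sum K x h n (\<lambda>i. Xs i \<omega>)"
  let ?w = "\<lambda>i. K (dist x (Xs i \<omega>) / h)"
  have wS: "?S = (\<Sum>i=1..n. ?w i)" by (simp add: kernel_sum_def)
  show ?thesis
  proof (cases "?S = 0")
    case True
    then have "l\<^sub>K * count h n \<omega> \<le> 0" using kernel_sum_bounds(1)[OF h, of n \<omega>] by simp
    then have "count h n \<omega> = 0"
      using K_bounds(1) count_nonneg[of h n \<omega>] by (simp add: mult_le_0_iff)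
    moreover have "norm (bias F h n \<omega>) \<le> \<Lambda> * norm (F x)"
      using True L_bound[of "- F x"] by (simp add: bias_term_def)
    ultimately show ?thesis by blast
  next
    case False
    have "0 \<le> ?S" unfolding wS using h by (intro sum_nonneg weight_nonneg)
    then have S: "0 < ?S" using False by simp
    have bias_eq: "bias F h n \<omega> = L ((\<Sum>i=1..n. ?w i *\<^sub>R (F (Xs i \<omega>) - F x)) /\<^sub>R ?S)"
      unfolding bias_term_def using False
      by (simp add: wS scaleR_diff_right sum_subtractf flip: scaleR_sum_left)
    have "norm (bias F h n \<omega>) \<le> \<Lambda> * norm ((\<Sum>i=1..n. ?w i *\<^sub>R (F (Xs i \<omega>) - F x)) /\<^sub>R ?S)"
      unfolding bias_eq by (rule L_bound)
    also have "norm ((\<Sum>i=1..n. ?w i *\<^sub>R (F (Xs i \<omega>) - F x)) /\<^sub>R ?S)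
        \<le> (\<Sum>i=1..n. ?w i * (b * h powr \<beta>)) / ?S"
    proof -
      have "norm (?w i *\<^sub>R (F (Xs i \<omega>) - F x)) \<le> ?w i * (b * h powr \<beta>)" for i
      proof (cases "dist x (Xs i \<omega>) \<le> h")
        case True
        then have "norm (F (Xs i \<omega>) - F x) \<le> b * dist x (Xs i \<omega>) powr \<beta>" by (rule F)
        also have "\<dots> \<le> b * h powr \<beta>" using b True by (intro mult_left_mono powr_mono2) auto
        finally show ?thesis using weight_nonneg[OF h] by (simp add: mult_left_mono)
      next
        case False
        then show ?thesis using weight_outside[OF h] by simp
      qed
      then have "norm (\<Sum>i=1..n. ?w i *\<^sub>R (F (Xs i \<omega>) - F x)) \<le> (\<Sum>i=1..n. ?w i * (b * h powr \<beta>))"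
        by (intro sum_norm_le)
      then show ?thesis using S by (simp add: divide_inverse mult.commute)
    qed
    also have "(\<Sum>i=1..n. ?w i * (b * h powr \<beta>)) / ?S = b * h powr \<beta>"
      using S by (simp add: wS flip: sum_distrib_right)
    finally show ?thesis using \<Lambda> by (simp add: mult_left_mono)
  qed
qed

text \<open>The exceptional alternative of \<open>bias_bound\<close> occurs inside the lower-tail
  event of the count, whose probability is at most \<open>2 * exp (- y / 4) \<le> 8 / y\<close> for
  \<open>y = n * \<phi> h\<close>.\<close>

lemma bias_second_moment:
  assumes h: "0 < h" and np: "0 < real n * \<phi> h" and b: "0 \<le> b" "0 \<le> \<beta>"
    and F: "\<And>z. dist x z \<le> h \<Longrightarrow> norm (F z - F x) \<le> b * dist x z powr \<beta>"
  shows "(\<integral>\<^sup>+\<omega>. ennreal ((norm (bias F h n \<omega>))\<^sup>2) \<partial>M)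
    \<le> ennreal ((\<Lambda> * (b * h powr \<beta>))\<^sup>2 + 8 * (\<Lambda> * norm (F x))\<^sup>2 / (real n * \<phi> h))"
proof -
  let ?np = "real n * \<phi> h"
  define A where "A = {\<omega>\<in>space M. count h n \<omega> \<le> ?np / 4}"
  have n: "1 \<le> n" using np by (cases n) auto
  have A: "A \<in> sets M" unfolding A_def by measurable
  have "(\<integral>\<^sup>+\<omega>. ennreal ((norm (bias F h n \<omega>))\<^sup>2) \<partial>M)
      \<le> (\<integral>\<^sup>+\<omega>. ennreal ((\<Lambda> * (b * h powr \<beta>))\<^sup>2) + ennreal ((\<Lambda> * norm (F x))\<^sup>2) * indicator A \<omega> \<partial>M)"
  proof (intro nn_integral_mono)
    fix \<omega> assume \<omega>: "\<omega> \<in> space M"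
    have "norm (bias F h n \<omega>) \<le> \<Lambda> * (b * h powr \<beta>)
        \<or> count h n \<omega> = 0 \<and> norm (bias F h n \<omega>) \<le> \<Lambda> * norm (F x)"
      by (intro bias_bound h b F)
    then show "ennreal ((norm (bias F h n \<omega>))\<^sup>2)
        \<le> ennreal ((\<Lambda> * (b * h powr \<beta>))\<^sup>2) + ennreal ((\<Lambda> * norm (F x))\<^sup>2) * indicator A \<omega>"
    proof (elim disjE conjE)
      assume "norm (bias F h n \<omega>) \<le> \<Lambda> * (b * h powr \<beta>)"
      then have "ennreal ((norm (bias F h n \<omega>))\<^sup>2) \<le> ennreal ((\<Lambda> * (b * h powr \<beta>))\<^sup>2)"
        by (intro ennreal_leI power_mono) auto
      then show ?thesis by (rule order_trans) simp
    next
      assume "count h n \<omega> = 0" and "norm (bias F h n \<omega>) \<le> \<Lambda> * norm (F x)"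
      then have "ennreal ((norm (bias F h n \<omega>))\<^sup>2) \<le> ennreal ((\<Lambda> * norm (F x))\<^sup>2) * indicator A \<omega>"
        using \<omega> np by (auto simp: A_def intro!: ennreal_leI power_mono)
      then show ?thesis by (rule order_trans) simp
    qed
  qed
  also have "\<dots> = ennreal ((\<Lambda> * (b * h powr \<beta>))\<^sup>2) + ennreal ((\<Lambda> * norm (F x))\<^sup>2) * ennreal (prob A)"
    using A by (simp add: nn_integral_add nn_integral_cmult_indicator emeasure_space_1 emeasure_eq_measure[of A])
  also have "\<dots> \<le> ennreal ((\<Lambda> * (b * h powr \<beta>))\<^sup>2) + ennreal ((\<Lambda> * norm (F x))\<^sup>2) * ennreal (8 / ?np)"
  proof (intro add_left_mono mult_left_mono ennreal_leI)
    have "prob A \<le> 2 * exp (- ?np / 4)" using prob_count_lower_tail[OF n, of h] by (simp add: A_def)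
    also have "\<dots> \<le> 8 / ?np"
    proof -
      have "?np / 4 \<le> exp (?np / 4)" using exp_ge_add_one_self[of "?np / 4"] by linarith
      then show ?thesis using np by (simp add: exp_minus field_simps)
    qed
    finally show "prob A \<le> 8 / ?np" .
  qed simp
  also have "\<dots> = ennreal ((\<Lambda> * (b * h powr \<beta>))\<^sup>2 + 8 * (\<Lambda> * norm (F x))\<^sup>2 / ?np)"
    using np by (subst ennreal_mult'[symmetric], simp, subst ennreal_plus[symmetric]) (auto simp: mult.commute)
  finally show ?thesis .
qed

text \<open>The exponent is generic here: at the optimal bandwidth the bound is applied with the
  larger exponent of the smoother \<open>F\<close>.\<close>

lemma bias_noise_second_moment:
  assumes type2: "type2_space TYPE('b)" and coords: "coordinate_functionals I e (\<psi> :: nat \<Rightarrow> 'b \<Rightarrow> real)"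
    and [measurable]: "F \<in> borel_measurable borel" and b: "0 \<le> b" "0 \<le> \<beta>" and \<rho>': "\<rho>' \<le> \<rho>"
    and F: "\<And>z. dist x z \<le> \<rho>' \<Longrightarrow> norm (F z - F x) \<le> b * dist x z powr \<beta>"
  shows "\<exists>C\<ge>0. \<forall>h n. 0 < h \<longrightarrow> h \<le> \<rho>' \<longrightarrow> 0 < real n * \<phi> h \<longrightarrow>
    (\<integral>\<^sup>+\<omega>. ennreal ((norm (bias F h n \<omega> + noise h n \<omega>))\<^sup>2) \<partial>M)
      \<le> ennreal (C * (h powr (2 * \<beta>) + 1 / (real n * \<phi> h)))"
proof -
  obtain C where C: "0 \<le> C" and noise: "\<And>h n. 0 < h \<Longrightarrow> h \<le> \<rho> \<Longrightarrow> 0 < real n * \<phi> h \<Longrightarrow>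
    (\<integral>\<^sup>+\<omega>. ennreal ((norm (noise h n \<omega>))\<^sup>2) \<partial>M) \<le> ennreal (C / (real n * \<phi> h))"
    using noise_second_moment[OF type2 coords] by blast
  define E where "E = C + 8 * (\<Lambda> * norm (F x))\<^sup>2 + (\<Lambda> * b)\<^sup>2"
  define C' where "C' = 2 * E"
  show ?thesis
  proof (intro exI[of _ C'] conjI allI impI)
    show "0 \<le> C'" using C by (simp add: C'_def E_def)
    fix h n assume h: "0 < h" "h \<le> \<rho>'" and np: "0 < real n * \<phi> h"
    let ?np = "real n * \<phi> h"
    have [measurable]: "bias F h n \<in> borel_measurable M" "noise h n \<in> borel_measurable M"
      using h by (auto intro: bias_meas noise_meas)
    have "(\<integral>\<^sup>+\<omega>. ennreal ((norm (bias F h n \<omega> + noise h n \<omega>))\<^sup>2) \<partial>M)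
        \<le> (\<integral>\<^sup>+\<omega>. 2 * ennreal ((norm (bias F h n \<omega>))\<^sup>2) + 2 * ennreal ((norm (noise h n \<omega>))\<^sup>2) \<partial>M)"
    proof (intro nn_integral_mono)
      fix \<omega>
      show "ennreal ((norm (bias F h n \<omega> + noise h n \<omega>))\<^sup>2)
          \<le> 2 * ennreal ((norm (bias F h n \<omega>))\<^sup>2) + 2 * ennreal ((norm (noise h n \<omega>))\<^sup>2)"
        using ennreal_norm_add_power2_le[of "bias F h n \<omega>" "noise h n \<omega>"] by simp
    qed
    also have "\<dots> = 2 * (\<integral>\<^sup>+\<omega>. ennreal ((norm (bias F h n \<omega>))\<^sup>2) \<partial>M)
        + 2 * (\<integral>\<^sup>+\<omega>. ennreal ((norm (noise h n \<omega>))\<^sup>2) \<partial>M)"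
      by (subst nn_integral_add, measurable, subst (1 2) nn_integral_cmult) measurable
    also have "\<dots> \<le> 2 * ennreal ((\<Lambda> * (b * h powr \<beta>))\<^sup>2 + 8 * (\<Lambda> * norm (F x))\<^sup>2 / ?np)
        + 2 * ennreal (C / ?np)"
    proof (intro add_mono mult_left_mono)
      show "(\<integral>\<^sup>+\<omega>. ennreal ((norm (bias F h n \<omega>))\<^sup>2) \<partial>M)
          \<le> ennreal ((\<Lambda> * (b * h powr \<beta>))\<^sup>2 + 8 * (\<Lambda> * norm (F x))\<^sup>2 / ?np)"
        using h by (intro bias_second_moment np b F) auto
      show "(\<integral>\<^sup>+\<omega>. ennreal ((norm (noise h n \<omega>))\<^sup>2) \<partial>M) \<le> ennreal (C / ?np)"
        using h \<rho>' by (intro noise np) auto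
    qed auto
    also have "\<dots> = ennreal (2 * ((\<Lambda> * (b * h powr \<beta>))\<^sup>2 + 8 * (\<Lambda> * norm (F x))\<^sup>2 / ?np) + 2 * (C / ?np))"
    proof -
      have two: "2 * ennreal u + 2 * ennreal w = ennreal (2 * u + 2 * w)" if "0 \<le> u" "0 \<le> w" for u w
        using that by (simp add: ennreal_mult)
      show ?thesis using C np by (intro two) auto
    qed
    also have "\<dots> \<le> ennreal (C' * (h powr (2 * \<beta>) + 1 / ?np))"
    proof (intro ennreal_leI)
      have hp: "(\<Lambda> * (b * h powr \<beta>))\<^sup>2 = (\<Lambda> * b)\<^sup>2 * h powr (2 * \<beta>)"
        by (simp add: power_mult_distrib power2_eq_square powr_add[symmetric])
      have "(\<Lambda> * b)\<^sup>2 * h powr (2 * \<beta>) \<le> E * h powr (2 * \<beta>)"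
        unfolding E_def using C by (intro mult_right_mono) auto
      moreover have "8 * (\<Lambda> * norm (F x))\<^sup>2 / ?np + C / ?np \<le> E * (1 / ?np)"
        using np by (simp add: E_def divide_right_mono flip: add_divide_distrib)
      ultimately show "2 * ((\<Lambda> * (b * h powr \<beta>))\<^sup>2 + 8 * (\<Lambda> * norm (F x))\<^sup>2 / ?np) + 2 * (C / ?np)
          \<le> C' * (h powr (2 * \<beta>) + 1 / ?np)"
        unfolding hp C'_def by (simp only: distrib_left mult.assoc)
    qed
    finally show "(\<integral>\<^sup>+\<omega>. ennreal ((norm (bias F h n \<omega> + noise h n \<omega>))\<^sup>2) \<partial>M) \<le> ennreal (C' * (h powr (2 * \<beta>) + 1 / ?np))" .
  qed
qed

text \<open>Also valid when the kernel sum vanishes: nonnegative weights with sum 0 are all 0, so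
  the numerator is 0 as well.\<close>

lemma Usum_eq: "0 < h \<Longrightarrow> Usum h n \<omega> = kernel_sum K x h n (\<lambda>i. Xs i \<omega>) *\<^sub>R noise h n \<omega>"
proof (cases "kernel_sum K x h n (\<lambda>i. Xs i \<omega>) = 0")
  case True
  assume h: "0 < h"
  have "\<forall>i\<in>{1..n}. K (dist x (Xs i \<omega>) / h) = 0"
    using True weight_nonneg[OF h] unfolding kernel_sum_def by (subst (asm) sum_nonneg_eq_0_iff) auto
  then show ?thesis using True by (simp add: U_def)
qed (simp add: noise_eq)

end

section \<open>Anticoncentration of the noise\<close>

locale kernel_noise_functional = kernel_noise M R X Y Xs Ys \<kappa> x K l\<^sub>K L\<^sub>K G L \<nu> c\<^sub>G \<rho> \<Lambda>
  for M :: "'w measure" and R :: "'r measure"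
    and X :: "'w \<Rightarrow> 'c::polish_space" and Y :: "'w \<Rightarrow> 'r"
    and Xs :: "nat \<Rightarrow> 'w \<Rightarrow> 'c" and Ys :: "nat \<Rightarrow> 'w \<Rightarrow> 'r"
    and \<kappa> :: "'c \<Rightarrow> 'r measure" and x :: 'c and K :: "real \<Rightarrow> real" and l\<^sub>K L\<^sub>K :: real
    and G :: "'r \<Rightarrow> 'g::{banach, second_countable_topology}"
    and L :: "'g \<Rightarrow> 'b::{banach, second_countable_topology}"
    and \<nu> c\<^sub>G \<rho> \<Lambda> :: real +
  fixes f :: "'b \<Rightarrow> real" and N v :: real
  assumes f_lin: "bounded_linear f" and f_bound: "\<And>u. \<bar>f u\<bar> \<le> N * norm u" and N: "0 < N"
    and var_lower: "\<And>z. dist x z \<le> \<rho> \<Longrightarrow> v \<le> coord_cond_var f L G \<kappa> z" and v: "0 < v"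
begin

lemma f_meas [measurable]: "f \<in> borel_measurable borel"
  using f_lin by (intro borel_measurable_continuous_onI linear_continuous_on)

lemma fU_integrable_powr:
  assumes h: "0 < h" "h \<le> \<rho>" and q: "0 < q" "q \<le> \<nu>"
  shows "integrable D (\<lambda>p. \<bar>f (U h p)\<bar> powr q)"
    and "(\<integral>p. \<bar>f (U h p)\<bar> powr q \<partial>D) \<le> (N * (L\<^sub>K * \<Lambda>)) powr q * (1 + c\<^sub>G) * \<phi> h"
proof -
  have "(\<integral>\<^sup>+p. ennreal (\<bar>f (U h p)\<bar> powr q) \<partial>D) \<le> (\<integral>\<^sup>+p. ennreal (N powr q) * ennreal (norm (U h p) powr q) \<partial>D)"
    using f_bound N q
    by (intro nn_integral_mono) (auto simp: powr_mult[symmetric] simp flip: ennreal_mult intro!: ennreal_leI powr_mono2)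
  also have "\<dots> \<le> ennreal (N powr q) * ennreal ((L\<^sub>K * \<Lambda>) powr q * (1 + c\<^sub>G) * \<phi> h)"
    using h by (subst nn_integral_cmult) (auto intro!: mult_left_mono U_moment q)
  also have "\<dots> = ennreal ((N * (L\<^sub>K * \<Lambda>)) powr q * (1 + c\<^sub>G) * \<phi> h)"
    using N K_bounds \<Lambda> c\<^sub>G \<phi>_nonneg by (subst ennreal_mult[symmetric]) (auto simp: powr_mult mult.assoc)
  finally have le: "(\<integral>\<^sup>+p. ennreal (\<bar>f (U h p)\<bar> powr q) \<partial>D) \<le> ennreal ((N * (L\<^sub>K * \<Lambda>)) powr q * (1 + c\<^sub>G) * \<phi> h)" .
  show int: "integrable D (\<lambda>p. \<bar>f (U h p)\<bar> powr q)"
  proof (rule integrableI_bounded)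
    show "(\<integral>\<^sup>+p. ennreal (norm (\<bar>f (U h p)\<bar> powr q)) \<partial>D) < \<infinity>"
      using le by (auto intro: le_less_trans)
  qed (use h in simp)
  have "ennreal (\<integral>p. \<bar>f (U h p)\<bar> powr q \<partial>D) \<le> ennreal ((N * (L\<^sub>K * \<Lambda>)) powr q * (1 + c\<^sub>G) * \<phi> h)"
    using le by (subst (asm) nn_integral_eq_integral[OF int]) auto
  then show "(\<integral>p. \<bar>f (U h p)\<bar> powr q \<partial>D) \<le> (N * (L\<^sub>K * \<Lambda>)) powr q * (1 + c\<^sub>G) * \<phi> h"
    using c\<^sub>G \<phi>_nonneg by (subst (asm) ennreal_le_iff) auto
qed

text \<open>Inside the ball the weight is at least \<open>l\<^sub>K\<close> and the conditional
  variance at least \<open>v\<close>. The order \<open>\<phi> h\<close> matches the upper bound for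
  the absolute moments, which makes the Lyapunov ratio small.\<close>

lemma fU_variance_lower:
  assumes h: "0 < h" "h \<le> \<rho>"
  shows "integrable D (\<lambda>p. (f (U h p))\<^sup>2)" "l\<^sub>K\<^sup>2 * v * \<phi> h \<le> (\<integral>p. (f (U h p))\<^sup>2 \<partial>D)"
proof -
  interpret f: bounded_linear f by (rule f_lin)
  have sq: "t\<^sup>2 = \<bar>t\<bar> powr 2" for t :: real by simp
  show int: "integrable D (\<lambda>p. (f (U h p))\<^sup>2)"
    unfolding sq using \<nu> h by (intro fU_integrable_powr) auto
  have "ennreal (l\<^sub>K\<^sup>2 * v * \<phi> h) = (\<integral>\<^sup>+z. ennreal (l\<^sub>K\<^sup>2 * v) * indicator {z. dist x z \<le> h} z \<partial>P\<^sub>X)"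
    using v by (simp add: nn_integral_cmult_indicator emeasure_ball ennreal_mult \<phi>_nonneg)
  also have "\<dots> \<le> (\<integral>\<^sup>+z. \<integral>\<^sup>+y. ennreal ((f (U h (z, y)))\<^sup>2) \<partial>\<kappa> z \<partial>P\<^sub>X)"
  proof (intro nn_integral_mono)
    fix z
    show "ennreal (l\<^sub>K\<^sup>2 * v) * indicator {z. dist x z \<le> h} z \<le> (\<integral>\<^sup>+y. ennreal ((f (U h (z, y)))\<^sup>2) \<partial>\<kappa> z)"
    proof (cases "dist x z \<le> h")
      case True
      let ?w = "K (dist x z / h)"
      have z: "dist x z \<le> \<rho>" using True h by simp
      have "integrable (\<kappa> z) (\<lambda>y. (f (\<xi> (z, y)))\<^sup>2)"
      proof (rule ccontr)
        assume "\<not> ?thesis"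
        \<comment> \<open>The integral of a non-integrable function is 0 by default, so the positive
          lower bound on the variance forces integrability.\<close>
        then have "coord_cond_var f L G \<kappa> z = 0"
          by (simp add: coord_cond_var_def \<xi>_def not_integrable_integral_eq)
        then show False using var_lower[OF z] v by simp
      qed
      then have "(\<integral>\<^sup>+y. ennreal ((f (\<xi> (z, y)))\<^sup>2) \<partial>\<kappa> z) = ennreal (coord_cond_var f L G \<kappa> z)"
        by (subst nn_integral_eq_integral) (auto simp: coord_cond_var_def \<xi>_def)
      then have lower: "ennreal v \<le> (\<integral>\<^sup>+y. ennreal ((f (\<xi> (z, y)))\<^sup>2) \<partial>\<kappa> z)"
        using var_lower[OF z] by (simp add: ennreal_leI)
      have "l\<^sub>K \<le> ?w" using weight_ge[OF h(1), of z] True by simp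
      then have "l\<^sub>K\<^sup>2 \<le> ?w\<^sup>2" using K_bounds(1) by (intro power_mono) auto
      then have "ennreal (l\<^sub>K\<^sup>2) * ennreal v \<le> ennreal (?w\<^sup>2) * (\<integral>\<^sup>+y. ennreal ((f (\<xi> (z, y)))\<^sup>2) \<partial>\<kappa> z)"
        by (intro mult_mono lower ennreal_leI) auto
      also have "\<dots> = (\<integral>\<^sup>+y. ennreal ((f (U h (z, y)))\<^sup>2) \<partial>\<kappa> z)"
        by (subst nn_integral_cmult[symmetric]) (auto simp: U_def f.scaleR power_mult_distrib ennreal_mult)
      finally show ?thesis using True v by (simp add: ennreal_mult)
    qed simp
  qed
  also have "\<dots> = (\<integral>\<^sup>+p. ennreal ((f (U h p))\<^sup>2) \<partial>D)"
    using h by (subst nn_integral_D) auto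
  also have "\<dots> = ennreal (\<integral>p. (f (U h p))\<^sup>2 \<partial>D)"
    using int by (intro nn_integral_eq_integral) auto
  finally show "l\<^sub>K\<^sup>2 * v * \<phi> h \<le> (\<integral>p. (f (U h p))\<^sup>2 \<partial>D)"
    by (subst (asm) ennreal_le_iff) auto
qed

text \<open>The Lyapunov numerator is at most of order \<open>n * \<phi> h\<close>, while the
  variance of the row is at least of that order. The ratio is thus
  \<open>O((n * \<phi> h) powr (1 - \<nu>' / 2))\<close>, which vanishes because
  \<open>\<nu>' > 2\<close>. The normal limit then makes small intervals around 0
  improbable.\<close>

lemma fUsum_anticoncentration:
  assumes h: "\<And>n. 0 < h n" "h \<longlonglongrightarrow> 0" and \<rho>: "0 < \<rho>"
    and np: "filterlim (\<lambda>n. real n * \<phi> (h n)) at_top sequentially" and \<epsilon>: "0 < \<epsilon>"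
  shows "\<forall>\<^sub>F n in sequentially.
    prob {\<omega>\<in>space M. \<bar>f (Usum (h n) n \<omega>)\<bar> \<le> \<epsilon> * sqrt (l\<^sub>K\<^sup>2 * v * (real n * \<phi> (h n)))} \<le> 3 * \<epsilon>"
proof -
  interpret f: bounded_linear f by (rule f_lin)
  \<comment> \<open>The central limit theorem takes exponents up to 3; the moment of order \<nu>
    controls all smaller ones.\<close>
  define \<nu>' where "\<nu>' = min \<nu> 3"
  have \<nu>': "2 < \<nu>'" "\<nu>' \<le> 3" "\<nu>' \<le> \<nu>" using \<nu> by (auto simp: \<nu>'_def)
  define W where "W n i \<omega> = f (U (h n) (Xs i \<omega>, Ys i \<omega>))" for n i \<omega>
  define Q where "Q n = distr D borel (\<lambda>p. f (U (h n) p))" for n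
  have [measurable]: "U (h n) \<in> borel_measurable (borel \<Otimes>\<^sub>M R)" for n using h(1) by (rule U_meas)
  have Wsum: "(\<Sum>i=1..n. W n i \<omega>) = f (Usum (h n) n \<omega>)" for n \<omega>
    by (simp add: W_def f.sum)
  have small: "\<forall>\<^sub>F n in sequentially. h n \<le> \<rho>"
    using order_tendstoD(2)[OF h(2) \<rho>] by eventually_elim simp
  have pos: "\<forall>\<^sub>F n in sequentially. 0 < real n * \<phi> (h n)"
    using np by (simp add: filterlim_at_top_dense)
  have Q2: "(\<integral>x. x\<^sup>2 \<partial>Q n) = (\<integral>p. (f (U (h n) p))\<^sup>2 \<partial>D)" for n
    unfolding Q_def by (subst integral_distr) auto
  have Q\<nu>: "(\<integral>x. \<bar>x\<bar> powr \<nu>' \<partial>Q n) = (\<integral>p. \<bar>f (U (h n) p)\<bar> powr \<nu>' \<partial>D)" for n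
    unfolding Q_def by (subst integral_distr) auto
  let ?s = "\<lambda>n. sqrt (real n * (\<integral>x. x\<^sup>2 \<partial>Q n))"
  define C where "C = (N * (L\<^sub>K * \<Lambda>)) powr \<nu>' * (1 + c\<^sub>G)"
  have C: "0 \<le> C" using c\<^sub>G by (simp add: C_def)
  have "weak_conv_m (\<lambda>n. distr M borel (\<lambda>\<omega>. (\<Sum>i=1..n. W n i \<omega>) / ?s n)) std_normal_distribution"
  proof (rule lyapunov_clt_iid_rows[OF _ _ _ _ \<nu>'(1,2)])
    show "indep_vars (\<lambda>_. borel) (W n) {1..n}" for n
      unfolding W_def by (intro indep_sample) auto
    show "distr M borel (W n i) = Q n" if "i \<in> {1..n}" for n i
      unfolding W_def Q_def using that by (intro distr_sample) auto
    show "real_distribution (Q n)" for n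
      unfolding Q_def by (intro prob_space.real_distribution_distr prob_space_D) simp
    show "\<forall>\<^sub>F n in sequentially. integrable (Q n) (\<lambda>x. x) \<and> (\<integral>x. x \<partial>Q n) = 0"
      using small
    proof eventually_elim
      case (elim n)
      have "integrable D (\<lambda>p. f (U (h n) p))"
        using h(1) elim by (intro integrable_bounded_linear[OF f_lin U_integrable])
      moreover have "(\<integral>p. f (U (h n) p) \<partial>D) = 0"
        using h(1) elim f_lin by (intro functional_U_mean)
      ultimately show ?case
        unfolding Q_def by (simp add: integrable_distr_eq integral_distr)
    qed
    show "\<forall>\<^sub>F n in sequentially. integrable (Q n) (\<lambda>x. \<bar>x\<bar> powr \<nu>')"
      using small
    proof eventually_elim
      case (elim n)
      have "integrable D (\<lambda>p. \<bar>f (U (h n) p)\<bar> powr \<nu>')"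
        using h(1) elim \<nu>' by (intro fU_integrable_powr) auto
      then show ?case unfolding Q_def by (simp add: integrable_distr_eq)
    qed
    show "\<forall>\<^sub>F n in sequentially. integrable (Q n) (\<lambda>x. x\<^sup>2) \<and> 0 < (\<integral>x. x\<^sup>2 \<partial>Q n)"
      using small pos
    proof eventually_elim
      case (elim n)
      have "0 < l\<^sub>K\<^sup>2 * v * \<phi> (h n)"
        using elim v K_bounds \<phi>_nonneg[of "h n"] by (auto simp: zero_less_mult_iff)
      then show ?case
        using fU_variance_lower[OF h(1)[of n] elim(1)] unfolding Q2 by (simp add: Q_def integrable_distr_eq)
    qed
    show "(\<lambda>n. real n * (\<integral>x. \<bar>x\<bar> powr \<nu>' \<partial>Q n) / (real n * (\<integral>x. x\<^sup>2 \<partial>Q n)) powr (\<nu>' / 2)) \<longlonglongrightarrow> 0"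
    proof (rule Lim_null_comparison)
      show "(\<lambda>n. C / (l\<^sub>K\<^sup>2 * v) powr (\<nu>' / 2) * (real n * \<phi> (h n)) powr (1 - \<nu>' / 2)) \<longlonglongrightarrow> 0"
        using \<nu>' by (intro tendsto_mult_right_zero tendsto_neg_powr np) auto
      show "\<forall>\<^sub>F n in sequentially. norm (real n * (\<integral>x. \<bar>x\<bar> powr \<nu>' \<partial>Q n) / (real n * (\<integral>x. x\<^sup>2 \<partial>Q n)) powr (\<nu>' / 2))
          \<le> C / (l\<^sub>K\<^sup>2 * v) powr (\<nu>' / 2) * (real n * \<phi> (h n)) powr (1 - \<nu>' / 2)"
        using small pos
      proof eventually_elim
        case (elim n)
        let ?np = "real n * \<phi> (h n)"
        have lv: "0 < l\<^sub>K\<^sup>2 * v" using v K_bounds by simp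
        have n: "0 < n" using elim(2) by (cases n) auto
        have num: "real n * (\<integral>x. \<bar>x\<bar> powr \<nu>' \<partial>Q n) \<le> C * ?np"
          using mult_left_mono[OF fU_integrable_powr(2)[OF h(1)[of n] elim(1), of \<nu>'], of "real n"] \<nu>'
          unfolding Q\<nu> C_def by (simp add: algebra_simps)
        have den: "l\<^sub>K\<^sup>2 * v * ?np \<le> real n * (\<integral>x. x\<^sup>2 \<partial>Q n)"
          using mult_left_mono[OF fU_variance_lower(2)[OF h(1)[of n] elim(1)], of "real n"]
          unfolding Q2 by (simp add: algebra_simps)
        have num0: "0 \<le> real n * (\<integral>x. \<bar>x\<bar> powr \<nu>' \<partial>Q n)"
          unfolding Q\<nu> by (intro mult_nonneg_nonneg integral_nonneg_AE) auto
        have "norm (real n * (\<integral>x. \<bar>x\<bar> powr \<nu>' \<partial>Q n) / (real n * (\<integral>x. x\<^sup>2 \<partial>Q n)) powr (\<nu>' / 2))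
            = real n * (\<integral>x. \<bar>x\<bar> powr \<nu>' \<partial>Q n) / (real n * (\<integral>x. x\<^sup>2 \<partial>Q n)) powr (\<nu>' / 2)"
          using num0 by simp
        also have "\<dots> \<le> C * ?np / (l\<^sub>K\<^sup>2 * v * ?np) powr (\<nu>' / 2)"
          using num num0 den lv elim(2) \<nu>' C n
          by (intro frac_le powr_mono2) (auto intro!: mult_pos_pos)
        also have "\<dots> = C / (l\<^sub>K\<^sup>2 * v) powr (\<nu>' / 2) * ?np powr (1 - \<nu>' / 2)"
          using lv elim(2) powr_mult[of "l\<^sub>K\<^sup>2 * v" ?np "\<nu>' / 2"] by (simp add: powr_diff)
        finally show ?case .
      qed
    qed
  qed
  then have "\<forall>\<^sub>F n in sequentially. measure (distr M borel (\<lambda>\<omega>. (\<Sum>i=1..n. W n i \<omega>) / ?s n)) {-\<epsilon>..\<epsilon>} < 3 * \<epsilon>"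
  proof (rule weak_conv_std_normal_small_interval[rotated, OF _ \<epsilon>])
    have [measurable]: "(\<lambda>\<omega>. Usum (h n) n \<omega>) \<in> borel_measurable M" for n
      using h(1) by (rule Usum_meas)
    show "real_distribution (distr M borel (\<lambda>\<omega>. (\<Sum>i=1..n. W n i \<omega>) / ?s n))" for n
      unfolding Wsum by (intro real_distribution_distr) measurable
  qed
  then show ?thesis using small pos
  proof eventually_elim
    case (elim n)
    have [measurable]: "(\<lambda>\<omega>. Usum (h n) n \<omega>) \<in> borel_measurable M" using h(1) by (rule Usum_meas)
    have lv: "0 < l\<^sub>K\<^sup>2 * v" using v K_bounds by simp
    have den: "l\<^sub>K\<^sup>2 * v * (real n * \<phi> (h n)) \<le> real n * (\<integral>x. x\<^sup>2 \<partial>Q n)"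
      using mult_left_mono[OF fU_variance_lower(2)[OF h(1)[of n] elim(2)], of "real n"]
      unfolding Q2 by (simp add: algebra_simps)
    have s: "sqrt (l\<^sub>K\<^sup>2 * v * (real n * \<phi> (h n))) \<le> ?s n" "0 < ?s n"
      using den mult_pos_pos[OF lv elim(3)] by (auto intro: less_le_trans)
    have "prob {\<omega>\<in>space M. \<bar>f (Usum (h n) n \<omega>)\<bar> \<le> \<epsilon> * sqrt (l\<^sub>K\<^sup>2 * v * (real n * \<phi> (h n)))}
        \<le> prob {\<omega>\<in>space M. f (Usum (h n) n \<omega>) / ?s n \<in> {-\<epsilon>..\<epsilon>}}"
    proof (intro finite_measure_mono subsetI)
      fix \<omega> assume \<omega>: "\<omega> \<in> {\<omega>\<in>space M. \<bar>f (Usum (h n) n \<omega>)\<bar> \<le> \<epsilon> * sqrt (l\<^sub>K\<^sup>2 * v * (real n * \<phi> (h n)))}"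
      then have "\<bar>f (Usum (h n) n \<omega>)\<bar> \<le> \<epsilon> * sqrt (l\<^sub>K\<^sup>2 * v * (real n * \<phi> (h n)))"
        by blast
      also have "\<dots> \<le> \<epsilon> * ?s n" using s(1) \<epsilon> by (intro mult_left_mono) auto
      finally have "\<bar>f (Usum (h n) n \<omega>)\<bar> \<le> \<epsilon> * ?s n" .
      then have "\<bar>f (Usum (h n) n \<omega>) / ?s n\<bar> \<le> \<epsilon>"
        using s(2) by (simp add: abs_divide field_simps)
      then have "f (Usum (h n) n \<omega>) / ?s n \<in> {-\<epsilon>..\<epsilon>}"
        unfolding atLeastAtMost_iff by (intro conjI; linarith)
      then show "\<omega> \<in> {\<omega>\<in>space M. f (Usum (h n) n \<omega>) / ?s n \<in> {-\<epsilon>..\<epsilon>}}"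
        using \<omega> by blast
    qed measurable
    also have "\<dots> = measure (distr M borel (\<lambda>\<omega>. (\<Sum>i=1..n. W n i \<omega>) / ?s n)) {-\<epsilon>..\<epsilon>}"
    proof -
      have rv: "(\<lambda>\<omega>. f (Usum (h n) n \<omega>) / ?s n) \<in> borel_measurable M" by measurable
      show ?thesis unfolding Wsum by (subst measure_distr[OF rv]) (auto intro!: arg_cong[where f=prob])
    qed
    finally show ?case using elim(1) by simp
  qed
qed

text \<open>A small quotient requires a small numerator or a large denominator. The first is
  improbable by the limit theorem for one functional, the second by Markov's inequality.\<close>

lemma noise_anticoncentration:
  assumes h: "\<And>n. 0 < h n" "h \<longlonglongrightarrow> 0" and \<rho>: "0 < \<rho>"
    and np: "filterlim (\<lambda>n. real n * \<phi> (h n)) at_top sequentially" and \<eta>: "0 < \<eta>"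
  shows "\<exists>\<delta>>0. \<forall>\<^sub>F n in sequentially.
    prob {\<omega>\<in>space M. norm (noise (h n) n \<omega>) \<le> \<delta> / sqrt (real n * \<phi> (h n))} \<le> \<eta>"
proof -
  interpret f: bounded_linear f by (rule f_lin)
  \<comment> \<open>\<open>A\<close> and \<epsilon> give each of the two events a bound of
    \<open>\<eta> / 2\<close>; \<delta> is solved from the requirement that a quotient below the
    threshold with denominator below \<open>A * n * \<phi> (h n)\<close> puts the functional of the
    numerator below its own threshold.\<close>
  define A where "A = 2 * L\<^sub>K / \<eta>"
  define \<epsilon> where "\<epsilon> = \<eta> / 6"
  define \<delta> where "\<delta> = \<epsilon> * sqrt (l\<^sub>K\<^sup>2 * v) / (A * N)"
  have A: "0 < A" using K_bounds \<eta> by (simp add: A_def)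
  have \<epsilon>: "0 < \<epsilon>" using \<eta> by (simp add: \<epsilon>_def)
  have \<delta>: "0 < \<delta>" using \<epsilon> A N v K_bounds by (simp add: \<delta>_def)
  have pos: "\<forall>\<^sub>F n in sequentially. 0 < real n * \<phi> (h n)"
    using np by (simp add: filterlim_at_top_dense)
  have "\<forall>\<^sub>F n in sequentially.
    prob {\<omega>\<in>space M. norm (noise (h n) n \<omega>) \<le> \<delta> / sqrt (real n * \<phi> (h n))} \<le> \<eta>"
    using fUsum_anticoncentration[OF h \<rho> np \<epsilon>] pos
  proof eventually_elim
    case (elim n)
    let ?np = "real n * \<phi> (h n)" and ?S = "\<lambda>\<omega>. kernel_sum K x (h n) n (\<lambda>i. Xs i \<omega>)"
    have [measurable]: "(\<lambda>\<omega>. Usum (h n) n \<omega>) \<in> borel_measurable M" using h(1) by (rule Usum_meas)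
    have [measurable]: "?S \<in> borel_measurable M" using h(1) by (rule kernel_sum_meas)
    let ?E1 = "{\<omega>\<in>space M. \<bar>f (Usum (h n) n \<omega>)\<bar> \<le> \<epsilon> * sqrt (l\<^sub>K\<^sup>2 * v * ?np)}"
    let ?E2 = "{\<omega>\<in>space M. A * ?np \<le> ?S \<omega>}"
    have "prob {\<omega>\<in>space M. norm (noise (h n) n \<omega>) \<le> \<delta> / sqrt ?np} \<le> prob (?E1 \<union> ?E2)"
    proof (intro finite_measure_mono subsetI)
      fix \<omega> assume "\<omega> \<in> {\<omega>\<in>space M. norm (noise (h n) n \<omega>) \<le> \<delta> / sqrt ?np}"
      then have \<omega>: "\<omega> \<in> space M" and V: "norm (noise (h n) n \<omega>) \<le> \<delta> / sqrt ?np" by auto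
      show "\<omega> \<in> ?E1 \<union> ?E2"
      proof (cases "A * ?np \<le> ?S \<omega>")
        case False
        have S0: "0 \<le> ?S \<omega>"
          unfolding kernel_sum_def using h(1) by (intro sum_nonneg weight_nonneg)
        have "\<bar>f (Usum (h n) n \<omega>)\<bar> = ?S \<omega> * \<bar>f (noise (h n) n \<omega>)\<bar>"
          using S0 Usum_eq[where h="h n" and n=n and \<omega>=\<omega>] h(1) by (simp add: f.scaleR abs_mult)
        also have "\<dots> \<le> (A * ?np) * (N * (\<delta> / sqrt ?np))"
          using False S0 f_bound[of "noise (h n) n \<omega>"] mult_left_mono[OF V, of N] N A elim(2)
          by (intro mult_mono) auto
        also have "\<dots> = \<epsilon> * sqrt (l\<^sub>K\<^sup>2 * v) * (?np / sqrt ?np)"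
          using A N by (simp add: \<delta>_def)
        also have "?np / sqrt ?np = sqrt ?np" using elim(2) by (simp add: real_div_sqrt)
        finally show ?thesis using \<omega> by (simp add: real_sqrt_mult)
      qed (use \<omega> in auto)
    qed measurable
    also have "\<dots> \<le> prob ?E1 + prob ?E2"
      by (intro measure_Un_le) measurable
    also have "\<dots> \<le> 3 * \<epsilon> + L\<^sub>K / A"
      by (intro add_mono elim(1) prob_kernel_sum_upper_tail h(1) A elim(2))
    also have "\<dots> = \<eta>" using K_bounds \<eta> by (simp add: \<epsilon>_def A_def)
    finally show ?case .
  qed
  then show ?thesis using \<delta> by blast
qed

end

section \<open>Comparison of the two estimates\<close>

lemma ennreal_divide_le_divide:
  fixes J I :: ennreal
  assumes "0 < d" "ennreal d \<le> I"
  shows "J / I \<le> J / ennreal d"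
proof (cases I)
  case (real i)
  then have "inverse i \<le> inverse d" using assms by (intro le_imp_inverse_le) auto
  then have "inverse I \<le> inverse (ennreal d)"
    using real assms by (subst inverse_ennreal) (auto simp: inverse_ennreal ennreal_leI)
  then show ?thesis unfolding divide_ennreal_def by (intro mult_left_mono) auto
qed (simp add: divide_ennreal_def)

section \<open>Orders in probability and ratios\<close>

context prob_space
begin

definition o_prob :: "(nat \<Rightarrow> 'a \<Rightarrow> real) \<Rightarrow> (nat \<Rightarrow> real) \<Rightarrow> bool" where
  "o_prob W r \<longleftrightarrow> (\<forall>\<epsilon>>0. (\<lambda>n. prob {\<omega>\<in>space M. \<epsilon> * r n < W n \<omega>}) \<longlonglongrightarrow> 0)"

text \<open>For positive \<open>r\<close> and nonnegative \<open>W\<close> this says that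
  \<open>r n / W n\<close>, read as infinite where \<open>W n\<close> vanishes, is bounded in
  probability.\<close>

definition away_from_0 :: "(nat \<Rightarrow> 'a \<Rightarrow> real) \<Rightarrow> (nat \<Rightarrow> real) \<Rightarrow> bool" where
  "away_from_0 W r \<longleftrightarrow>
    (\<forall>\<eta>>0. \<exists>\<delta>>0. \<forall>\<^sub>F n in sequentially. prob {\<omega>\<in>space M. W n \<omega> \<le> \<delta> * r n} \<le> \<eta>)"

lemma o_probD:
  "o_prob W r \<Longrightarrow> 0 < \<epsilon> \<Longrightarrow> (\<lambda>n. prob {\<omega>\<in>space M. \<epsilon> * r n < W n \<omega>}) \<longlonglongrightarrow> 0"
  by (simp add: o_prob_def)

lemma o_prob_add:
  assumes W: "o_prob W r" "o_prob W' r"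
    and meas [measurable]: "\<And>n. W n \<in> borel_measurable M" "\<And>n. W' n \<in> borel_measurable M"
  shows "o_prob (\<lambda>n \<omega>. W n \<omega> + W' n \<omega>) r"
  unfolding o_prob_def
proof (intro allI impI)
  fix \<epsilon> :: real assume \<epsilon>: "0 < \<epsilon>"
  let ?p = "\<lambda>W n. prob {\<omega>\<in>space M. \<epsilon> / 2 * r n < W n \<omega>}"
  have lim: "(\<lambda>n. ?p W n + ?p W' n) \<longlonglongrightarrow> 0 + 0"
    using \<epsilon> by (intro tendsto_add W[THEN o_probD]) auto
  have le: "prob {\<omega>\<in>space M. \<epsilon> * r n < W n \<omega> + W' n \<omega>} \<le> ?p W n + ?p W' n" for n
  proof -
    have "prob {\<omega>\<in>space M. \<epsilon> * r n < W n \<omega> + W' n \<omega>}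
        \<le> prob ({\<omega>\<in>space M. \<epsilon> / 2 * r n < W n \<omega>} \<union> {\<omega>\<in>space M. \<epsilon> / 2 * r n < W' n \<omega>})"
    proof (intro finite_measure_mono subsetI)
      fix \<omega> assume \<omega>: "\<omega> \<in> {\<omega>\<in>space M. \<epsilon> * r n < W n \<omega> + W' n \<omega>}"
      then have "\<epsilon> / 2 * r n < W n \<omega> \<or> \<epsilon> / 2 * r n < W' n \<omega>"
        by (cases "\<epsilon> / 2 * r n < W n \<omega>") auto
      then show "\<omega> \<in> {\<omega>\<in>space M. \<epsilon> / 2 * r n < W n \<omega>} \<union> {\<omega>\<in>space M. \<epsilon> / 2 * r n < W' n \<omega>}"
        using \<omega> by blast
    qed measurable
    also have "\<dots> \<le> ?p W n + ?p W' n" by (intro measure_Un_le) measurable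
    finally show ?thesis .
  qed
  show "(\<lambda>n. prob {\<omega>\<in>space M. \<epsilon> * r n < W n \<omega> + W' n \<omega>}) \<longlonglongrightarrow> 0"
    using lim unfolding add_0_left
    by (rule Lim_null_comparison[rotated]) (simp only: real_norm_def abs_of_nonneg measure_nonneg le eventually_True)
qed

lemma o_prob_mono:
  assumes W: "o_prob W r" and le: "\<And>n \<omega>. \<omega> \<in> space M \<Longrightarrow> W' n \<omega> \<le> W n \<omega>"
    and meas [measurable]: "\<And>n. W n \<in> borel_measurable M"
  shows "o_prob W' r"
  unfolding o_prob_def
proof (intro allI impI)
  fix \<epsilon> :: real assume \<epsilon>: "0 < \<epsilon>"
  have le: "prob {\<omega>\<in>space M. \<epsilon> * r n < W' n \<omega>} \<le> prob {\<omega>\<in>space M. \<epsilon> * r n < W n \<omega>}" for n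
    using le by (intro finite_measure_mono) (auto intro: less_le_trans)
  show "(\<lambda>n. prob {\<omega>\<in>space M. \<epsilon> * r n < W' n \<omega>}) \<longlonglongrightarrow> 0"
    using o_probD[OF W \<epsilon>]
    by (rule Lim_null_comparison[rotated]) (simp only: real_norm_def abs_of_nonneg measure_nonneg le eventually_True)
qed

lemma o_prob_if_small_o_prob:
  assumes W: "small_o_prob M (\<lambda>n \<omega>. ennreal (W n \<omega>)) s"
    and A: "0 < A" "\<forall>\<^sub>F n in sequentially. 0 \<le> s n \<and> s n \<le> A * r n"
    and meas [measurable]: "\<And>n. W n \<in> borel_measurable M"
  shows "o_prob W r"
  unfolding o_prob_def
proof (intro allI impI)
  fix \<epsilon> :: real assume \<epsilon>: "0 < \<epsilon>"
  have lim: "(\<lambda>n. prob {\<omega>\<in>space M. ennreal (\<epsilon> / A * s n) < ennreal (W n \<omega>)}) \<longlonglongrightarrow> 0"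
    using W[unfolded small_o_prob_def, rule_format, of "\<epsilon> / A"] \<epsilon> A(1) by simp
  show "(\<lambda>n. prob {\<omega>\<in>space M. \<epsilon> * r n < W n \<omega>}) \<longlonglongrightarrow> 0"
  proof (rule tendsto_sandwich[OF _ _ tendsto_const lim])
    show "\<forall>\<^sub>F n in sequentially. prob {\<omega>\<in>space M. \<epsilon> * r n < W n \<omega>}
        \<le> prob {\<omega>\<in>space M. ennreal (\<epsilon> / A * s n) < ennreal (W n \<omega>)}"
      using A(2)
    proof eventually_elim
      case (elim n)
      have le: "\<epsilon> / A * s n \<le> \<epsilon> * r n" and ge: "0 \<le> \<epsilon> / A * s n"
        using elim \<epsilon> A mult_left_mono[of "s n" "A * r n" "\<epsilon> / A"] by auto
      show ?case
        using le ge by (intro finite_measure_mono) (auto simp: ennreal_less_iff)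
    qed
  qed (simp add: always_eventually)
qed

text \<open>Chebyshev's inequality in the extended nonnegative reals, because the second moment may
  be infinite for finitely many \<open>n\<close>.\<close>

lemma o_prob_if_second_moment:
  assumes lim: "(\<lambda>n. (\<integral>\<^sup>+\<omega>. ennreal ((W n \<omega>)\<^sup>2) \<partial>M) / ennreal ((r n)\<^sup>2)) \<longlonglongrightarrow> 0"
    and r: "\<And>n. 0 < r n" and meas [measurable]: "\<And>n. W n \<in> borel_measurable M"
    and nonneg: "\<And>n \<omega>. 0 \<le> W n \<omega>"
  shows "o_prob W r"
  unfolding o_prob_def
proof (intro allI impI)
  fix \<epsilon> :: real assume \<epsilon>: "0 < \<epsilon>"
  let ?I = "\<lambda>n. \<integral>\<^sup>+\<omega>. ennreal ((W n \<omega>)\<^sup>2) \<partial>M"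
  have le: "ennreal (prob {\<omega>\<in>space M. \<epsilon> * r n < W n \<omega>}) \<le> ennreal (1 / \<epsilon>\<^sup>2) * (?I n / ennreal ((r n)\<^sup>2))" for n
  proof -
    have "ennreal ((\<epsilon> * r n)\<^sup>2) * emeasure M {\<omega>\<in>space M. \<epsilon> * r n < W n \<omega>}
        = (\<integral>\<^sup>+\<omega>. ennreal ((\<epsilon> * r n)\<^sup>2) * indicator {\<omega>\<in>space M. \<epsilon> * r n < W n \<omega>} \<omega> \<partial>M)"
      by (intro nn_integral_cmult_indicator[symmetric]) measurable
    also have "\<dots> \<le> ?I n"
      using \<epsilon> r[of n] by (intro nn_integral_mono) (auto simp: indicator_def intro!: ennreal_leI power_mono)
    finally have "ennreal ((\<epsilon> * r n)\<^sup>2) * ennreal (prob {\<omega>\<in>space M. \<epsilon> * r n < W n \<omega>}) \<le> ?I n"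
      by (simp add: emeasure_eq_measure)
    then have "ennreal (1 / (\<epsilon> * r n)\<^sup>2) * (ennreal ((\<epsilon> * r n)\<^sup>2) * ennreal (prob {\<omega>\<in>space M. \<epsilon> * r n < W n \<omega>}))
        \<le> ennreal (1 / (\<epsilon> * r n)\<^sup>2) * ?I n"
      by (rule mult_left_mono) simp
    moreover have "ennreal (1 / (\<epsilon> * r n)\<^sup>2) * (ennreal ((\<epsilon> * r n)\<^sup>2) * ennreal q) = ennreal q" if "0 \<le> q" for q
      using \<epsilon> r[of n] that by (simp flip: ennreal_mult)
    moreover have "ennreal (1 / (\<epsilon> * r n)\<^sup>2) * ?I n = ennreal (1 / \<epsilon>\<^sup>2) * (?I n / ennreal ((r n)\<^sup>2))"
    proof -
      have "ennreal (1 / (\<epsilon> * r n)\<^sup>2) = ennreal (1 / \<epsilon>\<^sup>2) * inverse (ennreal ((r n)\<^sup>2))"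
        using \<epsilon> r[of n] by (simp add: power_mult_distrib inverse_ennreal divide_inverse flip: ennreal_mult)
      then show ?thesis by (simp add: divide_ennreal_def ac_simps)
    qed
    ultimately show ?thesis by simp
  qed
  have "(\<lambda>n. ennreal (1 / \<epsilon>\<^sup>2) * (?I n / ennreal ((r n)\<^sup>2))) \<longlonglongrightarrow> ennreal (1 / \<epsilon>\<^sup>2) * 0"
    by (intro ennreal_tendsto_cmult lim) simp
  then have "(\<lambda>n. ennreal (prob {\<omega>\<in>space M. \<epsilon> * r n < W n \<omega>})) \<longlonglongrightarrow> ennreal 0"
    unfolding mult_zero_right ennreal_0
    by (rule tendsto_sandwich[OF _ _ tendsto_const, rotated 2]) (simp_all only: le eventually_True zero_le)
  then show "(\<lambda>n. prob {\<omega>\<in>space M. \<epsilon> * r n < W n \<omega>}) \<longlonglongrightarrow> 0"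
    by (subst (asm) tendsto_ennreal_iff) auto
qed

text \<open>If \<open>Z\<close> and \<open>W\<close> are both at most
  \<open>\<delta> / 2 * r n\<close>, then \<open>V\<close> is at most \<open>\<delta> * r n\<close>.
  The lower order of the noise passes in this way to the whole error.\<close>

lemma away_from_0_perturb:
  assumes V: "away_from_0 V r" and W: "o_prob W r"
    and le: "\<And>n \<omega>. \<omega> \<in> space M \<Longrightarrow> V n \<omega> \<le> Z n \<omega> + W n \<omega>"
    and r: "\<And>n. 0 \<le> r n"
    and meas [measurable]: "\<And>n. V n \<in> borel_measurable M" "\<And>n. W n \<in> borel_measurable M"
  shows "away_from_0 Z r"
  unfolding away_from_0_def
proof (intro allI impI)
  fix \<eta> :: real assume \<eta>: "0 < \<eta>"
  then have "0 < \<eta> / 2" by simp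
  with V obtain \<delta> where \<delta>: "0 < \<delta>"
    and ev: "\<forall>\<^sub>F n in sequentially. prob {\<omega>\<in>space M. V n \<omega> \<le> \<delta> * r n} \<le> \<eta> / 2"
    unfolding away_from_0_def by blast
  have "(\<lambda>n. prob {\<omega>\<in>space M. \<delta> / 2 * r n < W n \<omega>}) \<longlonglongrightarrow> 0"
    using \<delta> by (intro o_probD[OF W]) simp
  then have "\<forall>\<^sub>F n in sequentially. prob {\<omega>\<in>space M. \<delta> / 2 * r n < W n \<omega>} < \<eta> / 2"
    using \<eta> by (intro order_tendstoD(2)) auto
  with ev have "\<forall>\<^sub>F n in sequentially. prob {\<omega>\<in>space M. Z n \<omega> \<le> \<delta> / 2 * r n} \<le> \<eta>"
  proof eventually_elim
    case (elim n)
    have "prob {\<omega>\<in>space M. Z n \<omega> \<le> \<delta> / 2 * r n}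
        \<le> prob ({\<omega>\<in>space M. V n \<omega> \<le> \<delta> * r n} \<union> {\<omega>\<in>space M. \<delta> / 2 * r n < W n \<omega>})"
    proof (intro finite_measure_mono subsetI)
      fix \<omega> assume "\<omega> \<in> {\<omega>\<in>space M. Z n \<omega> \<le> \<delta> / 2 * r n}"
      then show "\<omega> \<in> {\<omega>\<in>space M. V n \<omega> \<le> \<delta> * r n} \<union> {\<omega>\<in>space M. \<delta> / 2 * r n < W n \<omega>}"
        using le[of \<omega> n] by (auto simp: not_less)
    qed measurable
    also have "\<dots> \<le> prob {\<omega>\<in>space M. V n \<omega> \<le> \<delta> * r n} + prob {\<omega>\<in>space M. \<delta> / 2 * r n < W n \<omega>}"
      by (intro measure_Un_le) measurable
    finally show ?case using elim by simp
  qed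
  then show "\<exists>\<delta>>0. \<forall>\<^sub>F n in sequentially. prob {\<omega>\<in>space M. Z n \<omega> \<le> \<delta> * r n} \<le> \<eta>"
    using \<delta> by (intro exI[of _ "\<delta> / 2"]) auto
qed

text \<open>Outside the event \<open>Z n \<omega> \<le> \<delta> * r n\<close> the denominator is
  positive and the extended quotient is an ordinary one. Vanishing denominators, where the quotient
  may be infinite, fall into that improbable event.\<close>

lemma small_o_prob_ratio:
  assumes W: "o_prob W r" and Z: "away_from_0 Z r" and r: "\<And>n. 0 < r n"
    and meas [measurable]: "\<And>n. W n \<in> borel_measurable M" "\<And>n. Z n \<in> borel_measurable M"
  shows "small_o_prob M (\<lambda>n \<omega>. ennreal (W n \<omega>) / ennreal (Z n \<omega>)) (\<lambda>_. 1)"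
  unfolding small_o_prob_def
proof (intro allI impI)
  fix \<epsilon> :: real assume \<epsilon>: "0 < \<epsilon>"
  let ?p = "\<lambda>n. prob {\<omega>\<in>space M. ennreal (\<epsilon> * 1) < ennreal (W n \<omega>) / ennreal (Z n \<omega>)}"
  show "?p \<longlonglongrightarrow> 0"
  proof (rule order_tendstoI)
    fix \<eta> :: real assume \<eta>: "0 < \<eta>"
    then have "0 < \<eta> / 2" by simp
    with Z obtain \<delta> where \<delta>: "0 < \<delta>"
      and ev: "\<forall>\<^sub>F n in sequentially. prob {\<omega>\<in>space M. Z n \<omega> \<le> \<delta> * r n} \<le> \<eta> / 2"
      unfolding away_from_0_def by blast
    have "(\<lambda>n. prob {\<omega>\<in>space M. (\<epsilon> * \<delta>) * r n < W n \<omega>}) \<longlonglongrightarrow> 0"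
      using \<delta> \<epsilon> by (intro o_probD[OF W]) simp
    then have "\<forall>\<^sub>F n in sequentially. prob {\<omega>\<in>space M. (\<epsilon> * \<delta>) * r n < W n \<omega>} < \<eta> / 2"
      using \<eta> by (intro order_tendstoD(2)) auto
    with ev show "\<forall>\<^sub>F n in sequentially. ?p n < \<eta>"
    proof eventually_elim
      case (elim n)
      have "?p n \<le> prob ({\<omega>\<in>space M. Z n \<omega> \<le> \<delta> * r n} \<union> {\<omega>\<in>space M. (\<epsilon> * \<delta>) * r n < W n \<omega>})"
      proof (intro finite_measure_mono subsetI)
        fix \<omega> assume \<omega>: "\<omega> \<in> {\<omega>\<in>space M. ennreal (\<epsilon> * 1) < ennreal (W n \<omega>) / ennreal (Z n \<omega>)}"
        show "\<omega> \<in> {\<omega>\<in>space M. Z n \<omega> \<le> \<delta> * r n} \<union> {\<omega>\<in>space M. (\<epsilon> * \<delta>) * r n < W n \<omega>}"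
        proof (rule ccontr)
          assume "\<not> ?thesis"
          then have z: "\<delta> * r n < Z n \<omega>" and w: "W n \<omega> \<le> \<epsilon> * \<delta> * r n" using \<omega> by auto
          have z0: "0 < Z n \<omega>" using z \<delta> r[of n] by (meson less_trans mult_pos_pos)
          have "\<epsilon> * (\<delta> * r n) \<le> \<epsilon> * Z n \<omega>" using z \<epsilon> by (intro mult_left_mono) auto
          then have "W n \<omega> \<le> \<epsilon> * Z n \<omega>" using w by (simp add: mult.assoc)
          \<comment> \<open>\<open>W\<close> may be negative, and \<open>ennreal\<close> sends
            negative reals to 0; taking \<open>max 0\<close> mirrors this truncation.\<close>
          then have "max 0 (W n \<omega>) / Z n \<omega> \<le> \<epsilon>" using z0 \<epsilon> by (simp add: field_simps)
          then have "ennreal (max 0 (W n \<omega>)) / ennreal (Z n \<omega>) \<le> ennreal \<epsilon>"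
            using z0 by (subst divide_ennreal) (auto intro: ennreal_leI)
          then show False using \<omega> by (simp add: max_def ennreal_neg split: if_splits)
        qed
      qed measurable
      also have "\<dots> \<le> prob {\<omega>\<in>space M. Z n \<omega> \<le> \<delta> * r n} + prob {\<omega>\<in>space M. (\<epsilon> * \<delta>) * r n < W n \<omega>}"
        by (intro measure_Un_le) measurable
      finally show ?case using elim by simp
    qed
  qed (auto intro!: always_eventually less_le_trans[OF _ measure_nonneg])
qed

text \<open>\<open>Z n > \<delta> * r n\<close> with probability at least 1/2 bounds the second
  moment of \<open>Z n\<close> below by \<open>\<delta>^2 * (r n)^2 / 2\<close>, whether or not that
  moment is finite.\<close>

lemma second_moment_ratio:
  assumes lim: "(\<lambda>n. J n / ennreal ((r n)\<^sup>2)) \<longlonglongrightarrow> 0" and Z: "away_from_0 Z r" and r: "\<And>n. 0 < r n"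
    and meas [measurable]: "\<And>n. Z n \<in> borel_measurable M"
  shows "(\<lambda>n. J n / (\<integral>\<^sup>+\<omega>. ennreal ((Z n \<omega>)\<^sup>2) \<partial>M)) \<longlonglongrightarrow> 0"
proof -
  have "(0::real) < 1 / 2" by simp
  with Z obtain \<delta> where \<delta>: "0 < \<delta>"
    and ev: "\<forall>\<^sub>F n in sequentially. prob {\<omega>\<in>space M. Z n \<omega> \<le> \<delta> * r n} \<le> 1 / 2"
    unfolding away_from_0_def by blast
  have "(\<lambda>n. ennreal (2 / \<delta>\<^sup>2) * (J n / ennreal ((r n)\<^sup>2))) \<longlonglongrightarrow> ennreal (2 / \<delta>\<^sup>2) * 0"
    by (intro ennreal_tendsto_cmult lim) simp
  then have lim': "(\<lambda>n. ennreal (2 / \<delta>\<^sup>2) * (J n / ennreal ((r n)\<^sup>2))) \<longlonglongrightarrow> 0" by simp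
  show ?thesis
  proof (rule tendsto_sandwich[OF _ _ tendsto_const lim'])
    show "\<forall>\<^sub>F n in sequentially. J n / (\<integral>\<^sup>+\<omega>. ennreal ((Z n \<omega>)\<^sup>2) \<partial>M)
        \<le> ennreal (2 / \<delta>\<^sup>2) * (J n / ennreal ((r n)\<^sup>2))"
      using ev
    proof eventually_elim
      case (elim n)
      let ?E = "{\<omega>\<in>space M. Z n \<omega> \<le> \<delta> * r n}"
      have E: "?E \<in> sets M" by measurable
      have "1 / 2 \<le> prob (space M - ?E)"
        using prob_compl[OF E] elim by simp
      then have "ennreal (\<delta>\<^sup>2 * (r n)\<^sup>2 / 2) \<le> ennreal ((\<delta> * r n)\<^sup>2) * emeasure M (space M - ?E)"
        using mult_left_mono[of "1 / 2" "prob (space M - ?E)" "(\<delta> * r n)\<^sup>2"]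
        by (simp add: emeasure_eq_measure power_mult_distrib ennreal_leI flip: ennreal_mult)
      also have "\<dots> = (\<integral>\<^sup>+\<omega>. ennreal ((\<delta> * r n)\<^sup>2) * indicator (space M - ?E) \<omega> \<partial>M)"
        by (intro nn_integral_cmult_indicator[symmetric]) measurable
      also have "\<dots> \<le> (\<integral>\<^sup>+\<omega>. ennreal ((Z n \<omega>)\<^sup>2) \<partial>M)"
        using \<delta> r[of n] by (intro nn_integral_mono) (auto simp: indicator_def intro!: ennreal_leI power_mono)
      finally have "J n / (\<integral>\<^sup>+\<omega>. ennreal ((Z n \<omega>)\<^sup>2) \<partial>M) \<le> J n / ennreal (\<delta>\<^sup>2 * (r n)\<^sup>2 / 2)"
        using \<delta> r[of n] by (intro ennreal_divide_le_divide) auto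
      also have "\<dots> = ennreal (2 / \<delta>\<^sup>2) * (J n / ennreal ((r n)\<^sup>2))"
      proof -
        have "inverse (ennreal (\<delta>\<^sup>2 * (r n)\<^sup>2 / 2)) = ennreal (2 / \<delta>\<^sup>2) * inverse (ennreal ((r n)\<^sup>2))"
          using \<delta> r[of n] by (simp add: inverse_ennreal field_simps flip: ennreal_mult)
        then show ?thesis by (simp add: divide_ennreal_def ac_simps)
      qed
      finally show ?case .
    qed
  qed auto
qed

end

section \<open>Negligible terms at the two bandwidths\<close>

context kernel_noise
begin

text \<open>Divided by \<open>h powr (2 * \<beta>)\<close>, the squared bias leaves
  \<open>h powr (2 * (\<beta>\<^sub>1 - \<beta>))\<close> and the noise variance the reciprocal of
  the signal-to-noise product; both vanish. The factor \<open>A^2\<close> passes from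
  \<open>h powr \<beta>\<close> to the scale \<open>r\<close>.\<close>

lemma bias_noise_ratio_tendsto_0:
  assumes type2: "type2_space TYPE('b)" and coords: "coordinate_functionals I e (\<psi> :: nat \<Rightarrow> 'b \<Rightarrow> real)"
    and F_meas: "F \<in> borel_measurable borel" and \<rho>: "0 < \<rho>" and b: "0 \<le> b" and \<beta>: "0 < \<beta>" "\<beta> < \<beta>\<^sub>1"
    and F: "\<And>z. dist x z \<le> \<rho> \<Longrightarrow> norm (F z - F x) \<le> b * dist x z powr \<beta>\<^sub>1"
    and h: "\<And>n. 0 < h n" "h \<longlonglongrightarrow> 0"
    and snr: "filterlim (\<lambda>n. h n powr (2 * \<beta>) * (real n * \<phi> (h n))) at_top sequentially"
    and A: "0 < A" "\<forall>\<^sub>F n in sequentially. h n powr \<beta> \<le> A * r n" and r: "\<And>n. 0 < r n"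
  shows "(\<lambda>n. (\<integral>\<^sup>+\<omega>. ennreal ((norm (bias F (h n) n \<omega> + noise (h n) n \<omega>))\<^sup>2) \<partial>M) / ennreal ((r n)\<^sup>2)) \<longlonglongrightarrow> 0"
proof -
  have \<beta>\<^sub>1: "0 \<le> \<beta>\<^sub>1" using \<beta> by simp
  obtain C where C: "0 \<le> C" and mom: "\<And>h n. 0 < h \<Longrightarrow> h \<le> \<rho> \<Longrightarrow> 0 < real n * \<phi> h \<Longrightarrow>
    (\<integral>\<^sup>+\<omega>. ennreal ((norm (bias F h n \<omega> + noise h n \<omega>))\<^sup>2) \<partial>M)
      \<le> ennreal (C * (h powr (2 * \<beta>\<^sub>1) + 1 / (real n * \<phi> h)))"
    using bias_noise_second_moment[OF type2 coords F_meas b \<beta>\<^sub>1 order.refl F] by blast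
  have h_right: "filterlim h (at_right 0) sequentially"
    using h by (auto simp: filterlim_at less_imp_neq[symmetric])
  let ?g = "\<lambda>n. h n powr (2 * (\<beta>\<^sub>1 - \<beta>)) + inverse (h n powr (2 * \<beta>) * (real n * \<phi> (h n)))"
  have g: "(\<lambda>n. C * A\<^sup>2 * ?g n) \<longlonglongrightarrow> C * A\<^sup>2 * (0 + 0)"
  proof (intro tendsto_mult tendsto_add tendsto_const)
    have "((\<lambda>t::real. t powr (2 * (\<beta>\<^sub>1 - \<beta>))) \<longlongrightarrow> 0) (at_right 0)"
      using \<beta> by real_asymp
    then show "(\<lambda>n. h n powr (2 * (\<beta>\<^sub>1 - \<beta>))) \<longlonglongrightarrow> 0"
      by (rule filterlim_compose[OF _ h_right])
    show "(\<lambda>n. inverse (h n powr (2 * \<beta>) * (real n * \<phi> (h n)))) \<longlonglongrightarrow> 0"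
      by (intro tendsto_inverse_0_at_top snr)
  qed
  have lim: "(\<lambda>n. ennreal (C * A\<^sup>2 * ?g n)) \<longlonglongrightarrow> 0"
    using tendsto_ennrealI[OF g] by simp
  have pos: "\<forall>\<^sub>F n in sequentially. 0 < h n powr (2 * \<beta>) * (real n * \<phi> (h n))"
    using snr by (simp add: filterlim_at_top_dense)
  show ?thesis
  proof (rule tendsto_sandwich[OF _ _ tendsto_const lim])
    show "\<forall>\<^sub>F n in sequentially. (\<integral>\<^sup>+\<omega>. ennreal ((norm (bias F (h n) n \<omega> + noise (h n) n \<omega>))\<^sup>2) \<partial>M) / ennreal ((r n)\<^sup>2)
        \<le> ennreal (C * A\<^sup>2 * ?g n)"
      using order_tendstoD(2)[OF h(2) \<rho>] A(2) pos
    proof eventually_elim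
      case (elim n)
      have np: "0 < real n * \<phi> (h n)" and hp: "0 < h n powr (2 * \<beta>)"
        using elim(3) h(1)[of n] by (auto simp: zero_less_mult_iff)
      have "0 \<le> inverse (h n powr (2 * \<beta>) * (real n * \<phi> (h n)))"
        using elim(3) by (simp only: inverse_nonnegative_iff_nonnegative less_imp_le)
      then have g0: "0 \<le> ?g n" by (intro add_nonneg_nonneg powr_ge_zero)
      have "(\<integral>\<^sup>+\<omega>. ennreal ((norm (bias F (h n) n \<omega> + noise (h n) n \<omega>))\<^sup>2) \<partial>M)
          \<le> ennreal (C * (h n powr (2 * \<beta>\<^sub>1) + 1 / (real n * \<phi> (h n))))"
        using elim np h(1) by (intro mom) auto
      also have "h n powr (2 * \<beta>\<^sub>1) + 1 / (real n * \<phi> (h n)) = h n powr (2 * \<beta>) * ?g n"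
        using hp np by (simp add: distrib_left powr_add[symmetric] field_simps)
      also have "ennreal (C * (h n powr (2 * \<beta>) * ?g n)) \<le> ennreal (C * A\<^sup>2 * ?g n * (r n)\<^sup>2)"
      proof (intro ennreal_leI)
        have "h n powr (2 * \<beta>) = (h n powr \<beta>)\<^sup>2"
          by (simp add: power2_eq_square powr_add[symmetric])
        also have "\<dots> \<le> (A * r n)\<^sup>2" using elim by (intro power_mono) auto
        finally have "h n powr (2 * \<beta>) \<le> A\<^sup>2 * (r n)\<^sup>2" by (simp add: power_mult_distrib)
        moreover have "0 \<le> C * ?g n" using C g0 by (rule mult_nonneg_nonneg)
        ultimately have "C * ?g n * h n powr (2 * \<beta>) \<le> C * ?g n * (A\<^sup>2 * (r n)\<^sup>2)"
          by (rule mult_left_mono)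
        then show "C * (h n powr (2 * \<beta>) * ?g n) \<le> C * A\<^sup>2 * ?g n * (r n)\<^sup>2"
          by (simp only: ac_simps)
      qed
      finally have "(\<integral>\<^sup>+\<omega>. ennreal ((norm (bias F (h n) n \<omega> + noise (h n) n \<omega>))\<^sup>2) \<partial>M) / ennreal ((r n)\<^sup>2)
          \<le> ennreal (C * A\<^sup>2 * ?g n * (r n)\<^sup>2) / ennreal ((r n)\<^sup>2)"
        by (rule divide_right_mono_ennreal)
      also have "\<dots> = ennreal (C * A\<^sup>2 * ?g n)"
      proof -
        have "0 \<le> C * A\<^sup>2 * ?g n" using C g0 by (intro mult_nonneg_nonneg) auto
        moreover have "ennreal (q * t) / ennreal t = ennreal q" if "0 \<le> q" "0 < t" for q t
          using that by (simp add: divide_ennreal)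
        ultimately show ?thesis using r[of n] by simp
      qed
      finally show ?case .
    qed
  qed auto
qed

text \<open>Unless the ball is empty, the bias is bounded by a multiple of
  \<open>h n powr \<beta>\<^sub>1\<close>, which is eventually below
  \<open>\<epsilon> * h n powr \<beta>\<close>. A larger bias thus occurs only on the event of the
  Chernoff bound.\<close>

lemma bias_o_prob:
  assumes F_meas: "F \<in> borel_measurable borel" and \<rho>: "0 < \<rho>" and b: "0 \<le> b" and \<beta>: "0 < \<beta>" "\<beta> < \<beta>\<^sub>1"
    and F: "\<And>z. dist x z \<le> \<rho> \<Longrightarrow> norm (F z - F x) \<le> b * dist x z powr \<beta>\<^sub>1"
    and h: "\<And>n. 0 < h n" "h \<longlonglongrightarrow> 0"
    and np: "filterlim (\<lambda>n. real n * \<phi> (h n)) at_top sequentially"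
  shows "o_prob (\<lambda>n \<omega>. norm (bias F (h n) n \<omega>)) (\<lambda>n. h n powr \<beta>)"
  unfolding o_prob_def
proof (intro allI impI)
  fix \<epsilon> :: real assume \<epsilon>: "0 < \<epsilon>"
  have h_right: "filterlim h (at_right 0) sequentially"
    using h by (auto simp: filterlim_at less_imp_neq[symmetric])
  have "((\<lambda>t::real. \<Lambda> * b * t powr (\<beta>\<^sub>1 - \<beta>)) \<longlongrightarrow> \<Lambda> * b * 0) (at_right 0)"
    using \<beta> by (intro tendsto_mult tendsto_const) real_asymp
  then have "(\<lambda>n. \<Lambda> * b * h n powr (\<beta>\<^sub>1 - \<beta>)) \<longlonglongrightarrow> \<Lambda> * b * 0"
    by (rule filterlim_compose[OF _ h_right])
  then have small: "\<forall>\<^sub>F n in sequentially. \<Lambda> * b * h n powr (\<beta>\<^sub>1 - \<beta>) < \<epsilon>"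
    using \<epsilon> by (intro order_tendstoD(2)) auto
  have "((\<lambda>t::real. 2 * exp (- t / 4)) \<longlongrightarrow> 0) at_top" by real_asymp
  then have lim: "(\<lambda>n. 2 * exp (- (real n * \<phi> (h n)) / 4)) \<longlonglongrightarrow> 0"
    by (rule filterlim_compose[OF _ np])
  show "(\<lambda>n. prob {\<omega>\<in>space M. \<epsilon> * h n powr \<beta> < norm (bias F (h n) n \<omega>)}) \<longlonglongrightarrow> 0"
  proof (rule tendsto_sandwich[OF _ _ tendsto_const lim])
    show "\<forall>\<^sub>F n in sequentially. prob {\<omega>\<in>space M. \<epsilon> * h n powr \<beta> < norm (bias F (h n) n \<omega>)}
        \<le> 2 * exp (- (real n * \<phi> (h n)) / 4)"
      using small order_tendstoD(2)[OF h(2) \<rho>] eventually_ge_at_top[of 1]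
    proof eventually_elim
      case (elim n)
      have "prob {\<omega>\<in>space M. \<epsilon> * h n powr \<beta> < norm (bias F (h n) n \<omega>)}
          \<le> prob {\<omega>\<in>space M. count (h n) n \<omega> \<le> real n * \<phi> (h n) / 4}"
      proof (intro finite_measure_mono subsetI)
        fix \<omega> assume \<omega>: "\<omega> \<in> {\<omega>\<in>space M. \<epsilon> * h n powr \<beta> < norm (bias F (h n) n \<omega>)}"
        have "\<Lambda> * (b * h n powr \<beta>\<^sub>1) = \<Lambda> * b * h n powr (\<beta>\<^sub>1 - \<beta>) * h n powr \<beta>"
          by (simp add: mult.assoc powr_add[symmetric])
        also have "\<dots> \<le> \<epsilon> * h n powr \<beta>" using elim by (intro mult_right_mono) auto
        finally have "\<not> norm (bias F (h n) n \<omega>) \<le> \<Lambda> * (b * h n powr \<beta>\<^sub>1)" using \<omega> by auto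
        moreover have "norm (bias F (h n) n \<omega>) \<le> \<Lambda> * (b * h n powr \<beta>\<^sub>1)
          \<or> count (h n) n \<omega> = 0 \<and> norm (bias F (h n) n \<omega>) \<le> \<Lambda> * norm (F x)"
          using elim \<beta> h(1) by (intro bias_bound b F) auto
        ultimately have "count (h n) n \<omega> = 0" by blast
        then show "\<omega> \<in> {\<omega>\<in>space M. count (h n) n \<omega> \<le> real n * \<phi> (h n) / 4}"
          using \<omega> \<phi>_nonneg[of "h n"] by simp
      qed measurable
      also have "\<dots> \<le> 2 * exp (- (real n * \<phi> (h n)) / 4)"
        using prob_count_lower_tail[OF elim(3), of "h n"] by simp
      finally show ?case .
    qed
  qed auto
qed

end

section \<open>Assembly of the upper bound at \<open>hop\<close> and the lower bound at
  \<open>hb\<close>\<close>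

theorem theorem9:
  fixes M :: "'w measure" and R :: "'r measure"
    and X :: "'w \<Rightarrow> 'c::polish_space" and Y :: "'w \<Rightarrow> 'r"
    and Xs :: "nat \<Rightarrow> 'w \<Rightarrow> 'c" and Ys :: "nat \<Rightarrow> 'w \<Rightarrow> 'r"
    and \<kappa> :: "'c \<Rightarrow> 'r measure"
    and x :: 'c
    and K :: "real \<Rightarrow> real"
    and e :: "nat \<Rightarrow> 'b::{banach, second_countable_topology}"
    and I :: "nat set" and \<psi> :: "nat \<Rightarrow> 'b \<Rightarrow> real" and i\<^sub>0 :: nat
    and F :: "'c \<Rightarrow> 'g::{banach, second_countable_topology}" and G :: "'r \<Rightarrow> 'g"
    and L :: "'g \<Rightarrow> 'b"
    and T :: "'r measure \<Rightarrow> 'b"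
    and C\<^sub>1 C\<^sub>2 C\<^sub>3 C\<^sub>4 t\<^sub>1 t\<^sub>2 t\<^sub>3 t\<^sub>4 :: real
    and l\<^sub>K L\<^sub>K \<beta> b\<^sub>F \<nu> c\<^sub>G a b \<beta>\<^sub>1 b\<^sub>F' :: real
    and hb hop :: "nat \<Rightarrow> real"
  defines "\<phi> \<equiv> small_ball_prob M X x"
    and "\<Theta> \<equiv> T (\<kappa> x)"
    and "est \<equiv> \<lambda>h n \<omega>. kernel_estimate T R K x h n (\<lambda>i. Xs i \<omega>) (\<lambda>i. Ys i \<omega>)"
    and "B \<equiv> \<lambda>h n \<omega>. bias_term L F K x h n (\<lambda>i. Xs i \<omega>)"
    and "V \<equiv> \<lambda>h n \<omega>. noise_term L G \<kappa> K x h n (\<lambda>i. Xs i \<omega>) (\<lambda>i. Ys i \<omega>)"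
    and "Rem \<equiv> \<lambda>h n \<omega>. remainder_term T R L F G \<kappa> K x h n (\<lambda>i. Xs i \<omega>) (\<lambda>i. Ys i \<omega>)"
    and "f \<equiv> bandwidth_objective a b \<beta> C\<^sub>1 C\<^sub>2 t\<^sub>1 t\<^sub>2 t\<^sub>3"
  assumes prob: "prob_space M"
    and X_meas: "X \<in> measurable M borel" and Y_meas: "Y \<in> measurable M R"
    and sample_indep:
      "prob_space.indep_vars M (\<lambda>_. borel \<Otimes>\<^sub>M R) (\<lambda>i \<omega>. (Xs i \<omega>, Ys i \<omega>)) {1..}"
    and sample_law:
      "\<And>i. i \<ge> 1 \<Longrightarrow> distr M (borel \<Otimes>\<^sub>M R) (\<lambda>\<omega>. (Xs i \<omega>, Ys i \<omega>))
                    = distr M (borel \<Otimes>\<^sub>M R) (\<lambda>\<omega>. (X \<omega>, Y \<omega>))"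
    and rcd: "regular_cond_distr M R X Y \<kappa>"
    and K_meas: "K \<in> borel_measurable (restrict_space borel {0..})"
    and K_nonneg: "\<And>u. 0 \<le> u \<Longrightarrow> 0 \<le> K u"
    and type2: "type2_space TYPE('b)"
    and basis: "schauder_basis I e"
    and coords: "coordinate_functionals I e \<psi>"
    and F_meas: "F \<in> borel_measurable borel" and G_meas: "G \<in> borel_measurable R"
    and L_lin: "bounded_linear L"
    and est_meas: "\<And>h n. 0 < h \<Longrightarrow> est h n \<in> borel_measurable M"
    and C_pos: "0 < C\<^sub>1" "0 < C\<^sub>2" "0 < C\<^sub>3" "0 < C\<^sub>4"
    and t_range: "0 \<le> t\<^sub>1" "0 < t\<^sub>2" "0 \<le> t\<^sub>3" "0 \<le> t\<^sub>4"
    and small_ball: "\<forall>\<^sub>F h in at_right 0.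
        C\<^sub>1 * h powr t\<^sub>1 * exp (- log_rate C\<^sub>2 t\<^sub>2 t\<^sub>3 h) \<le> \<phi> h \<and>
        \<phi> h \<le> C\<^sub>3 * h powr t\<^sub>4 * exp (- log_rate C\<^sub>4 t\<^sub>2 t\<^sub>3 h)"
    and K_bounds: "0 < l\<^sub>K" "l\<^sub>K \<le> L\<^sub>K"
      "\<And>u. 0 \<le> u \<Longrightarrow> u \<le> 1 \<Longrightarrow> l\<^sub>K \<le> K u \<and> K u \<le> L\<^sub>K"
      "\<And>u. 1 < u \<Longrightarrow> K u = 0"
    and F_smooth: "0 < \<beta>" "0 < b\<^sub>F"
      "\<forall>\<^sub>F z in nhds x. norm (F z - F x) \<le> b\<^sub>F * dist x z powr \<beta>"
    and G_moment: "2 < \<nu>"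
      "\<forall>\<^sub>F z in nhds x.
         (\<integral>\<^sup>+y. ennreal (norm (G y - cond_mean \<kappa> G z) powr \<nu>) \<partial>\<kappa> z) \<le> ennreal c\<^sub>G"
    and expansion: "\<And>h. admissible_bandwidth \<phi> h \<Longrightarrow>
        small_o_prob M (\<lambda>n \<omega>. ennreal (norm (Rem (h n) n \<omega>))) (rate \<phi> \<beta> h)"
    and coord_var: "i\<^sub>0 \<in> I"
      "(coord_cond_var (\<psi> i\<^sub>0) L G \<kappa> \<longlongrightarrow> coord_cond_var (\<psi> i\<^sub>0) L G \<kappa> x) (at x)"
      "0 < coord_cond_var (\<psi> i\<^sub>0) L G \<kappa> x"
    and hb: "admissible_bandwidth \<phi> hb"
      "\<exists>c>0. \<exists>C. \<forall>\<^sub>F n in sequentially.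
         c \<le> hb n powr (2 * \<beta>) * real n * \<phi> (hb n) \<and> hb n powr (2 * \<beta>) * real n * \<phi> (hb n) \<le> C"
    and ab: "0 < a" "0 < b"
      "\<And>h. admissible_bandwidth \<phi> h \<Longrightarrow>
         \<forall>\<^sub>F n in sequentially.
           (\<integral>\<^sup>+\<omega>. ennreal ((norm (B (h n) n \<omega> + V (h n) n \<omega>))\<^sup>2) \<partial>M) \<le> ennreal (f n (h n))"
    and hop: "\<And>n. 0 < hop n"
      "\<forall>\<^sub>F n in sequentially. is_arg_min (f n) (\<lambda>h. h \<in> {0<..<1}) (hop n)"
    and F_smoother: "\<beta> < \<beta>\<^sub>1" "0 < b\<^sub>F'"
      "\<forall>\<^sub>F z in nhds x. norm (F z - F x) \<le> b\<^sub>F' * dist x z powr \<beta>\<^sub>1"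
  shows "small_o_prob M
           (\<lambda>n \<omega>. ennreal (norm (est (hop n) n \<omega> - \<Theta>)) / ennreal (norm (est (hb n) n \<omega> - \<Theta>)))
           (\<lambda>_. 1)
       \<and> ((\<forall>h\<in>{hb, hop}.
             (\<lambda>n. (\<integral>\<^sup>+\<omega>. ennreal ((norm (Rem (h n) n \<omega>))\<^sup>2) \<partial>M)
                    / ennreal ((rate \<phi> \<beta> h n)\<^sup>2)) \<longlonglongrightarrow> 0)
           \<longrightarrow> (\<lambda>n. (\<integral>\<^sup>+\<omega>. ennreal ((norm (est (hop n) n \<omega> - \<Theta>))\<^sup>2) \<partial>M)
                    / (\<integral>\<^sup>+\<omega>. ennreal ((norm (est (hb n) n \<omega> - \<Theta>))\<^sup>2) \<partial>M)) \<longlonglongrightarrow> 0)"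
proof -
  interpret prob_space M by (rule prob)
  interpret bw: bandwidth_choice \<phi> a b \<beta> C\<^sub>1 C\<^sub>2 C\<^sub>3 C\<^sub>4 t\<^sub>1 t\<^sub>2 t\<^sub>3 t\<^sub>4 hop
    using C_pos t_range small_ball ab F_smooth(1) hop by unfold_locales (auto simp: f_def)
  have hb_pos: "\<And>n. 0 < hb n" and hb_lim: "hb \<longlonglongrightarrow> 0"
    and hb_np: "filterlim (\<lambda>n. real n * \<phi> (hb n)) at_top sequentially"
    using hb(1) by (auto simp: admissible_bandwidth_def)
  obtain c C where c: "0 < c"
    and hb_bounds: "\<forall>\<^sub>F n in sequentially.
       c \<le> hb n powr (2 * \<beta>) * real n * \<phi> (hb n) \<and> hb n powr (2 * \<beta>) * real n * \<phi> (hb n) \<le> C"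
    using hb(2) by blast
  from hb_bounds have "\<forall>\<^sub>F n in sequentially. c \<le> hb n powr (2 * \<beta>) * real n * \<phi> (hb n)"
    by eventually_elim simp
  then obtain A where A: "0 < A" and hop_le: "\<forall>\<^sub>F n in sequentially. hop n \<le> A * hb n"
    using bw.hop_le_const_mult[OF hb(1) c] by blast
  \<comment> \<open>The common scale: the error at \<open>hop\<close> will be shown to be of smaller
    order than \<open>r\<close>, and the error at \<open>hb\<close> to stay away from 0 relative to
    \<open>r\<close>.\<close>
  define r where "r n = hb n powr \<beta>" for n
  have r: "0 < r n" for n using hb_pos[of n] by (simp add: r_def)
  have r_bound: "\<forall>\<^sub>F n in sequentially. hop n powr \<beta> \<le> A powr \<beta> * r n"
    using hop_le
  proof eventually_elim
    case (elim n)
    then have "hop n powr \<beta> \<le> (A * hb n) powr \<beta>"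
      using hop(1)[of n] F_smooth(1) by (intro powr_mono2) auto
    then show ?case using A hb_pos[of n] by (simp add: r_def powr_mult)
  qed

  \<comment> \<open>Half of the limit is a lower bound on a punctured neighborhood; at
    \<open>x\<close> itself, which the filter omits, it is half of the value there.\<close>
  define v where "v = coord_cond_var (\<psi> i\<^sub>0) L G \<kappa> x / 2"
  have v: "0 < v" using coord_var(3) by (simp add: v_def)
  have "\<forall>\<^sub>F z in at x. v < coord_cond_var (\<psi> i\<^sub>0) L G \<kappa> z"
    using coord_var(2,3) by (intro order_tendstoD(1)) (auto simp: v_def)
  then have "\<forall>\<^sub>F z in nhds x. z \<noteq> x \<longrightarrow> v < coord_cond_var (\<psi> i\<^sub>0) L G \<kappa> z"
    by (simp add: eventually_at_filter)
  then have "\<forall>\<^sub>F z in nhds x. v \<le> coord_cond_var (\<psi> i\<^sub>0) L G \<kappa> z"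
  proof eventually_elim
    case (elim z)
    then show ?case using v by (cases "z = x") (auto simp: v_def)
  qed
  then have "\<forall>\<^sub>F z in nhds x. v \<le> coord_cond_var (\<psi> i\<^sub>0) L G \<kappa> z \<and>
      (\<integral>\<^sup>+y. ennreal (norm (G y - cond_mean \<kappa> G z) powr \<nu>) \<partial>\<kappa> z) \<le> ennreal c\<^sub>G \<and>
      norm (F z - F x) \<le> b\<^sub>F' * dist x z powr \<beta>\<^sub>1"
    using G_moment(2) F_smoother(3) by eventually_elim simp
  then obtain d where d: "0 < d" and near: "\<And>z. dist z x < d \<Longrightarrow> v \<le> coord_cond_var (\<psi> i\<^sub>0) L G \<kappa> z \<and>
      (\<integral>\<^sup>+y. ennreal (norm (G y - cond_mean \<kappa> G z) powr \<nu>) \<partial>\<kappa> z) \<le> ennreal c\<^sub>G \<and>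
      norm (F z - F x) \<le> b\<^sub>F' * dist x z powr \<beta>\<^sub>1"
    unfolding eventually_nhds_metric by blast
  \<comment> \<open>Half the radius puts the closed ball of the locale inside the open one obtained
    from the neighborhood filter.\<close>
  define \<rho> where "\<rho> = d / 2"
  have \<rho>: "0 < \<rho>" using d by (simp add: \<rho>_def)
  have in_ball: "dist z x < d" if "dist x z \<le> \<rho>" for z
    using that d by (simp add: \<rho>_def dist_commute)
  obtain \<Lambda> where \<Lambda>: "0 < \<Lambda>" "\<And>u. norm (L u) \<le> norm u * \<Lambda>"
    using bounded_linear.pos_bounded[OF L_lin] by blast
  have \<psi>_lin: "bounded_linear (\<psi> i\<^sub>0)"
    using coords coord_var(1) by (simp add: coordinate_functionals_def)
  obtain N where N: "0 < N" "\<And>u. norm (\<psi> i\<^sub>0 u) \<le> norm u * N"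
    using bounded_linear.pos_bounded[OF \<psi>_lin] by blast

  \<comment> \<open>\<open>c\<^sub>G\<close> may be negative, where \<open>ennreal\<close> reads it
    as 0, while the locale asks for a nonnegative constant; hence
    \<open>max 0 c\<^sub>G\<close>.\<close>
  interpret S: kernel_noise_functional M R X Y Xs Ys \<kappa> x K l\<^sub>K L\<^sub>K G L \<nu> "max 0 c\<^sub>G" \<rho> \<Lambda> "\<psi> i\<^sub>0" N v
  proof (intro kernel_noise_functional.intro kernel_noise.intro kernel_sample.intro
      kernel_sample_axioms.intro kernel_noise_axioms.intro kernel_noise_functional_axioms.intro prob)
    fix z assume "dist x z \<le> \<rho>"
    then have z: "dist z x < d" by (rule in_ball)
    show "(\<integral>\<^sup>+y. ennreal (norm (G y - cond_mean \<kappa> G z) powr \<nu>) \<partial>\<kappa> z) \<le> ennreal (max 0 c\<^sub>G)"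
      using near[OF z] by (auto elim!: order_trans intro!: ennreal_leI)
    show "v \<le> coord_cond_var (\<psi> i\<^sub>0) L G \<kappa> z"
      using near[OF z] by simp
  next
    show "norm (L u) \<le> \<Lambda> * norm u" for u using \<Lambda>(2)[of u] by (simp add: mult.commute)
    show "\<bar>\<psi> i\<^sub>0 u\<bar> \<le> N * norm u" for u using N(2)[of u] by (simp add: mult.commute)
  qed (use X_meas Y_meas sample_indep sample_law rcd K_meas K_bounds G_meas L_lin G_moment(1) \<Lambda>(1) N(1) v \<psi>_lin in auto)

  have F_ball: "norm (F z - F x) \<le> b\<^sub>F' * dist x z powr \<beta>\<^sub>1" if "dist x z \<le> \<rho>" for z
    using near[OF in_ball[OF that]] by simp
  \<comment> \<open>An identity by the definition of the remainder; the content of the expansion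
    hypothesis is the size of the last term.\<close>
  have est_eq: "est h n \<omega> - \<Theta> = (B h n \<omega> + V h n \<omega>) + Rem h n \<omega>" for h n \<omega>
    by (simp add: est_def \<Theta>_def B_def V_def Rem_def remainder_term_def)
  have B_meas [measurable]: "B h n \<in> borel_measurable M" if "0 < h" for h n
    unfolding B_def using S.bias_meas[OF F_meas that, of n] .
  have V_meas [measurable]: "V h n \<in> borel_measurable M" if "0 < h" for h n
    unfolding V_def using S.noise_meas[OF that, of n] .
  have Rem_meas [measurable]: "Rem h n \<in> borel_measurable M" if "0 < h" for h n
  proof -
    have [measurable]: "est h n \<in> borel_measurable M" "B h n \<in> borel_measurable M" "V h n \<in> borel_measurable M"
      using that est_meas B_meas V_meas by auto
    have "Rem h n = (\<lambda>\<omega>. est h n \<omega> - \<Theta> - (B h n \<omega> + V h n \<omega>))"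
      by (simp add: fun_eq_iff est_eq)
    then show ?thesis by simp
  qed
  have meas [measurable]:
    "\<And>n. B (hop n) n \<in> borel_measurable M" "\<And>n. V (hop n) n \<in> borel_measurable M"
    "\<And>n. Rem (hop n) n \<in> borel_measurable M" "\<And>n. est (hop n) n \<in> borel_measurable M"
    "\<And>n. B (hb n) n \<in> borel_measurable M" "\<And>n. V (hb n) n \<in> borel_measurable M"
    "\<And>n. Rem (hb n) n \<in> borel_measurable M" "\<And>n. est (hb n) n \<in> borel_measurable M"
    using hop(1) hb_pos B_meas V_meas Rem_meas est_meas by blast+

  have BV_lim: "(\<lambda>n. (\<integral>\<^sup>+\<omega>. ennreal ((norm (B (hop n) n \<omega> + V (hop n) n \<omega>))\<^sup>2) \<partial>M) / ennreal ((r n)\<^sup>2)) \<longlonglongrightarrow> 0"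
    unfolding B_def V_def
    using S.bias_noise_ratio_tendsto_0[OF type2 coords F_meas \<rho> less_imp_le[OF F_smoother(2)] F_smooth(1) F_smoother(1)
      F_ball hop(1) bw.hop_tendsto_0, folded \<phi>_def, OF _ bw.hop_signal_to_noise _ r_bound r] A by simp

  \<comment> \<open>Once the signal-to-noise product is at least 1, the stochastic entry of the
    maximum is at most \<open>hop n powr \<beta>\<close>, so the bias entry decides the
    rate.\<close>
  have rate_hop: "\<forall>\<^sub>F n in sequentially. rate \<phi> \<beta> hop n \<le> A powr \<beta> * r n"
    using r_bound bw.hop_signal_to_noise[unfolded filterlim_at_top, rule_format, of 1]
  proof eventually_elim
    case (elim n)
    let ?np = "real n * \<phi> (hop n)"
    have hp: "0 < hop n powr (2 * \<beta>)" using hop(1)[of n] by simp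
    then have np: "1 / hop n powr (2 * \<beta>) \<le> ?np" using elim(2) by (simp add: field_simps)
    have "?np powr (- 1 / 2) \<le> (1 / hop n powr (2 * \<beta>)) powr (- 1 / 2)"
      using np hp by (intro powr_mono2') auto
    also have "\<dots> = hop n powr \<beta>"
      using hop(1)[of n] by (simp add: powr_divide powr_powr powr_minus_divide)
    finally show ?case using elim(1) by (simp add: rate_def)
  qed
  \<comment> \<open>At \<open>hb\<close> the two entries of the maximum are balanced: the lower
    bound \<open>c\<close> makes the stochastic one at most
    \<open>c powr (- 1 / 2) * r n\<close>.\<close>
  have rate_hb: "\<forall>\<^sub>F n in sequentially. rate \<phi> \<beta> hb n \<le> max 1 (c powr (- 1 / 2)) * r n"
    using hb_bounds
  proof eventually_elim
    case (elim n)
    let ?np = "real n * \<phi> (hb n)"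
    have hp: "0 < hb n powr (2 * \<beta>)" using hb_pos[of n] by simp
    then have np: "c / hb n powr (2 * \<beta>) \<le> ?np" using elim by (simp add: field_simps)
    have "?np powr (- 1 / 2) \<le> (c / hb n powr (2 * \<beta>)) powr (- 1 / 2)"
      using np hp c by (intro powr_mono2') auto
    also have "\<dots> = c powr (- 1 / 2) * r n"
      using hb_pos[of n] c by (simp add: r_def powr_divide powr_powr powr_minus_divide)
    also have "\<dots> \<le> max 1 (c powr (- 1 / 2)) * r n" using r[of n] by (intro mult_right_mono) auto
    finally have "?np powr (- 1 / 2) \<le> max 1 (c powr (- 1 / 2)) * r n" .
    moreover have "1 * r n \<le> max 1 (c powr (- 1 / 2)) * r n" using r[of n] by (intro mult_right_mono) auto
    ultimately show ?case by (simp add: rate_def r_def)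
  qed
  have rate_nonneg: "0 \<le> rate \<phi> \<beta> h n" for h n by (simp add: rate_def max_def)

  have neg_Rem_hop: "o_prob (\<lambda>n \<omega>. norm (Rem (hop n) n \<omega>)) r"
    using A rate_hop rate_nonneg
    by (intro o_prob_if_small_o_prob[OF expansion[OF bw.hop_admissible]]) (auto elim: eventually_mono)
  have neg_Rem_hb: "o_prob (\<lambda>n \<omega>. norm (Rem (hb n) n \<omega>)) r"
    using rate_hb rate_nonneg
    by (intro o_prob_if_small_o_prob[OF expansion[OF hb(1)], of "max 1 (c powr (- 1 / 2))"]) (auto elim: eventually_mono)
  have neg_BV_hop: "o_prob (\<lambda>n \<omega>. norm (B (hop n) n \<omega> + V (hop n) n \<omega>)) r"
    by (rule o_prob_if_second_moment[OF BV_lim r]) auto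
  have neg_hop: "o_prob (\<lambda>n \<omega>. norm (est (hop n) n \<omega> - \<Theta>)) r"
    by (rule o_prob_mono[OF o_prob_add[OF neg_BV_hop neg_Rem_hop]])
      (auto simp: est_eq norm_triangle_ineq)

  have neg_B_hb: "o_prob (\<lambda>n \<omega>. norm (B (hb n) n \<omega>)) r"
    unfolding B_def r_def
    using S.bias_o_prob[OF F_meas \<rho> less_imp_le[OF F_smoother(2)] F_smooth(1) F_smoother(1)
      F_ball hb_pos hb_lim, folded \<phi>_def, OF _ hb_np] by simp
  have away_V: "away_from_0 (\<lambda>n \<omega>. norm (V (hb n) n \<omega>)) r"
    unfolding away_from_0_def
  proof (intro allI impI)
    fix \<eta> :: real assume \<eta>: "0 < \<eta>"
    obtain \<delta> where \<delta>: "0 < \<delta>" and ev: "\<forall>\<^sub>F n in sequentially.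
        prob {\<omega>\<in>space M. norm (V (hb n) n \<omega>) \<le> \<delta> / sqrt (real n * \<phi> (hb n))} \<le> \<eta>"
      using S.noise_anticoncentration[OF hb_pos hb_lim \<rho>, folded \<phi>_def, OF hb_np \<eta>] unfolding V_def by blast
    \<comment> \<open>\<open>C\<close> comes without a sign; a positive bound is required to divide
      by its root.\<close>
    define C' where "C' = max 1 C"
    have C': "0 < C'" by (simp add: C'_def)
    have "\<forall>\<^sub>F n in sequentially. prob {\<omega>\<in>space M. norm (V (hb n) n \<omega>) \<le> \<delta> / sqrt C' * r n} \<le> \<eta>"
      using ev hb_bounds
    proof eventually_elim
      case (elim n)
      let ?np = "real n * \<phi> (hb n)"
      have hp: "0 < hb n powr (2 * \<beta>)" using hb_pos[of n] by simp
      have "0 < hb n powr (2 * \<beta>) * ?np" using elim(2) c by (simp add: mult.assoc)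
      then have np: "0 < ?np" using hp by (simp add: zero_less_mult_iff)
      have "(hb n powr \<beta>)\<^sup>2 = hb n powr (2 * \<beta>)"
        by (simp add: power2_eq_square powr_add[symmetric])
      then have "(r n * sqrt ?np)\<^sup>2 = hb n powr (2 * \<beta>) * ?np"
        using np by (simp add: power_mult_distrib r_def)
      also have "\<dots> \<le> C'" using elim(2) by (simp add: C'_def mult.assoc le_max_iff_disj)
      finally have "r n * sqrt ?np \<le> sqrt C'" by (rule real_le_rsqrt)
      then have "\<delta> / sqrt C' * r n \<le> \<delta> / sqrt ?np"
        using \<delta> C' np by (simp add: field_simps)
      then have "prob {\<omega>\<in>space M. norm (V (hb n) n \<omega>) \<le> \<delta> / sqrt C' * r n}
          \<le> prob {\<omega>\<in>space M. norm (V (hb n) n \<omega>) \<le> \<delta> / sqrt ?np}"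
        by (intro finite_measure_mono) auto
      then show ?case using elim(1) by linarith
    qed
    then show "\<exists>\<delta>>0. \<forall>\<^sub>F n in sequentially. prob {\<omega>\<in>space M. norm (V (hb n) n \<omega>) \<le> \<delta> * r n} \<le> \<eta>"
      using \<delta> C' by (intro exI[of _ "\<delta> / sqrt C'"]) auto
  qed
  \<comment> \<open>The noise is the total error minus bias and remainder; as the latter two are
    negligible on the scale \<open>r\<close>, they cannot cancel it.\<close>
  have away_hb: "away_from_0 (\<lambda>n \<omega>. norm (est (hb n) n \<omega> - \<Theta>)) r"
  proof (rule away_from_0_perturb[OF away_V o_prob_add[OF neg_B_hb neg_Rem_hb]])
    fix n \<omega>
    have "V (hb n) n \<omega> = (est (hb n) n \<omega> - \<Theta>) - (B (hb n) n \<omega> + Rem (hb n) n \<omega>)"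
      by (simp add: est_eq)
    then show "norm (V (hb n) n \<omega>)
        \<le> norm (est (hb n) n \<omega> - \<Theta>) + (norm (B (hb n) n \<omega>) + norm (Rem (hb n) n \<omega>))"
      using norm_triangle_ineq4[of "est (hb n) n \<omega> - \<Theta>" "B (hb n) n \<omega> + Rem (hb n) n \<omega>"]
        norm_triangle_ineq[of "B (hb n) n \<omega>" "Rem (hb n) n \<omega>"] by simp
  qed (auto intro: less_imp_le r)

  show ?thesis
  proof (intro conjI impI)
    show "small_o_prob M (\<lambda>n \<omega>. ennreal (norm (est (hop n) n \<omega> - \<Theta>)) / ennreal (norm (est (hb n) n \<omega> - \<Theta>))) (\<lambda>_. 1)"
      by (rule small_o_prob_ratio[OF neg_hop away_hb r]) auto
  next
    assume "\<forall>h\<in>{hb, hop}. (\<lambda>n. (\<integral>\<^sup>+\<omega>. ennreal ((norm (Rem (h n) n \<omega>))\<^sup>2) \<partial>M)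
                    / ennreal ((rate \<phi> \<beta> h n)\<^sup>2)) \<longlonglongrightarrow> 0"
    then have Rem_lim: "(\<lambda>n. (\<integral>\<^sup>+\<omega>. ennreal ((norm (Rem (hop n) n \<omega>))\<^sup>2) \<partial>M)
        / ennreal ((rate \<phi> \<beta> hop n)\<^sup>2)) \<longlonglongrightarrow> 0"
      by simp
    let ?I = "\<lambda>n. \<integral>\<^sup>+\<omega>. ennreal ((norm (B (hop n) n \<omega> + V (hop n) n \<omega>))\<^sup>2) \<partial>M"
    let ?J = "\<lambda>n. \<integral>\<^sup>+\<omega>. ennreal ((norm (Rem (hop n) n \<omega>))\<^sup>2) \<partial>M"
    \<comment> \<open>The squared factor by which \<open>rate\<close> at \<open>hop\<close> may
      exceed \<open>r\<close>; it converts the remainder hypothesis, stated relative to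
      \<open>rate\<close>, to the scale \<open>r\<close>.\<close>
    define q where "q = (A powr \<beta>)\<^sup>2"
    have q: "0 < q" using A by (simp add: q_def)
    have lim: "(\<lambda>n. ennreal 2 * (?I n / ennreal ((r n)\<^sup>2))
        + ennreal (2 * q) * (?J n / ennreal ((rate \<phi> \<beta> hop n)\<^sup>2))) \<longlonglongrightarrow> ennreal 2 * 0 + ennreal (2 * q) * 0"
      by (intro tendsto_add ennreal_tendsto_cmult BV_lim Rem_lim) auto
    then have lim': "(\<lambda>n. ennreal 2 * (?I n / ennreal ((r n)\<^sup>2))
        + ennreal (2 * q) * (?J n / ennreal ((rate \<phi> \<beta> hop n)\<^sup>2))) \<longlonglongrightarrow> 0"
      by (simp only: mult_zero_right add_0_left)
    have "(\<lambda>n. (\<integral>\<^sup>+\<omega>. ennreal ((norm (est (hop n) n \<omega> - \<Theta>))\<^sup>2) \<partial>M) / ennreal ((r n)\<^sup>2)) \<longlonglongrightarrow> 0"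
    proof (rule tendsto_sandwich[OF _ _ tendsto_const lim'])
      show "\<forall>\<^sub>F n in sequentially. (\<integral>\<^sup>+\<omega>. ennreal ((norm (est (hop n) n \<omega> - \<Theta>))\<^sup>2) \<partial>M) / ennreal ((r n)\<^sup>2)
        \<le> ennreal 2 * (?I n / ennreal ((r n)\<^sup>2)) + ennreal (2 * q) * (?J n / ennreal ((rate \<phi> \<beta> hop n)\<^sup>2))"
        using rate_hop
      proof eventually_elim
        case (elim n)
        have rate_pos: "0 < rate \<phi> \<beta> hop n" using hop(1)[of n] by (simp add: rate_def less_max_iff_disj)
        have "(\<integral>\<^sup>+\<omega>. ennreal ((norm (est (hop n) n \<omega> - \<Theta>))\<^sup>2) \<partial>M)
            \<le> (\<integral>\<^sup>+\<omega>. ennreal 2 * ennreal ((norm (B (hop n) n \<omega> + V (hop n) n \<omega>))\<^sup>2)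
                 + ennreal 2 * ennreal ((norm (Rem (hop n) n \<omega>))\<^sup>2) \<partial>M)"
        proof (intro nn_integral_mono)
          fix \<omega>
          show "ennreal ((norm (est (hop n) n \<omega> - \<Theta>))\<^sup>2)
              \<le> ennreal 2 * ennreal ((norm (B (hop n) n \<omega> + V (hop n) n \<omega>))\<^sup>2)
                + ennreal 2 * ennreal ((norm (Rem (hop n) n \<omega>))\<^sup>2)"
            unfolding est_eq by (rule ennreal_norm_add_power2_le)
        qed
        also have "\<dots> = ennreal 2 * ?I n + ennreal 2 * ?J n"
          by (subst nn_integral_add, measurable, subst (1 2) nn_integral_cmult) measurable
        finally have "(\<integral>\<^sup>+\<omega>. ennreal ((norm (est (hop n) n \<omega> - \<Theta>))\<^sup>2) \<partial>M) / ennreal ((r n)\<^sup>2)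
            \<le> (ennreal 2 * ?I n + ennreal 2 * ?J n) / ennreal ((r n)\<^sup>2)"
          by (rule divide_right_mono_ennreal)
        also have "\<dots> = ennreal 2 * (?I n / ennreal ((r n)\<^sup>2)) + ennreal 2 * (?J n / ennreal ((r n)\<^sup>2))"
          by (simp only: divide_ennreal_def distrib_right mult.assoc)
        also have "?J n / ennreal ((r n)\<^sup>2) \<le> ?J n / ennreal ((rate \<phi> \<beta> hop n)\<^sup>2 / q)"
        proof (rule ennreal_divide_le_divide)
          have "(rate \<phi> \<beta> hop n)\<^sup>2 \<le> (A powr \<beta> * r n)\<^sup>2" using elim rate_pos by (intro power_mono) auto
          then show "ennreal ((rate \<phi> \<beta> hop n)\<^sup>2 / q) \<le> ennreal ((r n)\<^sup>2)"
            using q by (intro ennreal_leI) (simp add: q_def power_mult_distrib field_simps)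
        qed (use rate_pos q in simp)
        also have "?J n / ennreal ((rate \<phi> \<beta> hop n)\<^sup>2 / q) = ennreal q * (?J n / ennreal ((rate \<phi> \<beta> hop n)\<^sup>2))"
        proof -
          have "inverse (ennreal ((rate \<phi> \<beta> hop n)\<^sup>2 / q)) = ennreal q * inverse (ennreal ((rate \<phi> \<beta> hop n)\<^sup>2))"
            using rate_pos q by (simp add: inverse_ennreal divide_inverse flip: ennreal_mult)
          then show ?thesis by (simp add: divide_ennreal_def ac_simps)
        qed
        finally show ?case using q by (simp add: ennreal_mult mult.assoc mult_left_mono add_left_mono)
      qed
    qed auto
    then show "(\<lambda>n. (\<integral>\<^sup>+\<omega>. ennreal ((norm (est (hop n) n \<omega> - \<Theta>))\<^sup>2) \<partial>M)
        / (\<integral>\<^sup>+\<omega>. ennreal ((norm (est (hb n) n \<omega> - \<Theta>))\<^sup>2) \<partial>M)) \<longlonglongrightarrow> 0"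
      by (rule second_moment_ratio[OF _ away_hb r]) auto
  qed
qed

end
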